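(* Under the standing model and assumptions below, assume $E(\Vert\varepsilon\Vert^2)<\infty$ and $E(\Vert Z\Vert^3)<\infty$, that $W^0$ is an interior point of $\Theta_s$, and that the matrix $I_0$ defined below is invertible. Let $\nabla U_n(W^0)$ denote the gradient and $HU_n(W^0)$ the Hessian matrix of $W\mapsto U_n(W)$ at $W^0$, and let $\hat W_n\in\arg\min_{W\in\Theta_s}U_n(W)$. Then, as $n\to\infty$: <ol> <li>$HU_n(W^0)\to 2I_0$ almost surely;</li> <li>$\sqrt n\,\nabla U_n(W^0)$ converges in law to $\mathcal N(0,4I_0)$;</li> <li>$\sqrt n\,(\hat W_n-W^0)$ converges in law to $\mathcal N(0,I_0^{-1})$.</li> </ol> Here $I_0$ is the $s\times s$ matrix whose $(k,l)$ entry is \[ (I_0)_{k,l}=\operatorname{tr}\Big(\Gamma_0^{-1}\,E\Big[\frac{\partial F_{W^0}(Z)}{\partial W_k}\Big(\frac{\partial F_{W^0}(Z)}{\partial W_l}\Big)^T\Big]\Big), \] with $\Gamma_0=\Gamma(W^0)$ and $\frac{\partial F_W(Z)}{\partial W_k}\in\mathbb R^d$ the vector of partial derivatives of the components of $F_W(Z)$ with respect to the $k$-th weight.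
   Context: Let $(Y_t,Z_t)_{t\in\mathbb N}$ be i.i.d. random vectors in $\mathbb R^d\times\mathbb R^{d'}$, each with the law of a generic pair $(Y,Z)$. The model is $Y_t=F_{W^0}(Z_t)+\varepsilon_t$, where for a weight vector $W$, $F_W:\mathbb R^{d'}\to\mathbb R^d$ is the function computed by a one-hidden-layer multilayer perceptron with weights $W$ and sigmoidal activation functions in the hidden units, and $W^0$ is the true weight vector. The noise $(\varepsilon_t)$ is i.i.d., centered, independent of the inputs $(Z_t)$, with invertible covariance matrix; $\varepsilon$ denotes a generic variable with the law of $\varepsilon_t$. The parameter set $\Theta_s\subset\mathbb R^s$ is compact, and contains $W^0$. Parameters are considered modulo the finite group of weight transformations leaving $F_W$ invariant, and the model is assumed identifiable in this quotient space: $F_W=F_{W^0}$ almost surely on the support of $Z$ implies $W=W^0$ (e.g. the number of hidden units is the true one). Define \[ \Gamma_n(W)=\frac1n\sum_{t=1}^n (Y_t-F_W(Z_t))(Y_t-F_W(Z_t))^T,\qquad U_n(W)=\ln\det\Gamma_n(W), \] and $\Gamma(W)=E\big[(Y-F_W(Z))(Y-F_W(Z))^T\big]$, so $\Gamma(W^0)$ is the (invertible) noise covariance. *)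

theory Defs
  imports "HOL-Probability.Probability"
begin

text \<open>Sigmoidal activation function: strictly increasing, bounded, with finite
  (distinct) limits at minus and plus infinity, and three times differentiable
  with continuous, bounded derivatives (smoothness needed for gradients/Hessians).\<close>
definition sigmoidal :: "(real \<Rightarrow> real) \<Rightarrow> bool" where
  "sigmoidal \<phi> \<longleftrightarrow>
     strict_mono \<phi> \<and> bounded (range \<phi>) \<and>
     (\<exists>a b. a < b \<and> (\<phi> \<longlongrightarrow> a) at_bot \<and> (\<phi> \<longlongrightarrow> b) at_top) \<and>
     (\<exists>\<phi>1 \<phi>2 \<phi>3. (\<forall>x. (\<phi> has_real_derivative \<phi>1 x) (at x)) \<and>
                 (\<forall>x. (\<phi>1 has_real_derivative \<phi>2 x) (at x)) \<and>
                 (\<forall>x. (\<phi>2 has_real_derivative \<phi>3 x) (at x)) \<and>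
                 continuous_on UNIV \<phi>3 \<and>
                 bounded (range \<phi>1) \<and> bounded (range \<phi>2) \<and> bounded (range \<phi>3))"

text \<open>Weights of a one-hidden-layer perceptron with inputs in real^'e,
  hidden units indexed by 'h and outputs in real^'d:
  ((input-to-hidden weights, hidden biases), (hidden-to-output weights, output biases)).
  This is a Euclidean space of dimension s = h(d'+1) + d(h+1).\<close>
type_synonym ('e, 'h, 'd) mlp_weights =
  "(((real^'e)^'h) \<times> (real^'h)) \<times> (((real^'h)^'d) \<times> (real^'d))"

definition mlp :: "(real \<Rightarrow> real) \<Rightarrow> ('e::finite, 'h::finite, 'd::finite) mlp_weights
                    \<Rightarrow> real^'e \<Rightarrow> real^'d" where
  "mlp \<phi> W z = (\<chi> i. snd (snd W) $ i +
      (\<Sum>j\<in>UNIV. fst (snd W) $ i $ j * \<phi> (snd (fst W) $ j + fst (fst W) $ j \<bullet> z)))"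

definition outer :: "real^'d \<Rightarrow> real^'d \<Rightarrow> real^'d^'d" where
  "outer x y = (\<chi> i j. x $ i * y $ j)"

definition Gamma_n ::
  "(real \<Rightarrow> real) \<Rightarrow> (nat \<Rightarrow> 'a \<Rightarrow> real^'d) \<Rightarrow> (nat \<Rightarrow> 'a \<Rightarrow> real^'e)
   \<Rightarrow> nat \<Rightarrow> 'a \<Rightarrow> ('e::finite, 'h::finite, 'd::finite) mlp_weights \<Rightarrow> real^'d^'d" where
  "Gamma_n \<phi> Y Z n \<omega> W = (1 / real n) *\<^sub>R
     (\<Sum>t<n. outer (Y t \<omega> - mlp \<phi> W (Z t \<omega>)) (Y t \<omega> - mlp \<phi> W (Z t \<omega>)))"

definition U_n ::
  "(real \<Rightarrow> real) \<Rightarrow> (nat \<Rightarrow> 'a \<Rightarrow> real^'d) \<Rightarrow> (nat \<Rightarrow> 'a \<Rightarrow> real^'e)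
   \<Rightarrow> nat \<Rightarrow> 'a \<Rightarrow> ('e::finite, 'h::finite, 'd::finite) mlp_weights \<Rightarrow> real" where
  "U_n \<phi> Y Z n \<omega> W = ln (det (Gamma_n \<phi> Y Z n \<omega> W))"

definition gradient :: "('w::euclidean_space \<Rightarrow> real) \<Rightarrow> 'w \<Rightarrow> 'w" where
  "gradient f x = (\<Sum>b\<in>Basis. frechet_derivative f (at x) b *\<^sub>R b)"

definition hessian :: "('w::euclidean_space \<Rightarrow> real) \<Rightarrow> 'w \<Rightarrow> 'w \<Rightarrow> 'w \<Rightarrow> real" where
  "hessian f x b b' = frechet_derivative (\<lambda>y. frechet_derivative f (at y) b) (at x) b'"

definition mat_op :: "('w::euclidean_space \<Rightarrow> 'w \<Rightarrow> real) \<Rightarrow> 'w \<Rightarrow> 'w" where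
  "mat_op A v = (\<Sum>b\<in>Basis. (\<Sum>b'\<in>Basis. A b b' * (v \<bullet> b')) *\<^sub>R b)"

definition normal_law :: "real \<Rightarrow> real measure" where
  "normal_law v = (if v = 0 then return borel 0 else density lborel (normal_density 0 (sqrt v)))"

definition gaussian_law :: "'w::euclidean_space measure \<Rightarrow> ('w \<Rightarrow> 'w) \<Rightarrow> bool" where
  "gaussian_law \<mu> C \<longleftrightarrow> sets \<mu> = sets borel \<and> prob_space \<mu> \<and>
     (\<forall>t. distr \<mu> borel (\<lambda>x. t \<bullet> x) = normal_law (t \<bullet> C t))"

definition conv_in_law :: "'a measure \<Rightarrow> (nat \<Rightarrow> 'a \<Rightarrow> 'w::euclidean_space) \<Rightarrow> 'w measure \<Rightarrow> bool" where
  "conv_in_law M X \<mu> \<longleftrightarrow>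
     (\<forall>f :: 'w \<Rightarrow> real. continuous_on UNIV f \<and> bounded (range f) \<longrightarrow>
        (\<lambda>n. \<integral>\<omega>. f (X n \<omega>) \<partial>M) \<longlonglongrightarrow> (\<integral>x. f x \<partial>\<mu>))"

end

theory Submission
  imports Defs
begin

text \<open>
  Write \<open>\<Gamma>n(W)\<close> for the empirical residual second moment matrix, so \<open>Un = ln det \<Gamma>n\<close>. By Jacobi's formula the gradient of
  \<open>Un\<close> is \<open>tr (\<Gamma>n\<^sup>-\<^sup>1 D\<Gamma>n)\<close> and its Hessian is \<open>tr (\<Gamma>n\<^sup>-\<^sup>1 D\<^sup>2\<Gamma>n) - tr (\<Gamma>n\<^sup>-\<^sup>1 D\<Gamma>n \<Gamma>n\<^sup>-\<^sup>1 D\<Gamma>n)\<close>.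
  A uniform strong law on the compact parameter set gives the almost sure limits of \<open>\<Gamma>n\<close>, \<open>D\<Gamma>n\<close> and \<open>D\<^sup>2\<Gamma>n\<close>; at the true weights
  the terms that contain the noise linearly average out, which leaves the Hessian \<open>2 I0\<close>. Up to a factor that tends to the identity
  the normalised gradient is a normalised sum of i.i.d. centred vectors with covariance \<open>4 I0\<close>. Identifiability makes the true weights the unique
  minimiser of the limiting criterion, hence the estimator is consistent, and a Newton step from the true weights transfers
  the limit law of the gradient to the estimator.
\<close>

section \<open>Strong law of large numbers\<close>

text \<open>Moments are scarce: the second derivative of the squared residual contains the noise
  times a term that grows like the square of the input. Independence makes such products integrable
  as soon as each factor is, and so one integrable envelope dominates the squared residual and both
  its derivatives over the whole parameter set. In place of a Taylor remainder, the Hessian is shown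
  to converge jointly in \<open>n\<close> and in the weights near the true ones, and the mean value
  inequality does the rest. The random inverse matrix in the gradient is handled by comparison with
  a random majorant bounded in mean square: almost surely the error is eventually at most any
  prescribed multiple of it. This form serves the gradient and the estimator alike, and no rate of
  convergence of the estimator has to be known beforehand. The last obstacle is
  \<open>ln (det ...)\<close> at singular matrices, which always occur when \<open>n\<close> is
  below the output dimension: formulas for the derivatives hold only eventually and almost surely,
  whereas measurability has to be settled at every outcome.\<close>

lemma distr_pair_snd_prob:
  assumes "prob_space M" "prob_space N"
  shows "distr (M \<Otimes>\<^sub>M N) N snd = N"
proof (rule measure_eqI)
  interpret M: prob_space M by fact
  interpret N: prob_space N by fact
  fix A assume "A \<in> sets (distr (M \<Otimes>\<^sub>M N) N snd)"
  then have A: "A \<in> sets N" by simp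
  have "snd -` A \<inter> space (M \<Otimes>\<^sub>M N) = space M \<times> A"
    using sets.sets_into_space[OF A] by (auto simp: space_pair_measure)
  then show "emeasure (distr (M \<Otimes>\<^sub>M N) N snd) A = emeasure N A"
    using A by (simp add: emeasure_distr N.emeasure_pair_measure_Times M.emeasure_space_1)
qed simp

lemma distr_pair_fst_prob:
  assumes "prob_space M" "prob_space N"
  shows "distr (M \<Otimes>\<^sub>M N) M fst = M"
proof (rule measure_eqI)
  interpret M: prob_space M by fact
  interpret N: prob_space N by fact
  fix A assume "A \<in> sets (distr (M \<Otimes>\<^sub>M N) M fst)"
  then have A: "A \<in> sets M" by simp
  have "fst -` A \<inter> space (M \<Otimes>\<^sub>M N) = A \<times> space N"
    using sets.sets_into_space[OF A] by (auto simp: space_pair_measure)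
  then show "emeasure (distr (M \<Otimes>\<^sub>M N) M fst) A = emeasure M A"
    using A by (simp add: emeasure_distr N.emeasure_pair_measure_Times N.emeasure_space_1)
qed simp

text \<open>This is the maximum of \<open>0\<close> and the first \<open>n\<close> partial sums. The
  recursion passes to the shifted sequence: the largest sum that uses the first term is that term
  plus the largest sum of the remaining sequence. This is the identity on which Garsia's argument
  rests.\<close>

fun max_partial_sum :: "('v \<Rightarrow> real) \<Rightarrow> nat \<Rightarrow> (nat \<Rightarrow> 'v) \<Rightarrow> real" where
  "max_partial_sum x 0 \<omega> = 0"
| "max_partial_sum x (Suc n) \<omega> = max 0 (x (\<omega> 0) + max_partial_sum x n (\<lambda>i. \<omega> (Suc i)))"

lemma max_partial_sum_nonneg: "0 \<le> max_partial_sum x n \<omega>"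
  by (cases n) auto

lemma max_partial_sum_mono_Suc: "max_partial_sum x n \<omega> \<le> max_partial_sum x (Suc n) \<omega>"
proof (induction n arbitrary: \<omega>)
  case (Suc n)
  have "max_partial_sum x n (\<lambda>i. \<omega> (Suc i)) \<le> max_partial_sum x (Suc n) (\<lambda>i. \<omega> (Suc i))"
    by (rule Suc)
  then show ?case
    by (subst (1 2) max_partial_sum.simps) (simp del: max_partial_sum.simps add: max.coboundedI2)
qed simp

lemma max_partial_sum_mono: "m \<le> n \<Longrightarrow> max_partial_sum x m \<omega> \<le> max_partial_sum x n \<omega>"
  by (rule lift_Suc_mono_le[where f="\<lambda>n. max_partial_sum x n \<omega>"]) (rule max_partial_sum_mono_Suc)

lemma sum_le_max_partial_sum: "(\<Sum>i<n. x (\<omega> i)) \<le> max_partial_sum x n \<omega>"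
proof (induction n arbitrary: \<omega>)
  case (Suc n)
  have "(\<Sum>i<Suc n. x (\<omega> i)) = x (\<omega> 0) + (\<Sum>i<n. x (\<omega> (Suc i)))"
    by (rule sum.lessThan_Suc_shift)
  also have "\<dots> \<le> x (\<omega> 0) + max_partial_sum x n (\<lambda>i. \<omega> (Suc i))"
    using Suc[of "\<lambda>i. \<omega> (Suc i)"] by simp
  finally show ?case by simp
qed simp

lemma max_partial_sum_le: "max_partial_sum x n \<omega> \<le> (\<Sum>i<n. \<bar>x (\<omega> i)\<bar>)"
proof (induction n arbitrary: \<omega>)
  case (Suc n)
  have "max_partial_sum x (Suc n) \<omega> \<le> \<bar>x (\<omega> 0)\<bar> + max_partial_sum x n (\<lambda>i. \<omega> (Suc i))"
    using max_partial_sum_nonneg[of x n "\<lambda>i. \<omega> (Suc i)"] by auto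
  also have "\<dots> \<le> \<bar>x (\<omega> 0)\<bar> + (\<Sum>i<n. \<bar>x (\<omega> (Suc i))\<bar>)"
    using Suc[of "\<lambda>i. \<omega> (Suc i)"] by simp
  also have "\<dots> = (\<Sum>i<Suc n. \<bar>x (\<omega> i)\<bar>)"
    by (rule sum.lessThan_Suc_shift[symmetric])
  finally show ?case .
qed simp

context
  fixes D :: "'v measure" and x :: "'v \<Rightarrow> real"
  assumes D: "prob_space D" and x: "integrable D x"
begin

interpretation prob_space D by (rule D)

interpretation sequence_space D ..

interpretation PP: pair_prob_space D S ..

lemma x_meas: "x \<in> borel_measurable D"
  using x by simp

lemma coord_measurable: "(\<lambda>\<omega>. \<omega> (i::nat)) \<in> measurable S D"
  by simp

lemma measurable_max_partial_sum: "max_partial_sum x n \<in> borel_measurable S"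
proof (induction n)
  case (Suc n)
  note [measurable] = x_meas coord_measurable
  have "(\<lambda>\<omega> i. \<omega> (Suc i)) \<in> measurable S S"
    by (rule measurable_PiM_single') (auto simp: space_PiM)
  note [measurable] = measurable_compose[OF this Suc]
  show ?case by simp
qed simp

lemma integrable_coord: "integrable S (\<lambda>\<omega>. \<bar>x (\<omega> i)\<bar>)"
proof -
  note [measurable] = x_meas coord_measurable
  have "integrable (distr S D (\<lambda>\<omega>. \<omega> i)) (\<lambda>s. \<bar>x s\<bar>)"
    using x by (subst PiM_component) auto
  then show ?thesis by (subst (asm) integrable_distr_eq) auto
qed

lemma integrable_max_partial_sum: "integrable S (max_partial_sum x n)"
proof (rule Bochner_Integration.integrable_bound)
  show "integrable S (\<lambda>\<omega>. \<Sum>i<n. \<bar>x (\<omega> i)\<bar>)"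
    by (intro Bochner_Integration.integrable_sum integrable_coord)
  show "max_partial_sum x n \<in> borel_measurable S" by (rule measurable_max_partial_sum)
  show "AE \<omega> in S. norm (max_partial_sum x n \<omega>) \<le> norm (\<Sum>i<n. \<bar>x (\<omega> i)\<bar>)"
    using max_partial_sum_nonneg[of x n] max_partial_sum_le[of x n]
    by (intro AE_I2) (auto intro: order_trans abs_ge_self)
qed

text \<open>Garsia's argument. Writing \<open>M n\<close> for the maximum of the first \<open>n\<close> partial sums and \<open>M' n\<close> for the
  same maximum of the shifted sequence, \<open>M (n + 1) = max 0 (x (\<omega> 0) + M' n)\<close> gives
  \<open>0 \<le> E (max (- M' n) (x (\<omega> 0)); A)\<close> for the shift-invariant event \<open>A\<close> that the maxima are unbounded,
  and the integrand decreases to \<open>x (\<omega> 0)\<close> on \<open>A\<close>.\<close>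
lemma AE_partial_sums_bounded:
  assumes neg: "(\<integral>s. x s \<partial>D) < 0"
  shows "AE \<omega> in S. \<exists>K. \<forall>n. (\<Sum>i<n. x (\<omega> i)) \<le> K"
proof -
  let ?m = "max_partial_sum x"
  note [measurable] = x_meas coord_measurable measurable_max_partial_sum
  define A where "A = {\<omega> \<in> space S. \<forall>k::nat. \<exists>n. real k < ?m n \<omega>}"
  have A[measurable]: "A \<in> sets S"
    unfolding A_def by measurable
  have cn[measurable]: "(\<lambda>(s, \<omega>). case_nat s \<omega>) \<in> measurable (D \<Otimes>\<^sub>M S) S"
    by (rule measurable_PiM_single')
       (auto simp: space_pair_measure space_PiM PiE_iff measurable_split_conv split: nat.split)
  \<comment> \<open>Shift invariance: prepending \<open>s\<close> changes every partial sum by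
    \<open>x s\<close>, so exceeding a level \<open>j\<close> beyond
    \<open>k + \<bar>x s\<bar>\<close> on one side forces exceeding \<open>k\<close> on the
    other.\<close>
  have inA: "case_nat s \<omega> \<in> A \<longleftrightarrow> \<omega> \<in> A" if "s \<in> space D" "\<omega> \<in> space S" for s \<omega>
  proof -
    have sp: "case_nat s \<omega> \<in> space S"
      using that by (auto simp: space_PiM PiE_iff split: nat.split)
    have Suc: "?m (Suc n) (case_nat s \<omega>) = max 0 (x s + ?m n \<omega>)" for n by simp
    show ?thesis
    proof
      assume c: "case_nat s \<omega> \<in> A"
      show "\<omega> \<in> A" unfolding A_def
      proof (intro CollectI conjI allI that(2))
        fix k :: nat
        obtain j :: nat where j: "real k + \<bar>x s\<bar> < real j" using reals_Archimedean2 by blast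
        obtain n where n: "real j < ?m n (case_nat s \<omega>)" using c unfolding A_def by auto
        then have "n \<noteq> 0" using j by (intro notI) auto
        then obtain n' where "n = Suc n'" by (cases n) auto
        with n Suc[of n'] j have "real k < ?m n' \<omega>" by (auto simp: max_def split: if_splits)
        then show "\<exists>n. real k < ?m n \<omega>" by blast
      qed
    next
      assume c: "\<omega> \<in> A"
      show "case_nat s \<omega> \<in> A" unfolding A_def
      proof (intro CollectI conjI allI sp)
        fix k :: nat
        obtain j :: nat where j: "real k + \<bar>x s\<bar> < real j" using reals_Archimedean2 by blast
        obtain n where n: "real j < ?m n \<omega>" using c unfolding A_def by auto
        with Suc[of n] j have "real k < ?m (Suc n) (case_nat s \<omega>)" by linarith
        then show "\<exists>n. real k < ?m n (case_nat s \<omega>)" by blast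
      qed
    qed
  qed
  let ?DS = "D \<Otimes>\<^sub>M S"
  have snd: "integrable ?DS (\<lambda>p. f (snd p))" "(\<integral>p. f (snd p) \<partial>?DS) = (\<integral>\<omega>. f \<omega> \<partial>S)"
    if f: "integrable S f" for f :: "(nat \<Rightarrow> 'v) \<Rightarrow> real"
  proof -
    have S: "distr ?DS S snd = S"
      by (intro distr_pair_snd_prob D prob_space_PiM)
    have "integrable (distr ?DS S snd) f" using f by (simp only: S)
    then show "integrable ?DS (\<lambda>p. f (snd p))"
      using f by (subst (asm) integrable_distr_eq) auto
    have "(\<integral>p. f (snd p) \<partial>?DS) = (\<integral>\<omega>. f \<omega> \<partial>distr ?DS S snd)"
      using f by (intro integral_distr[symmetric]) auto
    then show "(\<integral>p. f (snd p) \<partial>?DS) = (\<integral>\<omega>. f \<omega> \<partial>S)" by (simp only: S)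
  qed
  have D': "distr ?DS D fst = D"
    by (intro distr_pair_fst_prob D prob_space_PiM)
  have "integrable (distr ?DS D fst) (\<lambda>s. \<bar>x s\<bar>)" using x by (simp only: D') simp
  then have ifst: "integrable ?DS (\<lambda>p. \<bar>x (fst p)\<bar>)"
    by (subst (asm) integrable_distr_eq) auto
  have iA: "integrable S (\<lambda>\<omega>. indicator A \<omega> * ?m n \<omega>)" for n
    by (rule Bochner_Integration.integrable_bound[OF integrable_max_partial_sum[of n]])
       (auto simp: indicator_def)
  \<comment> \<open>\<open>max 0 (a + m) - m = max (- m) a\<close>, so \<open>g n\<close> is the
    increment from the maximum of the tail to the maximum of the extended sequence, restricted to
    \<open>A\<close>.\<close>
  define g where "g n p = indicator A (snd p) * max (- ?m n (snd p)) (x (fst p))" for n p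
  have gm[measurable]: "g n \<in> borel_measurable ?DS" for n unfolding g_def by measurable
  have g_bound: "norm (g n p) \<le> \<bar>x (fst p)\<bar>" for n p
    unfolding g_def using max_partial_sum_nonneg[of x n "snd p"] by (auto simp: indicator_def)
  have gi: "integrable ?DS (g n)" for n
    by (rule Bochner_Integration.integrable_bound[OF ifst]) (use g_bound in auto)
  \<comment> \<open>Prepending an independent coordinate preserves the product measure
    (\<open>PiM_iter\<close>). Hence the mean of the longer maximum can be computed on
    \<open>?DS\<close>, where it splits into the mean of \<open>g n\<close> and the mean of the
    shorter maximum.\<close>
  have g0: "0 \<le> (\<integral>p. g n p \<partial>?DS)" for n
  proof -
    have "(\<integral>\<omega>. indicator A \<omega> * ?m n \<omega> \<partial>S) \<le> (\<integral>\<omega>. indicator A \<omega> * ?m (Suc n) \<omega> \<partial>S)"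
      by (intro integral_mono iA mult_left_mono max_partial_sum_mono_Suc) simp
    also have "\<dots> = (\<integral>\<omega>. indicator A \<omega> * ?m (Suc n) \<omega> \<partial>distr ?DS S (\<lambda>(s, \<omega>). case_nat s \<omega>))"
      by (simp only: PiM_iter)
    also have "\<dots> = (\<integral>p. indicator A (case p of (s, \<omega>) \<Rightarrow> case_nat s \<omega>) * ?m (Suc n) (case p of (s, \<omega>) \<Rightarrow> case_nat s \<omega>) \<partial>?DS)"
      by (rule integral_distr) measurable
    also have "\<dots> = (\<integral>p. g n p + indicator A (snd p) * ?m n (snd p) \<partial>?DS)"
    proof (rule Bochner_Integration.integral_cong)
      fix p assume "p \<in> space ?DS"
      then obtain s \<omega> where p: "p = (s, \<omega>)" and s: "s \<in> space D" "\<omega> \<in> space S"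
        by (auto simp: space_pair_measure)
      have "indicator A (case_nat s \<omega>) = (indicator A \<omega> :: real)"
        using inA[OF s] by (simp add: indicator_def)
      then show "indicator A (case p of (s, \<omega>) \<Rightarrow> case_nat s \<omega>) * ?m (Suc n) (case p of (s, \<omega>) \<Rightarrow> case_nat s \<omega>)
          = g n p + indicator A (snd p) * ?m n (snd p)"
        by (simp add: p g_def indicator_def max_def)
    qed simp
    also have "\<dots> = (\<integral>p. g n p \<partial>?DS) + (\<integral>\<omega>. indicator A \<omega> * ?m n \<omega> \<partial>S)"
      using snd[OF iA[of n]] gi[of n] by (simp add: Bochner_Integration.integral_add)
    finally show ?thesis by simp
  qed
  \<comment> \<open>On \<open>A\<close> the maxima exceed \<open>- x (fst p)\<close> from some index
    on, and then \<open>g n p\<close> equals \<open>x (fst p)\<close>. The limit has integral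
    \<open>measure S A\<close> times the negative mean of \<open>x\<close>, which forces
    \<open>measure S A = 0\<close>.\<close>
  have "(\<lambda>n. \<integral>p. g n p \<partial>?DS) \<longlonglongrightarrow> (\<integral>p. indicator A (snd p) * x (fst p) \<partial>?DS)"
  proof (rule integral_dominated_convergence[where w="\<lambda>p. \<bar>x (fst p)\<bar>"])
    show "AE p in ?DS. (\<lambda>n. g n p) \<longlonglongrightarrow> indicator A (snd p) * x (fst p)"
    proof (rule AE_I2)
      fix p assume "p \<in> space ?DS"
      show "(\<lambda>n. g n p) \<longlonglongrightarrow> indicator A (snd p) * x (fst p)"
      proof (cases "snd p \<in> A")
        case True
        obtain k :: nat where k: "- x (fst p) < real k" using reals_Archimedean2 by blast
        obtain N where N: "real k < ?m N (snd p)" using True unfolding A_def by auto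
        have "eventually (\<lambda>n. g n p = indicator A (snd p) * x (fst p)) sequentially"
          using eventually_ge_at_top[of N]
        proof eventually_elim
          case (elim n)
          have "- ?m n (snd p) \<le> x (fst p)"
            using max_partial_sum_mono[OF elim, of x "snd p"] N k by linarith
          then show ?case by (simp add: g_def max_def)
        qed
        then show ?thesis by (rule tendsto_eventually)
      qed (simp add: g_def)
    qed
  qed (use ifst g_bound in auto)
  then have "0 \<le> (\<integral>p. indicator A (snd p) * x (fst p) \<partial>?DS)"
    using g0 by (intro LIMSEQ_le_const) auto
  also have "\<dots> = (\<integral>s. (\<integral>\<omega>. indicator A \<omega> * x s \<partial>S) \<partial>D)"
  proof -
    have "integrable ?DS (\<lambda>p. indicator A (snd p) * x (fst p))"
      by (rule Bochner_Integration.integrable_bound[OF ifst]) (auto simp: indicator_def)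
    from PP.integral_fst'[OF this] show ?thesis by simp
  qed
  also have "\<dots> = measure S A * (\<integral>s. x s \<partial>D)"
    by simp
  finally have "measure S A = 0"
    using neg measure_nonneg[of S A] by (smt (verit) mult_pos_neg)
  then have "emeasure S A = 0"
    by (simp add: P.emeasure_eq_measure)
  then have "AE \<omega> in S. \<omega> \<notin> A" by (intro AE_not_in) auto
  then show ?thesis
  proof (rule AE_mp, intro AE_I2 impI)
    fix \<omega> assume \<omega>: "\<omega> \<in> space S" "\<omega> \<notin> A"
    then obtain k :: nat where "\<forall>n. ?m n \<omega> \<le> real k" unfolding A_def by (auto simp: not_less)
    then show "\<exists>K. \<forall>n. (\<Sum>i<n. x (\<omega> i)) \<le> K"
      using sum_le_max_partial_sum[of x \<omega>] by (meson order_trans)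
  qed
qed

end

text \<open>Subtracting the mean and a further \<open>1 / Suc k\<close> makes the expectation
  negative, so the partial sums are bounded above by some \<open>K\<close> depending on the outcome,
  and \<open>K / n\<close> tends to \<open>0\<close>. Running over the countable family
  \<open>1 / Suc k\<close> keeps a single null set for all \<open>e\<close>.\<close>

lemma AE_mean_le:
  fixes x :: "'v \<Rightarrow> real"
  assumes D: "prob_space D" and x: "integrable D x"
  shows "AE \<omega> in (\<Pi>\<^sub>M i\<in>(UNIV::nat set). D). \<forall>e>0. \<forall>\<^sub>F n::nat in sequentially. (\<Sum>i<n. x (\<omega> i)) / real n \<le> (\<integral>s. x s \<partial>D) + e"
proof -
  interpret D: prob_space D by fact
  let ?S = "\<Pi>\<^sub>M i\<in>(UNIV::nat set). D" and ?E = "\<integral>s. x s \<partial>D"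
  have "AE \<omega> in ?S. \<forall>k::nat. \<exists>K. \<forall>n::nat. (\<Sum>i<n. x (\<omega> i) - ?E - 1 / Suc k) \<le> K"
    unfolding AE_all_countable
  proof
    fix k :: nat
    show "AE \<omega> in ?S. \<exists>K. \<forall>n::nat. (\<Sum>i<n. x (\<omega> i) - ?E - 1 / Suc k) \<le> K"
      by (rule AE_partial_sums_bounded[OF D]) (use x in \<open>auto simp: D.prob_space\<close>)
  qed
  then show ?thesis
  proof (rule AE_mp, intro AE_I2 impI allI)
    fix \<omega> and e :: real
    assume b: "\<forall>k::nat. \<exists>K. \<forall>n::nat. (\<Sum>i<n. x (\<omega> i) - ?E - 1 / Suc k) \<le> K" and e: "e > 0"
    obtain k :: nat where k: "1 / Suc k < e / 2" using nat_approx_posE[of "e/2"] e by auto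
    obtain K where K: "\<And>n::nat. (\<Sum>i<n. x (\<omega> i) - ?E - 1 / Suc k) \<le> K" using b by blast
    have "(\<lambda>n. K / real n) \<longlonglongrightarrow> 0" by (rule lim_const_over_n)
    then have "\<forall>\<^sub>F n in sequentially. K / real n < e / 2"
      using e by (intro order_tendstoD(2)[of _ 0]) auto
    then show "\<forall>\<^sub>F n::nat in sequentially. (\<Sum>i<n. x (\<omega> i)) / real n \<le> ?E + e"
      using eventually_gt_at_top[of 0]
    proof eventually_elim
      case (elim n)
      have "(\<Sum>i<n. x (\<omega> i)) \<le> K + real n * (?E + 1 / Suc k)"
        using K[of n] by (simp add: sum_subtractf algebra_simps)
      then have "(\<Sum>i<n. x (\<omega> i)) / real n \<le> K / real n + (?E + 1 / Suc k)"
        using elim(2) by (simp add: divide_le_eq distrib_right del: of_nat_Suc) (simp add: distrib_left mult.commute)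
      with elim k show ?case by linarith
    qed
  qed
qed

text \<open>The one-sided bound for \<open>x\<close> and for \<open>- x\<close> encloses the
  averages from both sides.\<close>

lemma AE_mean_tendsto_PiM:
  fixes x :: "'v \<Rightarrow> real"
  assumes D: "prob_space D" and x: "integrable D x"
  shows "AE \<omega> in (\<Pi>\<^sub>M i\<in>(UNIV::nat set). D). (\<lambda>n. (\<Sum>i<n. x (\<omega> i)) / real n) \<longlonglongrightarrow> (\<integral>s. x s \<partial>D)"
  using AE_mean_le[OF D x] AE_mean_le[OF D integrable_minus[OF x]]
proof eventually_elim
  case (elim \<omega>)
  show ?case
  proof (rule tendstoI)
    fix e :: real assume "e > 0"
    then have e: "e / 2 > 0" by simp
    from elim(1)[rule_format, OF e] elim(2)[rule_format, OF e]
    show "\<forall>\<^sub>F n in sequentially. dist ((\<Sum>i<n. x (\<omega> i)) / real n) (\<integral>s. x s \<partial>D) < e"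
    proof eventually_elim
      case (elim n)
      then show ?case using \<open>e > 0\<close> by (simp add: dist_real_def sum_negf abs_less_iff)
    qed
  qed
qed

locale iid_sequence = prob_space M for M :: "'a measure" +
  fixes N :: "'v measure" and V :: "nat \<Rightarrow> 'a \<Rightarrow> 'v"
  assumes V_indep: "indep_vars (\<lambda>_. N) V UNIV"
    and V_ident: "\<And>t. distr M N (V t) = distr M N (V 0)"
begin

lemma V_measurable[measurable]: "V t \<in> measurable M N"
  using V_indep by (simp add: indep_vars_def)

text \<open>Independence and identical laws say that the whole sequence has the product law of
  copies of \<open>?D\<close>, so the almost sure statement about coordinates pulls back along the
  map sending an outcome to its sequence of values.\<close>

lemma strong_law:
  fixes g :: "'v \<Rightarrow> real"
  assumes [measurable]: "g \<in> borel_measurable N" and int: "integrable M (\<lambda>\<omega>. g (V 0 \<omega>))"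
  shows "AE \<omega> in M. (\<lambda>n. (\<Sum>t<n. g (V t \<omega>)) / real n) \<longlonglongrightarrow> (\<integral>\<omega>. g (V 0 \<omega>) \<partial>M)"
proof -
  let ?D = "distr M N (V 0)"
  have D: "prob_space ?D" by (rule prob_space_distr) simp
  have "distr M (\<Pi>\<^sub>M i\<in>UNIV. N) (\<lambda>\<omega>. \<lambda>i\<in>UNIV. V i \<omega>) = (\<Pi>\<^sub>M i\<in>UNIV. distr M N (V i))"
    using indep_vars_iff_distr_eq_PiM[of UNIV V "\<lambda>_. N"] V_indep by simp
  then have eq: "distr M (\<Pi>\<^sub>M i\<in>UNIV. N) (\<lambda>\<omega> i. V i \<omega>) = (\<Pi>\<^sub>M i\<in>(UNIV::nat set). ?D)"
    using PiM_cong[of "UNIV :: nat set" UNIV "\<lambda>i. distr M N (V i)" "\<lambda>_. ?D", OF refl V_ident] by (simp add: restrict_UNIV)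
  have intD: "integrable ?D g" using int by (simp add: integrable_distr_eq)
  have Vm: "(\<lambda>\<omega> i. V i \<omega>) \<in> measurable M (\<Pi>\<^sub>M i\<in>UNIV. N)"
  proof (rule measurable_PiM_single')
    show "(\<lambda>\<omega> i. V i \<omega>) \<in> space M \<rightarrow> (\<Pi>\<^sub>E i\<in>UNIV. space N)"
      using measurable_space[OF V_measurable] by (simp add: PiE_UNIV_domain)
  qed (rule V_measurable)
  have *: "AE \<omega> in distr M (\<Pi>\<^sub>M i\<in>UNIV. N) (\<lambda>\<omega> i. V i \<omega>). (\<lambda>n. (\<Sum>i<n. g (\<omega> i)) / real n) \<longlonglongrightarrow> (\<integral>s. g s \<partial>?D)"
    unfolding eq by (rule AE_mean_tendsto_PiM[OF D intD])
  have "AE \<omega> in M. (\<lambda>n. (\<Sum>i<n. g (V i \<omega>)) / real n) \<longlonglongrightarrow> (\<integral>s. g s \<partial>?D)"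
    by (rule AE_distrD[OF Vm *])
  then show ?thesis unfolding integral_distr[OF V_measurable assms(1)] .
qed

end

section \<open>Uniform strong law over a compact parameter set\<close>

lemma (in prob_space) continuous_on_expectation:
  fixes a :: "'w::metric_space \<Rightarrow> 'a \<Rightarrow> real"
  assumes [measurable]: "\<And>W. W \<in> \<Theta> \<Longrightarrow> a W \<in> borel_measurable M"
    and cont: "\<And>v. v \<in> space M \<Longrightarrow> continuous_on \<Theta> (\<lambda>W. a W v)"
    and bound: "\<And>W v. W \<in> \<Theta> \<Longrightarrow> v \<in> space M \<Longrightarrow> \<bar>a W v\<bar> \<le> K v"
    and K: "integrable M K"
  shows "continuous_on \<Theta> (\<lambda>W. expectation (a W))"
  unfolding continuous_on_sequentially
proof (intro allI ballI impI)
  fix x and W assume x: "W \<in> \<Theta>" and xs: "(\<forall>n. x n \<in> \<Theta>) \<and> x \<longlonglongrightarrow> W"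
  show "((\<lambda>W. expectation (a W)) \<circ> x) \<longlonglongrightarrow> expectation (a W)"
    unfolding o_def
  proof (rule integral_dominated_convergence[where w=K])
    show "AE v in M. (\<lambda>n. a (x n) v) \<longlonglongrightarrow> a W v"
      using cont x xs by (intro AE_I2) (auto simp: continuous_on_sequentially o_def)
  qed (use x xs K bound in auto)
qed

context iid_sequence begin

definition average :: "('v \<Rightarrow> 'b::real_vector) \<Rightarrow> nat \<Rightarrow> 'a \<Rightarrow> 'b" where
  "average g n \<omega> = (1 / real n) *\<^sub>R (\<Sum>t<n. g (V t \<omega>))"

lemma measurable_average[measurable]:
  fixes g :: "'v \<Rightarrow> 'b::{banach, second_countable_topology}"
  assumes "g \<in> borel_measurable N"
  shows "average g n \<in> borel_measurable M"
proof -
  have [measurable]: "(\<lambda>\<omega>. g (V t \<omega>)) \<in> borel_measurable M" for t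
    using assms by (rule measurable_compose[OF V_measurable])
  show ?thesis unfolding average_def[abs_def] by measurable
qed

lemma AE_average_tendsto:
  fixes g :: "'v \<Rightarrow> real"
  assumes "g \<in> borel_measurable N" "integrable M (\<lambda>\<omega>. g (V 0 \<omega>))"
  shows "AE \<omega> in M. (\<lambda>n. average g n \<omega>) \<longlonglongrightarrow> (\<integral>\<omega>. g (V 0 \<omega>) \<partial>M)"
  using strong_law[OF assms] by (simp add: average_def)

text \<open>All fluctuations are controlled by the averages of the moduli of continuity
  \<open>s m v = sup {\<bar>a W v - a W' v\<bar>. dist W W' < 1 / Suc m}\<close>, where the supremum runs over a
  countable dense set to be measurable; \<open>E s m \<rightarrow> 0\<close> by uniform continuity on the compact set.\<close>
lemma uniform_strong_law:
  fixes a :: "'w::{metric_space, second_countable_topology} \<Rightarrow> 'v \<Rightarrow> real"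
  assumes \<Theta>: "compact \<Theta>"
    and am[measurable]: "\<And>W. W \<in> \<Theta> \<Longrightarrow> a W \<in> borel_measurable N"
    and cont: "\<And>v. v \<in> space N \<Longrightarrow> continuous_on \<Theta> (\<lambda>W. a W v)"
    and bound: "\<And>W v. W \<in> \<Theta> \<Longrightarrow> v \<in> space N \<Longrightarrow> \<bar>a W v\<bar> \<le> K v"
    and Km[measurable]: "K \<in> borel_measurable N" and K: "integrable M (\<lambda>\<omega>. K (V 0 \<omega>))"
  shows "AE \<omega> in M. uniform_limit \<Theta> (\<lambda>n W. average (a W) n \<omega>) (\<lambda>W. \<integral>\<omega>. a W (V 0 \<omega>) \<partial>M) sequentially"
proof (cases "\<Theta> = {}")
  case True then show ?thesis by (simp add: uniform_limit_iff)
next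
  case False
  obtain T where T: "countable T" "T \<subseteq> \<Theta>" "\<Theta> \<subseteq> closure T" by (rule separable)
  then have "T \<noteq> {}" using False by auto
  define P where "P m = {(W, W'). W \<in> T \<and> W' \<in> T \<and> dist W W' < 1 / real (Suc m)}" for m
  define s where "s m v = (SUP p\<in>P m. \<bar>a (fst p) v - a (snd p) v\<bar>)" for m v
  have P_ne: "P m \<noteq> {}" for m
  proof -
    obtain W where "W \<in> T" using \<open>T \<noteq> {}\<close> by auto
    then have "(W, W) \<in> P m" by (simp add: P_def)
    then show ?thesis by blast
  qed
  have P_T: "fst p \<in> \<Theta>" "snd p \<in> \<Theta>" if "p \<in> P m" for p m using that T by (auto simp: P_def)
  have cP: "countable (P m)" for m
    by (rule countable_subset[of _ "T \<times> T"]) (use T in \<open>auto simp: P_def\<close>)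
  have diff_le: "\<bar>a W v - a W' v\<bar> \<le> 2 * K v" if "W \<in> \<Theta>" "W' \<in> \<Theta>" "v \<in> space N" for W W' v
    using bound[of W v] bound[of W' v] that by linarith
  have bdd: "bdd_above ((\<lambda>p. \<bar>a (fst p) v - a (snd p) v\<bar>) ` P m)" if "v \<in> space N" for m v
    by (rule bdd_aboveI[of _ "2 * K v"]) (use P_T that diff_le in auto)
  have sm[measurable]: "s m \<in> borel_measurable N" for m
    unfolding s_def[abs_def] by (rule borel_measurable_cSUP[OF cP]) (use P_T bdd in auto)
  have s_nonneg: "0 \<le> s m v" and s_le: "s m v \<le> 2 * K v" if v: "v \<in> space N" for m v
  proof -
    obtain p where p: "p \<in> P m" using P_ne by blast
    show "0 \<le> s m v" unfolding s_def using p by (intro cSUP_upper2[OF bdd[OF v] p]) auto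
    show "s m v \<le> 2 * K v" unfolding s_def using P_ne P_T v diff_le by (intro cSUP_least) auto
  qed
  \<comment> \<open>The supremum runs only over pairs from the dense set \<open>T\<close>. Sequences
    in \<open>T\<close> tending to \<open>W\<close> and \<open>W'\<close> eventually satisfy the
    strict distance bound, and continuity carries the estimate to the limit.\<close>
  have s_upper: "\<bar>a W v - a W' v\<bar> \<le> s m v"
    if W: "W \<in> \<Theta>" "W' \<in> \<Theta>" "dist W W' < 1 / real (Suc m)" and v: "v \<in> space N" for W W' m v
  proof -
    obtain x where x: "\<And>n. x n \<in> T" "x \<longlonglongrightarrow> W" using T W by (meson closure_sequential subsetD)
    obtain y where y: "\<And>n. y n \<in> T" "y \<longlonglongrightarrow> W'" using T W by (meson closure_sequential subsetD)
    have "(\<lambda>n. dist (x n) (y n)) \<longlonglongrightarrow> dist W W'" by (intro tendsto_intros x y)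
    then have ev: "\<forall>\<^sub>F n in sequentially. dist (x n) (y n) < 1 / real (Suc m)"
      by (rule order_tendstoD(2)) (rule W)
    have lim: "(\<lambda>n. a (z n) v) \<longlonglongrightarrow> a Z v" if "\<And>n. z n \<in> T" "z \<longlonglongrightarrow> Z" "Z \<in> \<Theta>" for z Z
      using cont[OF v] that T unfolding continuous_on_sequentially o_def by blast
    have "(\<lambda>n. \<bar>a (x n) v - a (y n) v\<bar>) \<longlonglongrightarrow> \<bar>a W v - a W' v\<bar>"
      by (intro tendsto_intros lim x y W)
    then show ?thesis
    proof (rule tendsto_upperbound)
      show "\<forall>\<^sub>F n in sequentially. \<bar>a (x n) v - a (y n) v\<bar> \<le> s m v"
        using ev
      proof eventually_elim
        case (elim n)
        then have "(x n, y n) \<in> P m" using x y by (auto simp: P_def)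
        then show ?case unfolding s_def using cSUP_upper[OF _ bdd[OF v], of "(x n, y n)" m] by simp
      qed
    qed simp
  qed
  have s_lim: "(\<lambda>m. s m v) \<longlonglongrightarrow> 0" if v: "v \<in> space N" for v
  proof (rule tendstoI)
    fix e :: real assume e: "e > 0"
    have "uniformly_continuous_on \<Theta> (\<lambda>W. a W v)"
      by (rule compact_uniformly_continuous[OF cont[OF v] \<Theta>])
    then obtain d where d: "d > 0" "\<And>W W'. W \<in> \<Theta> \<Longrightarrow> W' \<in> \<Theta> \<Longrightarrow> dist W' W < d \<Longrightarrow> dist (a W' v) (a W v) < e / 2"
      unfolding uniformly_continuous_on_def using e by (meson half_gt_zero)
    obtain k :: nat where k: "1 / Suc k < d" using nat_approx_posE[OF d(1)] by auto
    show "\<forall>\<^sub>F m in sequentially. dist (s m v) 0 < e"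
      using eventually_ge_at_top[of k]
    proof eventually_elim
      case (elim m)
      have "1 / real (Suc m) \<le> 1 / Suc k" using elim by (simp add: frac_le)
      then have "s m v \<le> e / 2"
        unfolding s_def using P_ne k d(2) T(2)
        by (intro cSUP_least) (force simp: P_def dist_real_def intro!: less_imp_le)+
      then show ?case using s_nonneg[OF v, of m] e by simp
    qed
  qed
  have V_sp: "V t \<omega> \<in> space N" if "\<omega> \<in> space M" for t \<omega>
    using measurable_space[OF V_measurable that] .
  have s_int: "integrable M (\<lambda>\<omega>. s m (V 0 \<omega>))" for m
    by (rule Bochner_Integration.integrable_bound[OF integrable_mult_right[OF K, of 2]])
       (use s_nonneg s_le V_sp in \<open>auto intro!: AE_I2 intro: order_trans[OF _ abs_ge_self]\<close>)
  have Es: "(\<lambda>m. \<integral>\<omega>. s m (V 0 \<omega>) \<partial>M) \<longlonglongrightarrow> (\<integral>\<omega>. 0 \<partial>M)"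
    by (rule integral_dominated_convergence[where w="\<lambda>\<omega>. 2 * K (V 0 \<omega>)"])
       (use s_lim s_nonneg s_le V_sp K in auto)
  have a_int: "integrable M (\<lambda>\<omega>. a W (V 0 \<omega>))" if "W \<in> \<Theta>" for W
    by (rule Bochner_Integration.integrable_bound[OF K])
       (use bound V_sp that in \<open>auto intro!: AE_I2 intro: order_trans[OF _ abs_ge_self]\<close>)
  let ?A = "\<lambda>W. \<integral>\<omega>. a W (V 0 \<omega>) \<partial>M"
  have "AE \<omega> in M. \<forall>m. (\<lambda>n. average (s m) n \<omega>) \<longlonglongrightarrow> (\<integral>\<omega>. s m (V 0 \<omega>) \<partial>M)"
    unfolding AE_all_countable by (intro allI AE_average_tendsto s_int sm)
  moreover have "AE \<omega> in M. \<forall>W\<in>T. (\<lambda>n. average (a W) n \<omega>) \<longlonglongrightarrow> ?A W"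
    unfolding AE_ball_countable[OF T(1)]
    using T by (intro ballI AE_average_tendsto a_int am) auto
  ultimately show ?thesis
    using AE_space
  proof eventually_elim
    case (elim \<omega>)
    show ?case
    proof (rule uniform_limitI)
      fix e :: real assume e: "e > 0"
      have "\<forall>\<^sub>F m in sequentially. (\<integral>\<omega>. s m (V 0 \<omega>) \<partial>M) < e / 4"
        using Es e by (intro order_tendstoD(2)[of _ 0]) auto
      then obtain m where m: "(\<integral>\<omega>. s m (V 0 \<omega>) \<partial>M) < e / 4"
        by (auto simp: eventually_sequentially)
      \<comment> \<open>A finite net in \<open>T\<close> at scale \<open>1 / Suc m\<close>. Three
        errors remain, each at most \<open>e / 4\<close>: the oscillation of the averages, the
        convergence at the net point and the oscillation of the expectation.\<close>
      obtain T0 where T0: "T0 \<subseteq> T" "finite T0" "\<Theta> \<subseteq> (\<Union>W\<in>T0. ball W (1 / Suc m))"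
      proof (rule compactE_image[OF \<Theta>, of T "\<lambda>W. ball W (1 / Suc m)"])
        show "\<Theta> \<subseteq> (\<Union>W\<in>T. ball W (1 / real (Suc m)))"
        proof
          fix W assume "W \<in> \<Theta>"
          then have "W \<in> closure T" using T by auto
          then obtain W' where "W' \<in> T" "dist W' W < 1 / Suc m"
            unfolding closure_approachable by (metis of_nat_0_less_iff zero_less_Suc zero_less_divide_1_iff)
          then show "W \<in> (\<Union>W\<in>T. ball W (1 / real (Suc m)))" by auto
        qed
      qed auto
      have "\<forall>\<^sub>F n in sequentially. \<forall>W\<in>T0. dist (average (a W) n \<omega>) (?A W) < e / 4"
        using elim(2) T0 e by (intro eventually_ball_finite ballI tendstoD) auto
      moreover have "\<forall>\<^sub>F n in sequentially. average (s m) n \<omega> < e / 4"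
        by (rule order_tendstoD(2)[OF _ m]) (use elim(1) in auto)
      ultimately show "\<forall>\<^sub>F n in sequentially. \<forall>W\<in>\<Theta>. dist (average (a W) n \<omega>) (?A W) < e"
      proof eventually_elim
        case (elim n)
        show ?case
        proof
          fix W assume W: "W \<in> \<Theta>"
          then obtain W' where W': "W' \<in> T0" "dist W W' < 1 / real (Suc m)"
            using T0 by (auto simp: dist_commute)
          have W'\<Theta>: "W' \<in> \<Theta>" using W' T0 T by auto
          have avg: "\<bar>average (a W) n \<omega> - average (a W') n \<omega>\<bar> \<le> average (s m) n \<omega>"
          proof -
            have "\<bar>average (a W) n \<omega> - average (a W') n \<omega>\<bar>
                = \<bar>(\<Sum>t<n. a W (V t \<omega>) - a W' (V t \<omega>))\<bar> / real n"
              by (simp add: average_def sum_subtractf diff_divide_distrib abs_divide flip: diff_divide_distrib)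
            also have "\<dots> \<le> (\<Sum>t<n. s m (V t \<omega>)) / real n"
              by (intro divide_right_mono order_trans[OF sum_abs] sum_mono s_upper W W'\<Theta> W'
                  V_sp \<open>\<omega> \<in> space M\<close>) auto
            finally show ?thesis by (simp add: average_def)
          qed
          have "\<bar>?A W - ?A W'\<bar> = \<bar>\<integral>\<omega>. a W (V 0 \<omega>) - a W' (V 0 \<omega>) \<partial>M\<bar>"
            using a_int W W'\<Theta> by simp
          also have "\<dots> \<le> (\<integral>\<omega>. \<bar>a W (V 0 \<omega>) - a W' (V 0 \<omega>)\<bar> \<partial>M)"
            by (rule integral_abs_bound)
          also have "\<dots> \<le> (\<integral>\<omega>. s m (V 0 \<omega>) \<partial>M)"
            using a_int W W'\<Theta> s_upper[OF W W'\<Theta> W'(2)] V_sp by (intro integral_mono s_int) auto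
          finally have A: "\<bar>?A W - ?A W'\<bar> \<le> (\<integral>\<omega>. s m (V 0 \<omega>) \<partial>M)" .
          have "\<bar>average (a W') n \<omega> - ?A W'\<bar> < e / 4"
            using elim(1) W'(1) by (simp add: dist_real_def)
          then have "\<bar>average (a W) n \<omega> - ?A W\<bar> < e / 4 + e / 4 + e / 4"
            using avg elim(2) A m by linarith
          then show "dist (average (a W) n \<omega>) (?A W) < e"
            using e by (simp add: dist_real_def)
        qed
      qed
    qed
  qed
qed

end

text \<open>Each coordinate is dominated by the same \<open>K\<close>, and there are finitely many
  of them, so the scalar law applies coordinatewise off one null set.\<close>

lemma (in iid_sequence) uniform_strong_law_vector:
  fixes a :: "'w::{metric_space, second_countable_topology} \<Rightarrow> 'v \<Rightarrow> 'm::euclidean_space"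
  assumes \<Theta>: "compact \<Theta>"
    and am[measurable]: "\<And>W. W \<in> \<Theta> \<Longrightarrow> a W \<in> borel_measurable N"
    and cont: "\<And>v. v \<in> space N \<Longrightarrow> continuous_on \<Theta> (\<lambda>W. a W v)"
    and bound: "\<And>W v. W \<in> \<Theta> \<Longrightarrow> v \<in> space N \<Longrightarrow> norm (a W v) \<le> K v"
    and Km: "K \<in> borel_measurable N" and K: "integrable M (\<lambda>\<omega>. K (V 0 \<omega>))"
  shows "AE \<omega> in M. uniform_limit \<Theta> (\<lambda>n W. average (a W) n \<omega>) (\<lambda>W. \<integral>\<omega>. a W (V 0 \<omega>) \<partial>M) sequentially"
    and "continuous_on \<Theta> (\<lambda>W. \<integral>\<omega>. a W (V 0 \<omega>) \<partial>M)"
    and "\<And>W. W \<in> \<Theta> \<Longrightarrow> integrable M (\<lambda>\<omega>. a W (V 0 \<omega>))"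
proof -
  have V_sp: "V t \<omega> \<in> space N" if "\<omega> \<in> space M" for t \<omega>
    using measurable_space[OF V_measurable that] .
  have aV[measurable]: "(\<lambda>\<omega>. a W (V t \<omega>)) \<in> borel_measurable M" if "W \<in> \<Theta>" for W t
    using am[OF that] by (rule measurable_compose[OF V_measurable])
  show int: "integrable M (\<lambda>\<omega>. a W (V 0 \<omega>))" if "W \<in> \<Theta>" for W
    by (rule Bochner_Integration.integrable_bound[OF K aV[OF that]])
       (use bound V_sp that in \<open>auto intro!: AE_I2 intro: order_trans[OF _ abs_ge_self]\<close>)
  let ?E = "\<lambda>W. \<integral>\<omega>. a W (V 0 \<omega>) \<partial>M"
  have bound_b: "\<bar>a W v \<bullet> b\<bar> \<le> K v" if "b \<in> Basis" "W \<in> \<Theta>" "v \<in> space N" for b W v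
    using Basis_le_norm[OF that(1)] bound[OF that(2,3)] by (rule order_trans)
  have E_inner: "(\<integral>\<omega>. a W (V 0 \<omega>) \<bullet> b \<partial>M) = ?E W \<bullet> b" if "W \<in> \<Theta>" for W b
    using int[OF that] by simp
  have comp: "AE \<omega> in M. uniform_limit \<Theta> (\<lambda>n W. average (\<lambda>v. a W v \<bullet> b) n \<omega>) (\<lambda>W. \<integral>\<omega>. a W (V 0 \<omega>) \<bullet> b \<partial>M) sequentially"
    if b: "b \<in> Basis" for b
    by (rule uniform_strong_law[OF \<Theta> _ _ bound_b[OF b] Km K])
       (auto intro!: continuous_intros cont)
  have "continuous_on \<Theta> (\<lambda>W. \<integral>\<omega>. a W (V 0 \<omega>) \<bullet> b \<partial>M)" if b: "b \<in> Basis" for b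
    by (rule continuous_on_expectation[OF _ _ _ K])
       (use b V_sp in \<open>auto intro!: continuous_intros cont bound_b\<close>)
  then show "continuous_on \<Theta> ?E"
    using E_inner by (subst continuous_on_componentwise) (simp cong: continuous_on_cong)
  have "AE \<omega> in M. \<forall>b\<in>Basis. uniform_limit \<Theta> (\<lambda>n W. average (\<lambda>v. a W v \<bullet> b) n \<omega>) (\<lambda>W. \<integral>\<omega>. a W (V 0 \<omega>) \<bullet> b \<partial>M) sequentially"
    using comp by (simp add: AE_ball_countable[OF countable_finite[OF finite_Basis]])
  then show "AE \<omega> in M. uniform_limit \<Theta> (\<lambda>n W. average (a W) n \<omega>) ?E sequentially"
  proof eventually_elim
    case (elim \<omega>)
    show ?case
    proof (rule uniform_limitI)
      fix e :: real assume "e > 0"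
      \<comment> \<open>The coordinate errors add up to at most \<open>e / 2\<close>; the factor
        \<open>2\<close> restores the strict inequality.\<close>
      define e' where "e' = e / (2 * real DIM('m))"
      have e': "e' > 0" using \<open>e > 0\<close> by (simp add: e'_def)
      have "\<forall>\<^sub>F n in sequentially. \<forall>b\<in>Basis. \<forall>W\<in>\<Theta>. dist (average (\<lambda>v. a W v \<bullet> b) n \<omega>) (\<integral>\<omega>. a W (V 0 \<omega>) \<bullet> b \<partial>M) < e'"
        using elim e' by (intro eventually_ball_finite) (auto dest: uniform_limitD)
      then show "\<forall>\<^sub>F n in sequentially. \<forall>W\<in>\<Theta>. dist (average (a W) n \<omega>) (?E W) < e"
      proof eventually_elim
        case (elim n)
        show ?case
        proof
          fix W assume W: "W \<in> \<Theta>"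
          have "norm (average (a W) n \<omega> - ?E W) \<le> (\<Sum>b\<in>Basis. \<bar>(average (a W) n \<omega> - ?E W) \<bullet> b\<bar>)"
            by (rule norm_le_l1)
          also have "\<dots> \<le> (\<Sum>b\<in>(Basis::'m set). e')"
          proof (rule sum_mono)
            fix b :: 'm assume b: "b \<in> Basis"
            have "(average (a W) n \<omega> - ?E W) \<bullet> b = average (\<lambda>v. a W v \<bullet> b) n \<omega> - (\<integral>\<omega>. a W (V 0 \<omega>) \<bullet> b \<partial>M)"
              using E_inner[OF W] by (simp add: average_def inner_diff_left inner_sum_left)
            then show "\<bar>(average (a W) n \<omega> - ?E W) \<bullet> b\<bar> \<le> e'"
              using elim b W by (force simp: dist_real_def)
          qed
          also have "\<dots> < e" using \<open>e > 0\<close> by (simp add: e'_def)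
          finally show "dist (average (a W) n \<omega>) (?E W) < e" by (simp add: dist_norm)
        qed
      qed
    qed
  qed
qed

text \<open>Uniform convergence to a continuous limit becomes an ordinary limit along a product
  filter, in which \<open>n\<close> grows while the parameter approaches \<open>W\<close> inside
  \<Theta>. Such limits pass through determinants, inverse matrices and logarithms by continuity at
  the limit point alone.\<close>

lemma uniform_limit_tendsto_prod:
  fixes f :: "'i \<Rightarrow> 'w::metric_space \<Rightarrow> 'm::metric_space"
  assumes ul: "uniform_limit \<Theta> f l F" and cont: "continuous_on \<Theta> l" and W: "W \<in> \<Theta>"
  shows "((\<lambda>(n, x). f n x) \<longlongrightarrow> l W) (F \<times>\<^sub>F inf (nhds W) (principal \<Theta>))"
proof (rule tendstoI)
  fix e :: real assume e: "e > 0"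
  have 1: "\<forall>\<^sub>F n in F. \<forall>x\<in>\<Theta>. dist (f n x) (l x) < e / 2"
    using uniform_limitD[OF ul, of "e / 2"] e by simp
  obtain d where d: "d > 0" "\<And>x. x \<in> \<Theta> \<Longrightarrow> dist x W < d \<Longrightarrow> dist (l x) (l W) < e / 2"
    using cont W e unfolding continuous_on_iff by (metis half_gt_zero)
  have 2: "\<forall>\<^sub>F x in inf (nhds W) (principal \<Theta>). x \<in> \<Theta> \<and> dist x W < d"
    unfolding eventually_inf_principal using d(1) by (auto simp: eventually_nhds_metric)
  have "\<forall>\<^sub>F p in F \<times>\<^sub>F inf (nhds W) (principal \<Theta>). (\<forall>x\<in>\<Theta>. dist (f (fst p) x) (l x) < e / 2) \<and> (snd p \<in> \<Theta> \<and> dist (snd p) W < d)"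
    unfolding eventually_prod_filter using 1 2 by fastforce
  then show "\<forall>\<^sub>F p in F \<times>\<^sub>F inf (nhds W) (principal \<Theta>). dist (case p of (n, x) \<Rightarrow> f n x) (l W) < e"
  proof eventually_elim
    case (elim p)
    then have "dist (f (fst p) (snd p)) (l (snd p)) < e / 2" "dist (l (snd p)) (l W) < e / 2" using d(2) by auto
    then have "dist (f (fst p) (snd p)) (l W) < e"
      using dist_triangle[of "f (fst p) (snd p)" "l W" "l (snd p)"] by linarith
    then show ?case by (simp add: case_prod_beta)
  qed
qed

text \<open>The way back from local to uniform: near each point a property holds from an index
  depending on the point, and a finite subcover leaves finitely many indices to combine.\<close>

lemma eventually_prod_compact:
  fixes \<Theta> :: "'w::topological_space set"
  assumes K: "compact \<Theta>"
    and ev: "\<And>W. W \<in> \<Theta> \<Longrightarrow> \<forall>\<^sub>F p in F \<times>\<^sub>F inf (nhds W) (principal S). P (fst p) (snd p)" and "\<Theta> \<subseteq> S"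
  shows "\<forall>\<^sub>F n in F. \<forall>W\<in>\<Theta>. P n W"
proof -
  have "\<exists>U Q. open U \<and> W \<in> U \<and> eventually Q F \<and> (\<forall>n x. Q n \<longrightarrow> x \<in> U \<longrightarrow> x \<in> S \<longrightarrow> P n x)" if W: "W \<in> \<Theta>" for W
  proof -
    obtain Q R where Q: "eventually Q F" and R: "eventually R (inf (nhds W) (principal S))"
      and QR: "\<And>n x. Q n \<Longrightarrow> R x \<Longrightarrow> P n x"
      using ev[OF W] unfolding eventually_prod_filter by auto
    obtain U where "open U" "W \<in> U" "\<And>x. x \<in> U \<Longrightarrow> x \<in> S \<Longrightarrow> R x"
      using R unfolding eventually_inf_principal eventually_nhds by auto
    then show ?thesis using Q QR by blast
  qed
  then obtain U Q where U: "\<And>W. W \<in> \<Theta> \<Longrightarrow> open (U W) \<and> W \<in> U W"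
    and Q: "\<And>W. W \<in> \<Theta> \<Longrightarrow> eventually (Q W) F"
    and UQ: "\<And>W n x. W \<in> \<Theta> \<Longrightarrow> Q W n \<Longrightarrow> x \<in> U W \<Longrightarrow> x \<in> S \<Longrightarrow> P n x"
    by metis
  obtain T where T: "T \<subseteq> \<Theta>" "finite T" "\<Theta> \<subseteq> (\<Union>W\<in>T. U W)"
    using compactE_image[OF K, of \<Theta> U] U by blast
  have "\<forall>\<^sub>F n in F. \<forall>W\<in>T. Q W n"
    using T Q by (intro eventually_ball_finite) auto
  then show ?thesis
  proof eventually_elim
    case (elim n)
    then show ?case using T UQ \<open>\<Theta> \<subseteq> S\<close> by blast
  qed
qed

section \<open>Gaussian laws and the central limit theorem\<close>

lemma bilinear_form_basis_zero:
  fixes B :: "'w::euclidean_space \<Rightarrow> 'w \<Rightarrow> real"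
  assumes B: "bilinear B" and z: "\<And>b y. b \<in> Basis \<Longrightarrow> B b y = 0"
  shows "B x y = 0"
proof -
  have "linear (\<lambda>x. B x y)" using B by (simp add: bilinear_def)
  from linear_sum[OF this, of "\<lambda>b. (x \<bullet> b) *\<^sub>R b" Basis]
  have "B (\<Sum>b\<in>Basis. (x \<bullet> b) *\<^sub>R b) y = (\<Sum>b\<in>Basis. (x \<bullet> b) * B b y)"
    by (simp add: bilinear_lmul[OF B])
  then show ?thesis using z by (simp add: euclidean_representation)
qed

text \<open>If \<open>B c c = 0\<close>, the form along the line \<open>y + t c\<close> is affine in
  \<open>t\<close>; with a nonzero slope it would become negative.\<close>

lemma psd_form_zero_imp:
  fixes B :: "'w::euclidean_space \<Rightarrow> 'w \<Rightarrow> real"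
  assumes B: "bilinear B" and sym: "\<And>x y. B x y = B y x" and psd: "\<And>x. 0 \<le> B x x" and c: "B c c = 0"
  shows "B c y = 0"
proof (rule ccontr)
  assume nz: "B c y \<noteq> 0"
  \<comment> \<open>Solves \<open>B y y + 2 * t * B c y = -1\<close>.\<close>
  define t where "t = - (B y y + 1) / (2 * B c y)"
  have "B (y + t *\<^sub>R c) (y + t *\<^sub>R c) = B y y + 2 * t * B c y + t * t * B c c"
    using B sym[of y c] by (simp add: bilinear_ladd bilinear_radd bilinear_lmul bilinear_rmul algebra_simps)
  also have "\<dots> = -1" using nz c by (simp add: t_def field_simps)
  finally show False using psd[of "y + t *\<^sub>R c"] by simp
qed

text \<open>Cholesky elimination, one coordinate at a time.\<close>
lemma psd_form_sum_squares_aux: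
  fixes B :: "'w::euclidean_space \<Rightarrow> 'w \<Rightarrow> real"
  assumes "finite S" "S \<subseteq> Basis"
    and "bilinear B" "\<And>x y. B x y = B y x" "\<And>x. 0 \<le> B x x"
    and "\<And>b y. b \<in> Basis - S \<Longrightarrow> B b y = 0"
  shows "\<exists>a. \<forall>x. B x x = (\<Sum>b\<in>S. (a b \<bullet> x)\<^sup>2)"
  using assms
proof (induction S arbitrary: B rule: finite_induct)
  case empty
  have "B x x = 0" for x
    by (rule bilinear_form_basis_zero[OF empty.prems(2)]) (rule empty.prems(5), simp)
  then show ?case by simp
next
  case (insert c S)
  note bl = \<open>bilinear B\<close> and sym = insert.prems(3) and psd = insert.prems(4) and z = insert.prems(5)
  show ?case
  proof (cases "B c c = 0")
    case True
    have "\<exists>a::'w \<Rightarrow> 'w. \<forall>x. B x x = (\<Sum>b\<in>S. (a b \<bullet> x)\<^sup>2)"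
    proof (rule insert.IH[of B])
      fix b y assume "b \<in> Basis - S"
      then show "B b y = 0" using z[of b y] psd_form_zero_imp[OF bl sym psd True] by (cases "b = c") auto
    qed (use insert.prems in auto)
    then obtain a where a: "\<And>x. B x x = (\<Sum>b\<in>S. (a b \<bullet> x)\<^sup>2)" by blast
    have "(\<Sum>b\<in>insert c S. ((a(c := 0)) b \<bullet> x)\<^sup>2) = (\<Sum>b\<in>S. (a b \<bullet> x)\<^sup>2)" for x
      using insert.hyps by (auto intro!: sum.cong)
    then show ?thesis using a by metis
  next
    case False
    then have pos: "B c c > 0" using psd[of c] by simp
    \<comment> \<open>The Schur complement of the pivot: \<open>B' x x\<close> is the minimum of the
      form along the line through \<open>x\<close> in direction \<open>c\<close>, which keeps it
      nonnegative, and \<open>c\<close> lies in its radical.\<close>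
    define B' where "B' x y = B x y - B c x * B c y / B c c" for x y
    have bl': "bilinear B'"
      using bl unfolding B'_def bilinear_def linear_iff by (simp add: algebra_simps add_divide_distrib)
    have psd': "0 \<le> B' x x" for x
    proof -
      define t where "t = - B c x / B c c"
      have "B (x + t *\<^sub>R c) (x + t *\<^sub>R c) = B x x + 2 * t * B c x + t * t * B c c"
        using bl sym[of x c] by (simp add: bilinear_ladd bilinear_radd bilinear_lmul bilinear_rmul algebra_simps)
      also have "\<dots> = B' x x" using pos by (simp add: t_def B'_def field_simps)
      finally show ?thesis using psd by metis
    qed
    have "\<exists>a::'w \<Rightarrow> 'w. \<forall>x. B' x x = (\<Sum>b\<in>S. (a b \<bullet> x)\<^sup>2)"
    proof (rule insert.IH[of B'])
      fix b y assume b: "b \<in> Basis - S"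
      show "B' b y = 0"
      proof (cases "b = c")
        case True then show ?thesis using pos by (simp add: B'_def)
      next
        case False
        then have "B b y = 0" "B b c = 0" using z b by auto
        then show ?thesis using sym[of c b] by (simp add: B'_def)
      qed
    next
      show "B' x y = B' y x" for x y using sym[of x y] by (simp add: B'_def mult.commute)
    qed (use insert.prems bl' psd' in auto)
    then obtain a where a: "\<And>x. B' x x = (\<Sum>b\<in>S. (a b \<bullet> x)\<^sup>2)" by blast
    \<comment> \<open>The Riesz vector of the functional sending \<open>x\<close> to
      \<open>B c x / sqrt (B c c)\<close>, whose square is the part split off from the form.\<close>
    define ac where "ac = (1 / sqrt (B c c)) *\<^sub>R (\<Sum>b\<in>Basis. B c b *\<^sub>R b)"
    have Bc: "B c x = (\<Sum>b\<in>Basis. B c b * (b \<bullet> x))" for x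
    proof -
      have "linear (B c)" using bl by (simp add: bilinear_def)
      from linear_sum[OF this, of "\<lambda>b. (x \<bullet> b) *\<^sub>R b" Basis]
      have "B c (\<Sum>b\<in>Basis. (x \<bullet> b) *\<^sub>R b) = (\<Sum>b\<in>Basis. (x \<bullet> b) * B c b)"
        by (simp add: bilinear_rmul[OF bl])
      then show ?thesis unfolding euclidean_representation by (simp add: inner_commute mult.commute)
    qed
    have "ac \<bullet> x = B c x / sqrt (B c c)" for x
      by (subst Bc) (simp add: ac_def inner_sum_left)
    then have "(ac \<bullet> x)\<^sup>2 = B c x * B c x / B c c" for x
      using pos by (simp add: power_divide power2_eq_square)
    then have "B x x = (ac \<bullet> x)\<^sup>2 + B' x x" for x by (simp add: B'_def)
    then have "B x x = (\<Sum>b\<in>insert c S. ((a(c := ac)) b \<bullet> x)\<^sup>2)" for x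
      using insert.hyps a[of x] by (auto intro!: sum.cong)
    then show ?thesis by metis
  qed
qed

lemma psd_form_sum_squares:
  fixes B :: "'w::euclidean_space \<Rightarrow> 'w \<Rightarrow> real"
  assumes "bilinear B" "\<And>x y. B x y = B y x" "\<And>x. 0 \<le> B x x"
  obtains a :: "'w \<Rightarrow> 'w" where "\<And>x. B x x = (\<Sum>b\<in>Basis. (a b \<bullet> x)\<^sup>2)"
proof -
  have "\<exists>a::'w \<Rightarrow> 'w. \<forall>x. B x x = (\<Sum>b\<in>Basis. (a b \<bullet> x)\<^sup>2)"
    by (rule psd_form_sum_squares_aux[of Basis B]) (use assms in auto)
  then show ?thesis using that by blast
qed

text \<open>\<open>sum_indep_normal\<close> asks for positive standard deviations and a nonempty
  index set, so terms with zero coefficient are removed first. If none remain, the law is the point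
  mass at \<open>0\<close>, which is the degenerate branch of \<open>normal_law\<close>.\<close>

lemma normal_law_sum_std_normal:
  fixes r :: "'i \<Rightarrow> real"
  assumes I: "finite I"
  shows "distr (\<Pi>\<^sub>M i\<in>I. density lborel std_normal_density) borel (\<lambda>x. \<Sum>i\<in>I. r i * x i) = normal_law (\<Sum>i\<in>I. (r i)\<^sup>2)"
proof -
  let ?N = "density lborel std_normal_density"
  have N: "prob_space ?N" by (rule prob_space_normal_density) simp
  interpret PP: prob_space "\<Pi>\<^sub>M i\<in>I. ?N" by (intro prob_space_PiM N)
  let ?J = "{i\<in>I. r i \<noteq> 0}"
  have sum_J: "(\<Sum>i\<in>I. r i * x i) = (\<Sum>i\<in>?J. r i * x i)" for x
    by (rule sum.mono_neutral_right) (use I in auto)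
  have sumsq_J: "(\<Sum>i\<in>I. (r i)\<^sup>2) = (\<Sum>i\<in>?J. (r i)\<^sup>2)"
    by (rule sum.mono_neutral_right) (use I in auto)
  show ?thesis
  proof (cases "?J = {}")
    case True
    then show ?thesis unfolding sum_J sumsq_J by (simp add: normal_law_def)
  next
    case False
    have comp: "distr (\<Pi>\<^sub>M i\<in>I. ?N) ?N (\<lambda>x. x i) = ?N" if "i \<in> I" for i
      using product_prob_space.PiM_component[OF product_prob_spaceI[OF N] that] .
    have distr_coord: "distributed (\<Pi>\<^sub>M i\<in>I. ?N) lborel (\<lambda>x. x i) (normal_density 0 1)" if "i \<in> I" for i
      unfolding distributed_def
    proof (intro conjI)
      show "(\<lambda>x. x i) \<in> measurable (\<Pi>\<^sub>M i\<in>I. ?N) lborel"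
        using measurable_component_singleton[OF that, of "\<lambda>_. ?N"] by simp
      have "distr (\<Pi>\<^sub>M i\<in>I. ?N) lborel (\<lambda>x. x i) = distr (\<Pi>\<^sub>M i\<in>I. ?N) ?N (\<lambda>x. x i)"
        by (rule distr_cong) simp_all
      then show "distr (\<Pi>\<^sub>M i\<in>I. ?N) lborel (\<lambda>x. x i) = ?N" using comp[OF that] by simp
    qed simp
    have ind: "PP.indep_vars (\<lambda>_. borel) (\<lambda>i x. x i) I"
    proof -
      have "PP.indep_vars (\<lambda>_. ?N) (\<lambda>i x. x i) I"
      proof (subst PP.indep_vars_iff_distr_eq_PiM')
        show "I \<noteq> {}" using False by auto
        have "distr (\<Pi>\<^sub>M i\<in>I. ?N) (\<Pi>\<^sub>M i\<in>I. ?N) (\<lambda>x. \<lambda>i\<in>I. x i) = distr (\<Pi>\<^sub>M i\<in>I. ?N) (\<Pi>\<^sub>M i\<in>I. ?N) (\<lambda>x. x)"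
          by (rule distr_cong) (auto simp: space_PiM PiE_def extensional_restrict)
        also have "\<dots> = (\<Pi>\<^sub>M i\<in>I. ?N)" by simp
        also have "\<dots> = (\<Pi>\<^sub>M i\<in>I. distr (\<Pi>\<^sub>M i\<in>I. ?N) ?N (\<lambda>x. x i))"
          by (rule PiM_cong) (simp_all only: comp)
        finally show "distr (\<Pi>\<^sub>M i\<in>I. ?N) (\<Pi>\<^sub>M i\<in>I. ?N) (\<lambda>x. \<lambda>i\<in>I. x i)
          = (\<Pi>\<^sub>M i\<in>I. distr (\<Pi>\<^sub>M i\<in>I. ?N) ?N (\<lambda>x. x i))" .
      qed simp
      then have "PP.indep_vars (\<lambda>_. borel) (\<lambda>i. (\<lambda>x. x) \<circ> (\<lambda>x. x i)) I"
        by (rule PP.indep_vars_compose) simp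
      then show ?thesis by (simp add: o_def)
    qed
    have "distributed (\<Pi>\<^sub>M i\<in>I. ?N) lborel (\<lambda>x. \<Sum>i\<in>?J. r i * x i)
        (normal_density (\<Sum>i\<in>?J. 0) (sqrt (\<Sum>i\<in>?J. \<bar>r i\<bar>\<^sup>2)))"
    proof (rule PP.sum_indep_normal)
      show "PP.indep_vars (\<lambda>i. borel) (\<lambda>i x. r i * x i) ?J"
        by (rule PP.indep_vars_compose2[OF PP.indep_vars_subset[OF ind]]) auto
      fix i assume i: "i \<in> ?J"
      then show "0 < \<bar>r i\<bar>" by simp
      show "distributed (\<Pi>\<^sub>M i\<in>I. ?N) lborel (\<lambda>x. r i * x i) (normal_density 0 \<bar>r i\<bar>)"
        using PP.normal_density_affine[OF distr_coord, of i "r i" 0] i by simp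
    qed (use I False in auto)
    then have d: "distr (\<Pi>\<^sub>M i\<in>I. ?N) lborel (\<lambda>x. \<Sum>i\<in>?J. r i * x i) = density lborel (normal_density 0 (sqrt (\<Sum>i\<in>?J. (r i)\<^sup>2)))"
      by (simp add: distributed_def)
    have "(\<Sum>i\<in>?J. (r i)\<^sup>2) > 0"
      using I False by (intro sum_pos) auto
    then have "normal_law (\<Sum>i\<in>?J. (r i)\<^sup>2) = density lborel (normal_density 0 (sqrt (\<Sum>i\<in>?J. (r i)\<^sup>2)))"
      by (simp add: normal_law_def)
    also have "\<dots> = distr (\<Pi>\<^sub>M i\<in>I. ?N) borel (\<lambda>x. \<Sum>i\<in>?J. r i * x i)"
      unfolding d[symmetric] by (rule distr_cong) simp_all
    finally show ?thesis unfolding sum_J sumsq_J by simp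
  qed
qed

text \<open>The law of a sum of the vectors \<open>a b\<close>, weighted by independent standard
  normal variables, where the \<open>a b\<close> come from writing the quadratic form as a sum of
  squares: its projection on \<open>t\<close> is normal with variance the sum of the squares of
  \<open>a b \<bullet> t\<close>.\<close>

lemma gaussian_law_exists:
  fixes C :: "'w::euclidean_space \<Rightarrow> 'w"
  assumes lin: "linear C" and sym: "\<And>x y. x \<bullet> C y = y \<bullet> C x" and psd: "\<And>x. 0 \<le> x \<bullet> C x"
  obtains \<mu> where "gaussian_law \<mu> C"
proof -
  have "bilinear (\<lambda>x y. x \<bullet> C y)"
    unfolding bilinear_def using lin by (auto simp: linear_iff inner_add_left inner_add_right)
  then obtain a :: "'w \<Rightarrow> 'w" where a: "\<And>x. x \<bullet> C x = (\<Sum>b\<in>Basis. (a b \<bullet> x)\<^sup>2)"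
    using psd_form_sum_squares[of "\<lambda>x y. x \<bullet> C y"] sym psd by metis
  let ?N = "density lborel std_normal_density"
  let ?P = "\<Pi>\<^sub>M b\<in>(Basis::'w set). ?N"
  have N: "prob_space ?N" by (rule prob_space_normal_density) simp
  interpret P: prob_space ?P by (intro prob_space_PiM N)
  have [measurable]: "(\<lambda>x. x b) \<in> borel_measurable ?P" if "b \<in> Basis" for b
    using measurable_component_singleton[OF that, of "\<lambda>_. ?N"] by simp
  define f where "f x = (\<Sum>b\<in>Basis. x b *\<^sub>R a b)" for x :: "'w \<Rightarrow> real"
  have [measurable]: "f \<in> borel_measurable ?P"
    unfolding f_def by measurable
  show ?thesis
  proof
    show "gaussian_law (distr ?P borel f) C"
      unfolding gaussian_law_def
    proof (intro conjI allI)
      show "prob_space (distr ?P borel f)" by (rule P.prob_space_distr) simp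
      fix t
      have "distr (distr ?P borel f) borel (\<lambda>x. t \<bullet> x) = distr ?P borel (\<lambda>x. t \<bullet> f x)"
        by (subst distr_distr) (auto simp: o_def)
      also have "\<dots> = distr ?P borel (\<lambda>x. \<Sum>b\<in>Basis. (a b \<bullet> t) * x b)"
        by (rule distr_cong) (simp_all add: f_def inner_sum_right mult.commute inner_commute)
      also have "\<dots> = normal_law (t \<bullet> C t)"
        unfolding a by (rule normal_law_sum_std_normal) simp
      finally show "distr (distr ?P borel f) borel (\<lambda>x. t \<bullet> x) = normal_law (t \<bullet> C t)" .
    qed simp
  qed
qed

section \<open>Trigonometric polynomials as test functions for convergence in law\<close>

inductive_set trig_poly :: "('w::euclidean_space \<Rightarrow> real) set" where
  cosine: "(\<lambda>x. r * cos (t \<bullet> x + c)) \<in> trig_poly"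
| add: "f \<in> trig_poly \<Longrightarrow> g \<in> trig_poly \<Longrightarrow> (\<lambda>x. f x + g x) \<in> trig_poly"

lemma trig_poly_const: "(\<lambda>x. r) \<in> trig_poly"
  using trig_poly.cosine[of r 0 0] by simp

text \<open>The product formula for cosines turns a product of two generators into a sum of two. The
  free phase \<open>c\<close> lets the same generators cover sines, so these functions form an
  algebra to which Stone--Weierstrass applies, while their expectations involve only the
  characteristic function.\<close>

lemma trig_poly_mult:
  assumes "f \<in> trig_poly" "g \<in> trig_poly"
  shows "(\<lambda>x. f x * g x) \<in> trig_poly"
  using assms
proof (induction f rule: trig_poly.induct)
  case (cosine r t c)
  from \<open>g \<in> trig_poly\<close> show ?case
  proof (induction g rule: trig_poly.induct)
    case (cosine r' t' c')
    have "(\<lambda>x. r * cos (t \<bullet> x + c) * (r' * cos (t' \<bullet> x + c')))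
      = (\<lambda>x. (r * r' / 2) * cos ((t - t') \<bullet> x + (c - c')) + (r * r' / 2) * cos ((t + t') \<bullet> x + (c + c')))"
    proof
      fix x
      let ?a = "cos ((t - t') \<bullet> x + (c - c'))" and ?b = "cos ((t + t') \<bullet> x + (c + c'))"
      have "cos (t \<bullet> x + c) * cos (t' \<bullet> x + c')
        = (cos ((t - t') \<bullet> x + (c - c')) + cos ((t + t') \<bullet> x + (c + c'))) / 2"
        unfolding cos_times_cos by (simp add: inner_diff_left inner_add_left algebra_simps)
      then have "(r * r') * (cos (t \<bullet> x + c) * cos (t' \<bullet> x + c')) = (r * r') * ((?a + ?b) / 2)" by simp
      also have "\<dots> = (r * r' / 2) * ?a + (r * r' / 2) * ?b" by (simp only: distrib_left add_divide_distrib times_divide_eq_left times_divide_eq_right)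
      finally show "r * cos (t \<bullet> x + c) * (r' * cos (t' \<bullet> x + c'))
        = (r * r' / 2) * cos ((t - t') \<bullet> x + (c - c')) + (r * r' / 2) * cos ((t + t') \<bullet> x + (c + c'))"
        by (simp only: mult_ac)
    qed
    then show ?case by (simp only: trig_poly.intros)
  next
    case (add g h)
    from trig_poly.add[OF add.IH] show ?case by (simp only: distrib_left)
  qed
next
  case (add f h)
  from trig_poly.add[OF add.IH(1)[OF add.prems] add.IH(2)[OF add.prems]] show ?case by (simp only: distrib_right)
qed

lemma trig_poly_compose_polynomial:
  assumes "real_polynomial_function p" "g \<in> trig_poly"
  shows "(\<lambda>x. p (g x)) \<in> trig_poly"
  using assms(1)
proof (induction p rule: real_polynomial_function.induct)
  case (linear f)
  then obtain k where "f = (\<lambda>x. x * k)" using real_bounded_linear by blast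
  then show ?case using trig_poly_mult[OF assms(2) trig_poly_const[of k]] by simp
qed (auto intro: trig_poly_const trig_poly.add trig_poly_mult)

lemma trig_poly_continuous: "g \<in> trig_poly \<Longrightarrow> continuous_on S g"
  by (induction rule: trig_poly.induct) (auto intro!: continuous_intros)

lemma trig_poly_measurable[measurable (raw)]: "g \<in> trig_poly \<Longrightarrow> g \<in> borel_measurable borel"
  by (intro borel_measurable_continuous_onI trig_poly_continuous)

lemma trig_poly_bounded: "g \<in> trig_poly \<Longrightarrow> \<exists>B. \<forall>x. \<bar>g x\<bar> \<le> B"
proof (induction rule: trig_poly.induct)
  case (cosine r t c)
  have "\<bar>r * cos (t \<bullet> x + c)\<bar> \<le> \<bar>r\<bar>" for x
    using mult_left_mono[OF abs_cos_le_one[of "t \<bullet> x + c"], of "\<bar>r\<bar>"] by (simp add: abs_mult)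
  then show ?case by blast
next
  case (add f g)
  then obtain B B' where "\<And>x. \<bar>f x\<bar> \<le> B" "\<And>x. \<bar>g x\<bar> \<le> B'" by blast
  then have "\<bar>f x + g x\<bar> \<le> B + B'" for x
    using abs_triangle_ineq[of "f x" "g x"] by (meson add_mono order_trans)
  then show ?case by blast
qed

text \<open>With \<open>t\<close> scaled to \<open>t \<bullet> (x - y) = 1\<close> and phase
  \<open>- (t \<bullet> y)\<close>, the two values are \<open>cos 1\<close> and
  \<open>cos 0\<close>.\<close>

lemma trig_poly_separates:
  fixes x y :: "'w::euclidean_space"
  assumes "x \<noteq> y"
  shows "\<exists>g\<in>trig_poly. g x \<noteq> g y"
proof -
  define t where "t = (1 / ((x - y) \<bullet> (x - y))) *\<^sub>R (x - y)"
  have "t \<bullet> (x - y) = 1" using assms by (simp add: t_def)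
  then have "cos (t \<bullet> x + - (t \<bullet> y)) \<noteq> cos (t \<bullet> y + - (t \<bullet> y))"
    using cos_monotone_0_pi[of 0 1] pi_gt3 by (simp add: inner_diff_right)
  then show ?thesis
    using trig_poly.cosine[of 1 t "- (t \<bullet> y)"] by (intro bexI[of _ "\<lambda>x. 1 * cos (t \<bullet> x + - (t \<bullet> y))"]) auto
qed

text \<open>Stone--Weierstrass controls the approximant only on the compact set; composing it with a polynomial
  that approximates a truncation on the range of the approximant bounds it everywhere.\<close>
lemma trig_poly_approximation:
  fixes f :: "'w::euclidean_space \<Rightarrow> real"
  assumes K: "compact K" and f: "continuous_on UNIV f" and B: "\<And>x. \<bar>f x\<bar> \<le> B" and e: "e > 0"
  obtains q where "q \<in> trig_poly" "\<And>x. x \<in> K \<Longrightarrow> \<bar>f x - q x\<bar> \<le> 2 * e" "\<And>x. \<bar>q x\<bar> \<le> B + 2 * e"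
proof -
  interpret R: function_ring_on "trig_poly :: ('w \<Rightarrow> real) set" K
    by unfold_locales (use K trig_poly_continuous trig_poly.add trig_poly_mult trig_poly_const trig_poly_separates in auto)
  have "B \<ge> 0" using B[of 0] by simp
  obtain g where g: "g \<in> trig_poly" "\<And>x. x \<in> K \<Longrightarrow> \<bar>f x - g x\<bar> < e"
    using R.Stone_Weierstrass_basic[OF continuous_on_subset[OF f] e] by auto
  obtain G where G: "\<And>x. \<bar>g x\<bar> \<le> G" using trig_poly_bounded[OF g(1)] by blast
  \<comment> \<open>On \<open>K\<close> the values of \<open>g\<close> stay within
    \<open>B + e\<close>, where the truncation is the identity. One \<open>e\<close> is spent on
    approximating \<open>f\<close> by \<open>g\<close>, the other on approximating \<open>h\<close>
    by a polynomial.\<close>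
  define h where "h s = max (- (B + e)) (min s (B + e))" for s :: real
  have "continuous_on {-G..G} h" unfolding h_def by (intro continuous_intros)
  then obtain p where p: "real_polynomial_function p" "\<And>s. s \<in> {-G..G} \<Longrightarrow> \<bar>h s - p s\<bar> < e"
    using Stone_Weierstrass_real_polynomial_function[of "{-G..G}" h e] e by auto
  have ps: "\<bar>h (g x) - p (g x)\<bar> < e" for x using G[of x] by (intro p) (auto simp: abs_le_iff)
  have hb: "\<bar>h s\<bar> \<le> B + e" for s using \<open>B \<ge> 0\<close> e by (auto simp: h_def)
  show ?thesis
  proof
    show "(\<lambda>x. p (g x)) \<in> trig_poly" by (rule trig_poly_compose_polynomial[OF p(1) g(1)])
    show "\<bar>p (g x)\<bar> \<le> B + 2 * e" for x using ps[of x] hb[of "g x"] by linarith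
    fix x assume x: "x \<in> K"
    have "\<bar>g x\<bar> \<le> B + e" using g(2)[OF x] B[of x] by linarith
    then have "h (g x) = g x" by (auto simp: h_def)
    then show "\<bar>f x - p (g x)\<bar> \<le> 2 * e" using ps[of x] g(2)[OF x] by linarith
  qed
qed

text \<open>Inside the ball of radius \<open>R\<close> the two functions are close; outside only the
  crude bound \<open>2 * B + 2 * e\<close> is available, on a set of probability at most
  \<open>e\<close>. It is stated for a random vector \<open>X\<close> so that it also covers the
  limit law, with \<open>X\<close> the identity.\<close>

lemma (in prob_space) trig_poly_expectation_diff:
  fixes f q :: "'w::euclidean_space \<Rightarrow> real"
  assumes f: "f \<in> borel_measurable borel" and q[measurable]: "q \<in> borel_measurable borel"
    and X[measurable]: "X \<in> borel_measurable M"
    and fB: "\<And>x. \<bar>f x\<bar> \<le> B" and qB: "\<And>x. \<bar>q x\<bar> \<le> B + 2 * e" and e: "e > 0"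
    and fq: "\<And>x. norm x \<le> R \<Longrightarrow> \<bar>f x - q x\<bar> \<le> 2 * e"
    and tight: "prob {\<omega>\<in>space M. R < norm (X \<omega>)} \<le> e"
  shows "\<bar>expectation (\<lambda>\<omega>. f (X \<omega>)) - expectation (\<lambda>\<omega>. q (X \<omega>))\<bar> \<le> 2 * e + (2 * B + 2 * e) * e"
proof -
  note [measurable] = f
  have B0: "B \<ge> 0" using fB[of 0] by simp
  have i: "integrable M (\<lambda>\<omega>. f (X \<omega>))" "integrable M (\<lambda>\<omega>. q (X \<omega>))"
    by (rule integrable_const_bound[where B=B]; use fB in simp)
       (rule integrable_const_bound[where B="B + 2 * e"]; use qB in simp)
  let ?A = "{\<omega>\<in>space M. R < norm (X \<omega>)}"
  have iA: "integrable M (indicator ?A :: 'a \<Rightarrow> real)"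
    by (intro integrable_real_indicator) (auto simp: emeasure_eq_measure)
  have "\<bar>expectation (\<lambda>\<omega>. f (X \<omega>)) - expectation (\<lambda>\<omega>. q (X \<omega>))\<bar> = \<bar>expectation (\<lambda>\<omega>. f (X \<omega>) - q (X \<omega>))\<bar>"
    using i by simp
  also have "\<dots> \<le> expectation (\<lambda>\<omega>. \<bar>f (X \<omega>) - q (X \<omega>)\<bar>)" by (rule integral_abs_bound)
  also have "\<dots> \<le> expectation (\<lambda>\<omega>. 2 * e + (2 * B + 2 * e) * indicator ?A \<omega>)"
  proof (rule integral_mono)
    fix \<omega> assume \<omega>: "\<omega> \<in> space M"
    show "\<bar>f (X \<omega>) - q (X \<omega>)\<bar> \<le> 2 * e + (2 * B + 2 * e) * indicator ?A \<omega>"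
    proof (cases "\<omega> \<in> ?A")
      case True
      then show ?thesis using fB[of "X \<omega>"] qB[of "X \<omega>"] e by simp
    next
      case False
      then show ?thesis using fq[of "X \<omega>"] \<omega> by simp
    qed
  next
    show "integrable M (\<lambda>\<omega>. 2 * e + (2 * B + 2 * e) * indicator ?A \<omega>)" using iA by simp
  qed (use i in auto)
  also have "\<dots> = 2 * e + (2 * B + 2 * e) * prob ?A" using iA by (simp add: prob_space)
  also have "\<dots> \<le> 2 * e + (2 * B + 2 * e) * e"
    using tight B0 e by (intro add_left_mono mult_left_mono) auto
  finally show ?thesis .
qed

text \<open>The prescribed lower bound \<open>R0\<close> lets one radius serve the limit law
  together with a tight sequence.\<close>

lemma (in prob_space) tight_single:
  fixes X :: "'a \<Rightarrow> 'w::euclidean_space"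
  assumes [measurable]: "X \<in> borel_measurable M" and e: "e > 0"
  obtains R where "prob {\<omega>\<in>space M. R < norm (X \<omega>)} \<le> e" "R \<ge> R0"
proof -
  let ?A = "\<lambda>n::nat. {\<omega>\<in>space M. real n < norm (X \<omega>)}"
  have "(\<lambda>n. prob (?A n)) \<longlonglongrightarrow> prob (\<Inter>n. ?A n)"
    by (rule finite_Lim_measure_decseq) (auto simp: decseq_def)
  moreover have "(\<Inter>n. ?A n) = {}"
  proof -
    have "\<exists>n::nat. \<not> real n < norm (X \<omega>)" for \<omega> using reals_Archimedean2[of "norm (X \<omega>)"] less_asym by blast
    then show ?thesis by fastforce
  qed
  ultimately have "(\<lambda>n. prob (?A n)) \<longlonglongrightarrow> 0" by simp
  then have "\<forall>\<^sub>F n in sequentially. prob (?A n) < e" using e by (rule order_tendstoD)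
  moreover have "\<forall>\<^sub>F n in sequentially. real n \<ge> R0"
    by (metis eventually_sequentiallyI nat_ceiling_le_eq)
  ultimately have "\<forall>\<^sub>F n in sequentially. prob (?A n) < e \<and> real n \<ge> R0" by (rule eventually_conj)
  then obtain n where "prob (?A n) < e" "real n \<ge> R0" by (auto simp: eventually_sequentially)
  then show ?thesis using that[of "real n"] by simp
qed

text \<open>A continuity theorem in the manner of Levy with the limit law given in advance:
  convergence on cosines extends by linearity to trigonometric polynomials, and tightness reduces a
  bounded continuous function to such a polynomial on a large ball.\<close>

lemma (in prob_space) conv_in_law_if_cos_conv:
  fixes X :: "nat \<Rightarrow> 'a \<Rightarrow> 'w::euclidean_space"
  assumes X[measurable]: "\<And>n. X n \<in> borel_measurable M"
    and \<mu>: "prob_space \<mu>" "sets \<mu> = sets borel"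
    and tight: "\<And>e. e > 0 \<Longrightarrow> \<exists>R. \<forall>n. prob {\<omega>\<in>space M. R < norm (X n \<omega>)} \<le> e"
    and cos_conv: "\<And>t c. (\<lambda>n. expectation (\<lambda>\<omega>. cos (t \<bullet> X n \<omega> + c))) \<longlonglongrightarrow> (\<integral>x. cos (t \<bullet> x + c) \<partial>\<mu>)"
  shows "conv_in_law M X \<mu>"
  unfolding conv_in_law_def
proof (intro allI impI)
  interpret \<mu>: prob_space \<mu> by fact
  note [measurable_cong] = \<mu>(2)
  fix f :: "'w \<Rightarrow> real" assume f: "continuous_on UNIV f \<and> bounded (range f)"
  then obtain B where B: "\<And>x. \<bar>f x\<bar> \<le> B" unfolding bounded_iff by auto
  have B0: "B \<ge> 0" using B[of 0] by simp
  have [measurable]: "f \<in> borel_measurable borel" using f by (intro borel_measurable_continuous_onI) auto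
  have trig: "(\<lambda>n. expectation (\<lambda>\<omega>. g (X n \<omega>))) \<longlonglongrightarrow> (\<integral>x. g x \<partial>\<mu>)" if "g \<in> trig_poly" for g
    using that
  proof (induction rule: trig_poly.induct)
    case (cosine r t c)
    then show ?case using tendsto_mult_left[OF cos_conv[of t c], of r] by simp
  next
    case (add f g)
    have int: "integrable M (\<lambda>\<omega>. h (X n \<omega>))" "integrable \<mu> h" if h: "h \<in> trig_poly" for h n
    proof -
      obtain b where b: "\<And>x. \<bar>h x\<bar> \<le> b" using trig_poly_bounded[OF h] by blast
      note [measurable] = trig_poly_measurable[OF h]
      show "integrable M (\<lambda>\<omega>. h (X n \<omega>))" "integrable \<mu> h"
        using b by (auto intro!: integrable_const_bound[where B=b] \<mu>.integrable_const_bound[where B=b])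
    qed
    show ?case using tendsto_add[OF add.IH] add.hyps int by simp
  qed
  show "(\<lambda>n. expectation (\<lambda>\<omega>. f (X n \<omega>))) \<longlonglongrightarrow> (\<integral>x. f x \<partial>\<mu>)"
  proof (rule tendstoI)
    fix d :: real assume d: "d > 0"
    \<comment> \<open>For \<open>e \<le> 1\<close> the approximation error
      \<open>2 * e + (2 * B + 2 * e) * e\<close> is at most \<open>e * k\<close>, hence at most
      \<open>d / 4\<close>; it is incurred once under \<open>M\<close> and once under \<mu>.\<close>
    define k where "k = 2 + (2 * B + 2)"
    have k: "k > 0" using B0 by (simp add: k_def)
    define e where "e = min 1 (d / 4 / k)"
    have e: "e > 0" "e \<le> 1" using d k by (auto simp: e_def)
    have "e * k \<le> (d / 4 / k) * k" using k by (intro mult_right_mono) (auto simp: e_def)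
    also have "\<dots> = d / 4" using k by simp
    finally have e3: "e * (2 + (2 * B + 2)) \<le> d / 4" by (simp only: k_def)
    have small: "2 * e + (2 * B + 2 * e) * e \<le> d / 4"
    proof -
      have "(2 * B + 2 * e) * e \<le> (2 * B + 2) * e" using e by (intro mult_right_mono) auto
      then show ?thesis using e3 by (simp add: algebra_simps)
    qed
    obtain R0 where R0: "\<And>n. prob {\<omega>\<in>space M. R0 < norm (X n \<omega>)} \<le> e" using tight[OF e(1)] by blast
    obtain R where R: "\<mu>.prob {x\<in>space \<mu>. R < norm x} \<le> e" "R \<ge> R0"
      using \<mu>.tight_single[of "\<lambda>x. x" e R0] e(1) by (auto simp: measurable_ident_sets[OF \<mu>(2)])
    have RX: "prob {\<omega>\<in>space M. R < norm (X n \<omega>)} \<le> e" for n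
      by (rule order_trans[OF finite_measure_mono R0[of n]]) (use R(2) in auto)
    obtain q where q: "q \<in> trig_poly" "\<And>x. x \<in> cball 0 R \<Longrightarrow> \<bar>f x - q x\<bar> \<le> 2 * e" "\<And>x. \<bar>q x\<bar> \<le> B + 2 * e"
      using trig_poly_approximation[OF compact_cball conjunct1[OF f] B e(1)] by blast
    note [measurable] = trig_poly_measurable[OF q(1)]
    have "\<bar>expectation (\<lambda>\<omega>. f (X n \<omega>)) - expectation (\<lambda>\<omega>. q (X n \<omega>))\<bar> \<le> d / 4" for n
      by (rule order_trans[OF trig_poly_expectation_diff[OF _ _ X B q(3) e(1) _ RX] small]) (use q(2) in auto)
    note fq1 = this
    have fq2: "\<bar>(\<integral>x. f x \<partial>\<mu>) - (\<integral>x. q x \<partial>\<mu>)\<bar> \<le> d / 4"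
      by (rule order_trans[OF \<mu>.trig_poly_expectation_diff[OF _ _ _ B q(3) e(1) _ R(1)] small])
         (use q(2) in \<open>auto simp: measurable_ident_sets[OF \<mu>(2)]\<close>)
    have "\<forall>\<^sub>F n in sequentially. \<bar>expectation (\<lambda>\<omega>. q (X n \<omega>)) - (\<integral>x. q x \<partial>\<mu>)\<bar> < d / 4"
      using tendstoD[OF trig[OF q(1)], of "d / 4"] d by (simp add: dist_real_def)
    then show "\<forall>\<^sub>F n in sequentially. dist (expectation (\<lambda>\<omega>. f (X n \<omega>))) (\<integral>x. f x \<partial>\<mu>) < d"
    proof eventually_elim
      case (elim n)
      then show ?case using fq1[of n] fq2 d unfolding dist_real_def by linarith
    qed
  qed
qed

section \<open>Second moments and the central limit theorem\<close>

lemma (in prob_space) indep_sum_second_moment: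
  fixes X :: "'i \<Rightarrow> 'a \<Rightarrow> real"
  assumes "finite I" "indep_vars (\<lambda>_. borel) X I"
    and "\<And>i. i \<in> I \<Longrightarrow> integrable M (\<lambda>\<omega>. (X i \<omega>)\<^sup>2)" "\<And>i. i \<in> I \<Longrightarrow> expectation (X i) = 0"
  shows "integrable M (\<lambda>\<omega>. (\<Sum>i\<in>I. X i \<omega>)\<^sup>2) \<and>
         expectation (\<lambda>\<omega>. (\<Sum>i\<in>I. X i \<omega>)\<^sup>2) = (\<Sum>i\<in>I. expectation (\<lambda>\<omega>. (X i \<omega>)\<^sup>2))"
  using assms
proof (induction I rule: finite_induct)
  case (insert j I)
  have rv[measurable]: "X i \<in> borel_measurable M" if "i \<in> insert j I" for i
    using insert.prems(1) that by (auto simp: indep_vars_def)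
  have int: "integrable M (X i)" if "i \<in> insert j I" for i
    by (rule square_integrable_imp_integrable) (use insert.prems rv that in auto)
  have IH: "integrable M (\<lambda>\<omega>. (\<Sum>i\<in>I. X i \<omega>)\<^sup>2)"
    "expectation (\<lambda>\<omega>. (\<Sum>i\<in>I. X i \<omega>)\<^sup>2) = (\<Sum>i\<in>I. expectation (\<lambda>\<omega>. (X i \<omega>)\<^sup>2))"
    using insert.IH insert.prems indep_vars_subset[OF insert.prems(1), of I] by auto
  have ind: "indep_var borel (X j) borel (\<lambda>\<omega>. \<Sum>i\<in>I. X i \<omega>)"
    by (rule indep_vars_sum[OF insert.hyps insert.prems(1)])
  have intS: "integrable M (\<lambda>\<omega>. \<Sum>i\<in>I. X i \<omega>)" using int by (intro Bochner_Integration.integrable_sum) auto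
  have intp: "integrable M (\<lambda>\<omega>. X j \<omega> * (\<Sum>i\<in>I. X i \<omega>))"
    by (rule indep_var_integrable[OF ind int intS]) simp
  have E: "expectation (\<lambda>\<omega>. X j \<omega> * (\<Sum>i\<in>I. X i \<omega>)) = 0"
    using indep_var_lebesgue_integral[OF ind int[of j] intS] insert.prems(3)[of j] by simp
  have eq: "(\<Sum>i\<in>insert j I. X i \<omega>)\<^sup>2 = (X j \<omega>)\<^sup>2 + (2 * (X j \<omega> * (\<Sum>i\<in>I. X i \<omega>)) + (\<Sum>i\<in>I. X i \<omega>)\<^sup>2)" for \<omega>
    using insert.hyps by (simp add: power2_sum)
  have ij: "integrable M (\<lambda>\<omega>. (X j \<omega>)\<^sup>2)" using insert.prems by simp
  have i2: "integrable M (\<lambda>\<omega>. 2 * (X j \<omega> * (\<Sum>i\<in>I. X i \<omega>)) + (\<Sum>i\<in>I. X i \<omega>)\<^sup>2)"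
    using intp IH(1) by (intro Bochner_Integration.integrable_add integrable_mult_right)
  have "expectation (\<lambda>\<omega>. 2 * (X j \<omega> * (\<Sum>i\<in>I. X i \<omega>)) + (\<Sum>i\<in>I. X i \<omega>)\<^sup>2) = (\<Sum>i\<in>I. expectation (\<lambda>\<omega>. (X i \<omega>)\<^sup>2))"
    using intp IH E by (subst Bochner_Integration.integral_add) auto
  then show ?case
    unfolding eq using ij i2 insert.hyps by simp
qed simp

text \<open>Independent centred terms are orthogonal, so their variances add and the factor
  \<open>1 / n\<close> cancels the number of terms. The empty sum at \<open>n = 0\<close> is why a
  bound is stated instead of an equality. The bound supplies tightness and, later, the mean square
  control of the majorant.\<close>

lemma (in prob_space) iid_normalized_sum_second_moment:
  fixes \<xi> :: "nat \<Rightarrow> 'a \<Rightarrow> 'w::euclidean_space"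
  assumes ind: "indep_vars (\<lambda>_. borel) \<xi> UNIV"
    and ident: "\<And>n. distr M borel (\<xi> n) = distr M borel (\<xi> 0)"
    and sq: "integrable M (\<lambda>\<omega>. (norm (\<xi> 0 \<omega>))\<^sup>2)" and mean: "expectation (\<xi> 0) = 0"
  shows "integrable M (\<lambda>\<omega>. (norm ((1 / sqrt (real n)) *\<^sub>R (\<Sum>i<n. \<xi> i \<omega>)))\<^sup>2)" (is ?int)
    and "expectation (\<lambda>\<omega>. (norm ((1 / sqrt (real n)) *\<^sub>R (\<Sum>i<n. \<xi> i \<omega>)))\<^sup>2) \<le> expectation (\<lambda>\<omega>. (norm (\<xi> 0 \<omega>))\<^sup>2)" (is ?le)
    and "\<And>t i. integrable M (\<lambda>\<omega>. (t \<bullet> \<xi> i \<omega>)\<^sup>2)"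
    and "\<And>t i. expectation (\<lambda>\<omega>. t \<bullet> \<xi> i \<omega>) = 0"
    and "\<And>t i. expectation (\<lambda>\<omega>. (t \<bullet> \<xi> i \<omega>)\<^sup>2) = expectation (\<lambda>\<omega>. (t \<bullet> \<xi> 0 \<omega>)\<^sup>2)"
proof -
  have rv[measurable]: "\<xi> i \<in> borel_measurable M" for i using ind by (simp add: indep_vars_def)
  have transfer: "integrable M (\<lambda>\<omega>. g (\<xi> i \<omega>)) \<longleftrightarrow> integrable M (\<lambda>\<omega>. g (\<xi> 0 \<omega>))"
    "expectation (\<lambda>\<omega>. g (\<xi> i \<omega>)) = expectation (\<lambda>\<omega>. g (\<xi> 0 \<omega>))"
    if [measurable]: "g \<in> borel_measurable borel" for i and g :: "'w \<Rightarrow> real"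
    using integrable_distr_eq[OF rv[of i] that] integrable_distr_eq[OF rv[of 0] that]
      integral_distr[OF rv[of i] that] integral_distr[OF rv[of 0] that] ident[of i] by simp_all
  have int0: "integrable M (\<xi> 0)"
  proof (rule Bochner_Integration.integrable_bound)
    show "integrable M (\<lambda>\<omega>. 1 + (norm (\<xi> 0 \<omega>))\<^sup>2)" using sq by simp
    have "norm x \<le> 1 + (norm x)\<^sup>2" for x :: 'w
      using sum_power2_ge_zero[of "norm x - 1/2" 0] by (simp add: power2_eq_square algebra_simps)
    then show "AE \<omega> in M. norm (\<xi> 0 \<omega>) \<le> norm (1 + (norm (\<xi> 0 \<omega>))\<^sup>2)" by simp
  qed simp
  have sq0: "integrable M (\<lambda>\<omega>. (t \<bullet> \<xi> 0 \<omega>)\<^sup>2)" for t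
  proof (rule Bochner_Integration.integrable_bound)
    show "integrable M (\<lambda>\<omega>. (norm t)\<^sup>2 * (norm (\<xi> 0 \<omega>))\<^sup>2)" using sq by simp
    have "(t \<bullet> x)\<^sup>2 \<le> (norm t)\<^sup>2 * (norm x)\<^sup>2" for x
      using power_mono[OF Cauchy_Schwarz_ineq2[of t x], of 2] by (simp add: power_mult_distrib)
    then show "AE \<omega> in M. norm ((t \<bullet> \<xi> 0 \<omega>)\<^sup>2) \<le> norm ((norm t)\<^sup>2 * (norm (\<xi> 0 \<omega>))\<^sup>2)" by simp
  qed simp
  show tsq: "integrable M (\<lambda>\<omega>. (t \<bullet> \<xi> i \<omega>)\<^sup>2)" for t i
    using sq0[of t] by (subst transfer) auto
  show tmean: "expectation (\<lambda>\<omega>. t \<bullet> \<xi> i \<omega>) = 0" for t i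
    using int0 mean by (subst transfer) auto
  show tvar: "expectation (\<lambda>\<omega>. (t \<bullet> \<xi> i \<omega>)\<^sup>2) = expectation (\<lambda>\<omega>. (t \<bullet> \<xi> 0 \<omega>)\<^sup>2)" for t i
    by (rule transfer) auto
  have indt: "indep_vars (\<lambda>_. borel) (\<lambda>i \<omega>. t \<bullet> \<xi> i \<omega>) {..<n}" for t
    by (rule indep_vars_compose2[OF indep_vars_subset[OF ind]]) auto
  note mom = indep_sum_second_moment[OF finite_lessThan indt tsq tmean]
  have norm_eq: "(norm ((1 / sqrt (real n)) *\<^sub>R (\<Sum>i<n. \<xi> i \<omega>)))\<^sup>2
      = (1 / real n) * (\<Sum>b\<in>Basis. (\<Sum>i<n. b \<bullet> \<xi> i \<omega>)\<^sup>2)" for \<omega>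
  proof -
    have "(norm x)\<^sup>2 = (\<Sum>b\<in>Basis. (b \<bullet> x)\<^sup>2)" for x :: 'w
      by (simp add: norm_eq_sqrt_inner euclidean_inner[of x x] sum_nonneg power2_eq_square inner_commute)
    from this[of "\<Sum>i<n. \<xi> i \<omega>"]
    have "(norm (\<Sum>i<n. \<xi> i \<omega>))\<^sup>2 = (\<Sum>b\<in>Basis. (\<Sum>i<n. b \<bullet> \<xi> i \<omega>)\<^sup>2)"
      by (simp only: inner_sum_right)
    then show ?thesis by (simp add: power_mult_distrib power_divide)
  qed
  show ?int unfolding norm_eq using mom by (intro integrable_mult_right Bochner_Integration.integrable_sum) auto
  have "expectation (\<lambda>\<omega>. (norm ((1 / sqrt (real n)) *\<^sub>R (\<Sum>i<n. \<xi> i \<omega>)))\<^sup>2)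
      = (1 / real n) * (\<Sum>b\<in>Basis. \<Sum>i<n. expectation (\<lambda>\<omega>. (b \<bullet> \<xi> i \<omega>)\<^sup>2))"
    unfolding norm_eq using mom by (simp add: Bochner_Integration.integral_sum)
  also have "\<dots> = (real n / real n) * (\<Sum>b\<in>Basis. expectation (\<lambda>\<omega>. (b \<bullet> \<xi> 0 \<omega>)\<^sup>2))"
  proof -
    have "(\<Sum>i<n. expectation (\<lambda>\<omega>. (b \<bullet> \<xi> i \<omega>)\<^sup>2)) = (\<Sum>i<n. expectation (\<lambda>\<omega>. (b \<bullet> \<xi> 0 \<omega>)\<^sup>2))" for b
      by (intro sum.cong refl tvar)
    then show ?thesis by (simp add: sum_distrib_left)
  qed
  also have "\<dots> \<le> (\<Sum>b\<in>Basis. expectation (\<lambda>\<omega>. (b \<bullet> \<xi> 0 \<omega>)\<^sup>2))"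
    using sum_nonneg[of Basis "\<lambda>b. expectation (\<lambda>\<omega>. (b \<bullet> \<xi> 0 \<omega>)\<^sup>2)"]
    by (intro mult_left_le_one_le) auto
  also have "\<dots> = expectation (\<lambda>\<omega>. \<Sum>b\<in>Basis. (b \<bullet> \<xi> 0 \<omega>)\<^sup>2)"
    by (rule Bochner_Integration.integral_sum[symmetric]) (rule tsq)
  also have "\<dots> = expectation (\<lambda>\<omega>. (norm (\<xi> 0 \<omega>))\<^sup>2)"
    by (simp add: norm_eq_sqrt_inner euclidean_inner[of "\<xi> 0 \<omega>" "\<xi> 0 \<omega>" for \<omega>] sum_nonneg power2_eq_square inner_commute)
  finally show ?le .
qed

lemma (in prob_space) second_moment_tail_bound:
  fixes T :: "'a \<Rightarrow> real"
  assumes [measurable]: "T \<in> borel_measurable M" and "integrable M (\<lambda>\<omega>. (T \<omega>)\<^sup>2)" "expectation (\<lambda>\<omega>. (T \<omega>)\<^sup>2) \<le> c" "R > 0"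
  shows "prob {\<omega>\<in>space M. R < T \<omega>} \<le> c / R\<^sup>2"
proof -
  have "prob {\<omega>\<in>space M. R < T \<omega>} \<le> prob {\<omega>\<in>space M. R\<^sup>2 \<le> (T \<omega>)\<^sup>2}"
    using assms by (intro finite_measure_mono) (auto intro!: power_mono)
  also have "\<dots> \<le> expectation (\<lambda>\<omega>. (T \<omega>)\<^sup>2) / R\<^sup>2"
    using assms by (intro integral_Markov_inequality_measure[where A="space M"]) auto
  also have "\<dots> \<le> c / R\<^sup>2" using assms by (intro divide_right_mono) auto
  finally show ?thesis .
qed

text \<open>For \<open>v > 0\<close> the scalar central limit theorem standardises by the standard
  deviation, so the test function is rescaled to \<open>cos (sqrt v * x + c)\<close>. For
  \<open>v = 0\<close> all terms vanish almost surely and both sides equal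
  \<open>cos c\<close>.\<close>

lemma (in prob_space) cos_normalized_sum_tendsto:
  fixes X :: "nat \<Rightarrow> 'a \<Rightarrow> real"
  assumes ind: "indep_vars (\<lambda>_. borel) X UNIV"
    and ident: "\<And>n. distr M borel (X n) = distr M borel (X 0)"
    and sq: "\<And>n. integrable M (\<lambda>\<omega>. (X n \<omega>)\<^sup>2)" and mean: "\<And>n. expectation (X n) = 0"
    and var: "\<And>n. expectation (\<lambda>\<omega>. (X n \<omega>)\<^sup>2) = v"
  shows "(\<lambda>n. expectation (\<lambda>\<omega>. cos ((\<Sum>i<n. X i \<omega>) / sqrt (real n) + c))) \<longlonglongrightarrow> (\<integral>x. cos (x + c) \<partial>normal_law v)"
proof (cases "v = 0")
  case True
  have rv[measurable]: "X i \<in> borel_measurable M" for i using ind by (simp add: indep_vars_def)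
  have "AE \<omega> in M. (X i \<omega>)\<^sup>2 = 0" for i
    using integral_nonneg_eq_0_iff_AE[OF sq[of i]] var[of i] True by auto
  then have "AE \<omega> in M. \<forall>i. X i \<omega> = 0" by (simp add: AE_all_countable)
  then have "AE \<omega> in M. cos ((\<Sum>i<n. X i \<omega>) / sqrt (real n) + c) = cos c" for n
    by eventually_elim simp
  then have "expectation (\<lambda>\<omega>. cos ((\<Sum>i<n. X i \<omega>) / sqrt (real n) + c)) = expectation (\<lambda>_. cos c)" for n
    by (intro integral_cong_AE) auto
  then show ?thesis using True by (simp add: normal_law_def prob_space integral_return)
next
  case False
  have rv[measurable]: "X i \<in> borel_measurable M" for i using ind by (simp add: indep_vars_def)
  have "v \<ge> 0" unfolding var[of 0, symmetric] by simp
  with False have v: "v > 0" by simp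
  let ?\<sigma> = "sqrt v"
  let ?S = "\<lambda>n \<omega>. (\<Sum>i<n. X i \<omega>) / sqrt (real n * ?\<sigma>\<^sup>2)"
  have "weak_conv_m (\<lambda>n. distr M borel (?S n)) std_normal_distribution"
    by (rule central_limit_theorem_zero_mean[OF ind mean _ sq _ ident]) (use v mean var in auto)
  then have "(\<lambda>n. \<integral>x. cos (?\<sigma> * x + c) \<partial>distr M borel (?S n)) \<longlonglongrightarrow> (\<integral>x. cos (?\<sigma> * x + c) \<partial>std_normal_distribution)"
  proof (rule weak_conv_imp_integral_bdd_continuous_conv[rotated 2])
    show "real_distribution (distr M borel (?S n))" for n
      by (intro real_distribution_distr) simp
    show "real_distribution std_normal_distribution"
      by (rule real_dist_normal_dist)
    show "isCont (\<lambda>x. cos (?\<sigma> * x + c)) x" for x by (intro continuous_intros)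
    show "norm (cos (?\<sigma> * x + c)) \<le> 1" for x by simp
  qed
  moreover have "(\<integral>x. cos (?\<sigma> * x + c) \<partial>distr M borel (?S n)) = expectation (\<lambda>\<omega>. cos ((\<Sum>i<n. X i \<omega>) / sqrt (real n) + c))" for n
  proof -
    have "?\<sigma> * ?S n \<omega> = (\<Sum>i<n. X i \<omega>) / sqrt (real n)" for \<omega>
      using v by (simp add: real_sqrt_mult)
    then show ?thesis by (subst integral_distr) auto
  qed
  moreover have "(\<integral>x. cos (?\<sigma> * x + c) \<partial>std_normal_distribution) = (\<integral>x. cos (x + c) \<partial>normal_law v)"
  proof -
    interpret N: prob_space std_normal_distribution by (rule prob_space_normal_density) simp
    have "distributed std_normal_distribution lborel (\<lambda>x. x) (normal_density 0 1)"
      by (simp add: distributed_def distr_id2)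
    from N.normal_density_affine[OF this, of "?\<sigma>" 0]
    have "distr std_normal_distribution lborel (\<lambda>x. ?\<sigma> * x) = normal_law v"
      using v by (simp add: distributed_def normal_law_def)
    then have "(\<integral>x. cos (x + c) \<partial>normal_law v) = (\<integral>x. cos (x + c) \<partial>distr std_normal_distribution lborel (\<lambda>x. ?\<sigma> * x))"
      by simp
    also have "\<dots> = (\<integral>x. cos (?\<sigma> * x + c) \<partial>std_normal_distribution)"
      by (rule integral_distr) auto
    finally show ?thesis by simp
  qed
  ultimately show ?thesis by simp
qed

text \<open>The Cramer--Wold device: a cosine of \<open>t \<bullet> x + c\<close> sees only the
  scalar sums of \<open>t \<bullet> \<xi> i\<close>, and the bound on second moments gives
  tightness.\<close>

theorem (in prob_space) multivariate_central_limit_theorem: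
  fixes \<xi> :: "nat \<Rightarrow> 'a \<Rightarrow> 'w::euclidean_space"
  assumes ind: "indep_vars (\<lambda>_. borel) \<xi> UNIV"
    and ident: "\<And>n. distr M borel (\<xi> n) = distr M borel (\<xi> 0)"
    and sq: "integrable M (\<lambda>\<omega>. (norm (\<xi> 0 \<omega>))\<^sup>2)" and mean: "expectation (\<xi> 0) = 0"
    and \<mu>: "gaussian_law \<mu> C" and cov: "\<And>t. t \<bullet> C t = expectation (\<lambda>\<omega>. (t \<bullet> \<xi> 0 \<omega>)\<^sup>2)"
  shows "conv_in_law M (\<lambda>n \<omega>. (1 / sqrt (real n)) *\<^sub>R (\<Sum>i<n. \<xi> i \<omega>)) \<mu>"
proof (rule conv_in_law_if_cos_conv)
  have rv[measurable]: "\<xi> i \<in> borel_measurable M" for i using ind by (simp add: indep_vars_def)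
  note mom = iid_normalized_sum_second_moment[OF ind ident sq mean]
  show "(\<lambda>\<omega>. (1 / sqrt (real n)) *\<^sub>R (\<Sum>i<n. \<xi> i \<omega>)) \<in> borel_measurable M" for n by simp
  show \<mu>': "prob_space \<mu>" "sets \<mu> = sets borel" using \<mu> by (auto simp: gaussian_law_def)
  show "\<exists>R. \<forall>n. prob {\<omega>\<in>space M. R < norm ((1 / sqrt (real n)) *\<^sub>R (\<Sum>i<n. \<xi> i \<omega>))} \<le> e" if e: "e > 0" for e
  proof (intro exI allI)
    fix n
    let ?c = "expectation (\<lambda>\<omega>. (norm (\<xi> 0 \<omega>))\<^sup>2)"
    have "?c \<ge> 0" by simp
    then have c: "?c \<ge> 0" "0 < ?c + 1" by linarith+
    \<comment> \<open>Chebyshev's inequality with squared radius \<open>(?c + 1) / e\<close>; the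
      added \<open>1\<close> keeps the radius positive when all the vectors vanish almost
      surely.\<close>
    have "prob {\<omega>\<in>space M. sqrt ((?c + 1) / e) < norm ((1 / sqrt (real n)) *\<^sub>R (\<Sum>i<n. \<xi> i \<omega>))} \<le> ?c / (sqrt ((?c + 1) / e))\<^sup>2"
      by (rule second_moment_tail_bound[OF _ mom(1,2)]) (use e c in \<open>auto intro!: divide_pos_pos\<close>)
    also have "\<dots> = e * (?c / (?c + 1))" using e c by simp
    also have "\<dots> \<le> e * 1" using e c by (intro mult_left_mono) (simp_all add: divide_le_eq)
    finally show "prob {\<omega>\<in>space M. sqrt ((?c + 1) / e) < norm ((1 / sqrt (real n)) *\<^sub>R (\<Sum>i<n. \<xi> i \<omega>))} \<le> e" by simp
  qed
  fix t c
  have t_ident: "distr M borel (\<lambda>\<omega>. t \<bullet> \<xi> n \<omega>) = distr M borel (\<lambda>\<omega>. t \<bullet> \<xi> 0 \<omega>)" for n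
    using distr_distr[of "(\<bullet>) t" borel borel "\<xi> n" M] distr_distr[of "(\<bullet>) t" borel borel "\<xi> 0" M] ident[of n]
    by (simp add: o_def)
  have "(\<lambda>n. expectation (\<lambda>\<omega>. cos ((\<Sum>i<n. t \<bullet> \<xi> i \<omega>) / sqrt (real n) + c)))
      \<longlonglongrightarrow> (\<integral>x. cos (x + c) \<partial>normal_law (t \<bullet> C t))"
    by (rule cos_normalized_sum_tendsto[where X="\<lambda>i \<omega>. t \<bullet> \<xi> i \<omega>", OF _ t_ident mom(3,4)])
       (auto simp: cov intro!: indep_vars_compose2[OF ind] mom(5))
  also have "normal_law (t \<bullet> C t) = distr \<mu> borel (\<lambda>x. t \<bullet> x)" using \<mu> by (simp add: gaussian_law_def)
  also have "(\<integral>x. cos (x + c) \<partial>distr \<mu> borel (\<lambda>x. t \<bullet> x)) = (\<integral>x. cos (t \<bullet> x + c) \<partial>\<mu>)"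
    by (rule integral_distr) (auto simp: measurable_cong_sets[OF \<mu>'(2) refl])
  finally show "(\<lambda>n. expectation (\<lambda>\<omega>. cos (t \<bullet> ((1 / sqrt (real n)) *\<^sub>R (\<Sum>i<n. \<xi> i \<omega>)) + c))) \<longlonglongrightarrow> (\<integral>x. cos (t \<bullet> x + c) \<partial>\<mu>)"
    by (simp add: inner_sum_right)
qed

text \<open>Closeness is measured relative to \<open>T n\<close>, which may be unbounded along a
  fixed outcome but exceeds a large \<open>R\<close> only with small probability. Where
  \<open>T n \<le> R\<close>, both vectors lie in one ball and differ by at most
  \<open>e * R\<close>, so uniform continuity of \<open>f\<close> on that ball applies.\<close>

lemma (in prob_space) slutsky:
  fixes X X' :: "nat \<Rightarrow> 'a \<Rightarrow> 'w::euclidean_space" and T :: "nat \<Rightarrow> 'a \<Rightarrow> real"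
  assumes conv: "conv_in_law M X \<mu>"
    and [measurable]: "\<And>n. X n \<in> borel_measurable M" "\<And>n. X' n \<in> borel_measurable M" "\<And>n. T n \<in> borel_measurable M"
    and T: "\<And>n. integrable M (\<lambda>\<omega>. (T n \<omega>)\<^sup>2)" "\<And>n. expectation (\<lambda>\<omega>. (T n \<omega>)\<^sup>2) \<le> c"
    and XT: "\<And>n \<omega>. norm (X n \<omega>) \<le> T n \<omega>"
    and close: "\<And>e. e > 0 \<Longrightarrow> AE \<omega> in M. \<forall>\<^sub>F n in sequentially. norm (X' n \<omega> - X n \<omega>) \<le> e * T n \<omega>"
  shows "conv_in_law M X' \<mu>"
  unfolding conv_in_law_def
proof (intro allI impI)
  fix f :: "'w \<Rightarrow> real" assume f: "continuous_on UNIV f \<and> bounded (range f)"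
  then obtain B where B: "\<And>x. \<bar>f x\<bar> \<le> B" unfolding bounded_iff by auto
  have B0: "B \<ge> 0" using B[of 0] by simp
  have [measurable]: "f \<in> borel_measurable borel" using f by (intro borel_measurable_continuous_onI) auto
  have "0 \<le> expectation (\<lambda>\<omega>. (T 0 \<omega>)\<^sup>2)" by simp
  then have c0: "c \<ge> 0" using T(2)[of 0] by linarith
  have iX: "integrable M (\<lambda>\<omega>. f (X n \<omega>))" and iX': "integrable M (\<lambda>\<omega>. f (X' n \<omega>))" for n
    using B by (auto intro!: integrable_const_bound[where B=B])
  have "(\<lambda>n. expectation (\<lambda>\<omega>. f (X' n \<omega>)) - expectation (\<lambda>\<omega>. f (X n \<omega>))) \<longlonglongrightarrow> 0"
  proof (rule tendstoI)
    fix d :: real assume d: "d > 0"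
    \<comment> \<open>Chosen so that \<open>2 * B\<close> times the Chebyshev bound
      \<open>c / R^2\<close> is at most \<open>d / 4\<close>; the increments by \<open>1\<close>
      avoid a zero radius.\<close>
    define R where "R = sqrt (8 * (B + 1) * (c + 1) / d)"
    have R: "R > 0" using d B0 c0 by (simp add: R_def)
    have R2: "2 * B * (c / R\<^sup>2) \<le> d / 4"
    proof -
      have Rsq: "R\<^sup>2 = 8 * (B + 1) * (c + 1) / d" using d B0 c0 by (simp add: R_def)
      have eq: "2 * B * (c / (8 * k * l / d)) = (d / 4) * ((B / k) * (c / l))" if "k > 0" "l > 0" for k l
        using d that by (simp add: field_simps)
      have "2 * B * (c / R\<^sup>2) = (d / 4) * ((B / (B + 1)) * (c / (c + 1)))"
        unfolding Rsq by (rule eq) (use B0 c0 in auto)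
      also have "\<dots> \<le> (d / 4) * (1 * 1)"
        using d B0 c0 by (intro mult_left_mono mult_mono) (auto simp: divide_le_eq)
      finally show ?thesis by simp
    qed
    have "uniformly_continuous_on (cball 0 (R + 1)) f"
      using f by (intro compact_uniformly_continuous) (auto intro: continuous_on_subset)
    then have "\<exists>\<delta>>0. \<forall>x\<in>cball 0 (R + 1). \<forall>y\<in>cball 0 (R + 1). dist y x < \<delta> \<longrightarrow> dist (f y) (f x) < d / 4"
      unfolding uniformly_continuous_on_def by (elim allE[of _ "d / 4"]) (use d in simp)
    then obtain \<delta> where \<delta>: "\<delta> > 0" "\<And>x y. x \<in> cball 0 (R + 1) \<Longrightarrow> y \<in> cball 0 (R + 1) \<Longrightarrow> dist y x < \<delta> \<Longrightarrow> dist (f y) (f x) < d / 4"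
      by blast
    \<comment> \<open>\<open>e * R \<le> 1\<close> keeps both points in the ball of radius
      \<open>R + 1\<close>, and \<open>e * R < \<delta>\<close> gives closeness of the values of
      \<open>f\<close>.\<close>
    define e where "e = min 1 (\<delta> / 2) / R"
    have e: "e > 0" "e * R \<le> 1" "e * R < \<delta>" using R \<delta>(1) by (auto simp: e_def)
    define A where "A n = {\<omega>\<in>space M. R < T n \<omega>}" for n
    define D where "D n = {\<omega>\<in>space M. e * T n \<omega> < norm (X' n \<omega> - X n \<omega>)}" for n
    have [measurable]: "A n \<in> sets M" "D n \<in> sets M" for n by (auto simp: A_def D_def)
    have iA: "integrable M (indicator (A n) :: 'a \<Rightarrow> real)" "integrable M (indicator (D n) :: 'a \<Rightarrow> real)" for n
      by (auto intro!: integrable_real_indicator simp: emeasure_eq_measure)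
    have point: "\<bar>f (X' n \<omega>) - f (X n \<omega>)\<bar> \<le> d / 4 + (2 * B * indicator (A n) \<omega> + 2 * B * indicator (D n) \<omega>)"
      if \<omega>: "\<omega> \<in> space M" for n \<omega>
    proof (cases "\<omega> \<in> A n \<or> \<omega> \<in> D n")
      case True
      then show ?thesis using B[of "X' n \<omega>"] B[of "X n \<omega>"] B0 d by (auto simp: indicator_def)
    next
      case False
      then have T': "T n \<omega> \<le> R" and c': "norm (X' n \<omega> - X n \<omega>) \<le> e * T n \<omega>" using \<omega> by (auto simp: A_def D_def)
      have "e * T n \<omega> \<le> e * R" using T' e by simp
      then have 1: "norm (X' n \<omega> - X n \<omega>) < \<delta>" "norm (X' n \<omega> - X n \<omega>) \<le> 1" using c' e by linarith+
      have 2: "norm (X n \<omega>) \<le> R" using XT[of n \<omega>] T' by linarith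
      have "norm (X' n \<omega>) \<le> R + 1" using norm_triangle_sub[of "X' n \<omega>" "X n \<omega>"] 1 2 by linarith
      then have "dist (f (X' n \<omega>)) (f (X n \<omega>)) < d / 4"
        using 1 2 by (intro \<delta>(2)) (auto simp: dist_norm)
      then show ?thesis using False by (simp add: dist_real_def)
    qed
    have bound: "\<bar>expectation (\<lambda>\<omega>. f (X' n \<omega>)) - expectation (\<lambda>\<omega>. f (X n \<omega>))\<bar> \<le> d / 4 + (d / 4 + 2 * B * prob (D n))" for n
    proof -
      have "\<bar>expectation (\<lambda>\<omega>. f (X' n \<omega>)) - expectation (\<lambda>\<omega>. f (X n \<omega>))\<bar> = \<bar>expectation (\<lambda>\<omega>. f (X' n \<omega>) - f (X n \<omega>))\<bar>"
        using iX iX' by simp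
      also have "\<dots> \<le> expectation (\<lambda>\<omega>. \<bar>f (X' n \<omega>) - f (X n \<omega>)\<bar>)" by (rule integral_abs_bound)
      also have "\<dots> \<le> expectation (\<lambda>\<omega>. d / 4 + (2 * B * indicator (A n) \<omega> + 2 * B * indicator (D n) \<omega>))"
        using iX iX' iA point by (intro integral_mono) auto
      also have "\<dots> = d / 4 + (2 * B * prob (A n) + 2 * B * prob (D n))"
        using iA by (simp add: prob_space)
      also have "2 * B * prob (A n) \<le> 2 * B * (c / R\<^sup>2)"
        unfolding A_def using B0 R T by (intro mult_left_mono second_moment_tail_bound) auto
      also note R2
      finally show ?thesis by simp
    qed
    \<comment> \<open>Almost every outcome leaves the events \<open>D n\<close> for good, so their
      probabilities tend to \<open>0\<close> by dominated convergence.\<close>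
    have "(\<lambda>n. expectation (indicator (D n) :: 'a \<Rightarrow> real)) \<longlonglongrightarrow> expectation (\<lambda>_. 0)"
    proof (rule integral_dominated_convergence[where w="\<lambda>_. 1"])
      show "AE \<omega> in M. (\<lambda>n. indicator (D n) \<omega> :: real) \<longlonglongrightarrow> 0"
        using close[OF e(1)]
      proof eventually_elim
        case (elim \<omega>)
        have "\<forall>\<^sub>F n in sequentially. indicator (D n) \<omega> = (0 :: real)"
          using elim by eventually_elim (auto simp: D_def indicator_def)
        then show ?case by (rule tendsto_eventually)
      qed
    qed auto
    then have "(\<lambda>n. 2 * B * prob (D n)) \<longlonglongrightarrow> 2 * B * 0" by (intro tendsto_intros) simp
    then have "\<forall>\<^sub>F n in sequentially. 2 * B * prob (D n) < d / 4" using d by (intro order_tendstoD(2)[of _ 0]) auto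
    then show "\<forall>\<^sub>F n in sequentially. dist (expectation (\<lambda>\<omega>. f (X' n \<omega>)) - expectation (\<lambda>\<omega>. f (X n \<omega>))) 0 < d"
    proof eventually_elim
      case (elim n)
      then show ?case using bound[of n] d by simp
    qed
  qed
  moreover have "(\<lambda>n. expectation (\<lambda>\<omega>. f (X n \<omega>))) \<longlonglongrightarrow> (\<integral>x. f x \<partial>\<mu>)"
    using conv f unfolding conv_in_law_def by blast
  ultimately show "(\<lambda>n. expectation (\<lambda>\<omega>. f (X' n \<omega>))) \<longlonglongrightarrow> (\<integral>x. f x \<partial>\<mu>)"
    using tendsto_add by fastforce
qed

section \<open>Matrix calculus\<close>

lemma matrix_inv_mult:
  fixes A :: "real^'n^'n"
  assumes "invertible A"
  shows "A ** matrix_inv A = mat 1" "matrix_inv A ** A = mat 1"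
  using assms someI_ex[of "\<lambda>A'. A ** A' = mat 1 \<and> A' ** A = mat 1"]
  unfolding invertible_def matrix_inv_def by blast+

lemma trace_mult_commute: "trace (A ** B) = trace (B ** A)"
  for A :: "real^'n^'m" and B :: "real^'m^'n"
  unfolding trace_def matrix_matrix_mult_def
  by simp (subst sum.swap, simp add: mult.commute)

text \<open>By linearity in row \<open>i\<close>, each summand other than the one with
  \<open>k = i\<close> has a repeated row and vanishes.\<close>

lemma det_replace_row_by_combination:
  fixes A :: "real^'n^'n"
  shows "det (\<chi> j. if j = i then (\<Sum>k\<in>UNIV. c k *s (A $ k)) else A $ j) = c i * det A"
proof -
  have "det (\<chi> j. if j = i then (\<Sum>k\<in>UNIV. c k *s (A $ k)) else A $ j)
      = (\<Sum>k\<in>UNIV. det (\<chi> j. if j = i then c k *s (A $ k) else A $ j))"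
    by (rule det_linear_row_sum) simp
  also have "\<dots> = (\<Sum>k\<in>UNIV. c k * det (\<chi> j. if j = i then A $ k else A $ j))"
    by (rule sum.cong[OF refl]) (rule det_row_mul)
  also have "\<dots> = (\<Sum>k\<in>UNIV. if k = i then c i * det A else 0)"
  proof (rule sum.cong[OF refl])
    fix k
    show "c k * det (\<chi> j. if j = i then A $ k else A $ j) = (if k = i then c i * det A else 0)"
    proof (cases "k = i")
      case True
      then have "(\<chi> j. if j = i then A $ k else A $ j) = A" by (simp add: vec_eq_iff)
      with True show ?thesis by simp
    next
      case False
      then have "det (\<chi> j. if j = i then A $ k else A $ j) = 0"
        by (intro det_identical_rows[of k i]) (simp_all add: row_def)
      with False show ?thesis by simp
    qed
  qed
  finally show ?thesis by simp
qed

lemma has_derivative_det: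
  fixes A :: "real^'n^'n"
  shows "(det has_derivative (\<lambda>H. \<Sum>i\<in>UNIV. det (\<chi> j. if j = i then H $ j else A $ j))) (at A)"
proof -
  have ent: "((\<lambda>A. A $ i $ j) has_derivative (\<lambda>H. H $ i $ j)) (at A)" for i j :: 'n
    by (intro bounded_linear_imp_has_derivative bounded_linear_compose[OF bounded_linear_vec_nth bounded_linear_vec_nth])
  have "(det has_derivative (\<lambda>H. \<Sum>p\<in>{p. p permutes UNIV}. of_int (sign p) *
      (\<Sum>i\<in>UNIV. H $ i $ p i * (\<Prod>j\<in>UNIV - {i}. A $ j $ p j)))) (at A)"
    unfolding det_def[abs_def]
    by (intro has_derivative_sum has_derivative_mult_right has_derivative_prod ent)
  also have "(\<lambda>H. \<Sum>p\<in>{p. p permutes UNIV}. of_int (sign p) *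
      (\<Sum>i\<in>UNIV. H $ i $ p i * (\<Prod>j\<in>UNIV - {i}. A $ j $ p j)))
    = (\<lambda>H. \<Sum>i\<in>UNIV. det (\<chi> j. if j = i then H $ j else A $ j))"
  proof
    fix H :: "real^'n^'n"
    have prod: "H $ i $ p i * (\<Prod>j\<in>UNIV - {i}. A $ j $ p j)
        = (\<Prod>j\<in>UNIV. (\<chi> j. if j = i then H $ j else A $ j) $ j $ p j)" for i and p :: "'n \<Rightarrow> 'n"
      by (subst prod.remove[of UNIV i]) auto
    show "(\<Sum>p\<in>{p. p permutes UNIV}. of_int (sign p) *
        (\<Sum>i\<in>UNIV. H $ i $ p i * (\<Prod>j\<in>UNIV - {i}. A $ j $ p j)))
      = (\<Sum>i\<in>UNIV. det (\<chi> j. if j = i then H $ j else A $ j))"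
      unfolding det_def prod sum_distrib_left by (rule sum.swap)
  qed
  finally show ?thesis .
qed

text \<open>Jacobi's formula without cofactors: \<open>H\<close> equals
  \<open>H ** matrix_inv A ** A\<close>, so every row of \<open>H\<close> is a combination of rows
  of \<open>A\<close>, and putting row \<open>i\<close> of \<open>H\<close> into \<open>A\<close>
  multiplies the determinant by the \<open>i\<close>-th diagonal entry of
  \<open>H ** matrix_inv A\<close>.\<close>

lemma has_derivative_det_invertible:
  fixes A :: "real^'n^'n"
  assumes A: "invertible A"
  shows "(det has_derivative (\<lambda>H. det A * trace (matrix_inv A ** H))) (at A)"
proof -
  have "(\<Sum>i\<in>UNIV. det (\<chi> j. if j = i then H $ j else A $ j)) = det A * trace (matrix_inv A ** H)" for H
  proof -
    let ?C = "H ** matrix_inv A"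
    have "H = ?C ** A" using matrix_inv_mult[OF A] by (simp flip: matrix_mul_assoc)
    moreover have "(C ** A) $ i = (\<Sum>k\<in>UNIV. C $ i $ k *s (A $ k))" for C :: "real^'n^'n" and i
      by (simp add: matrix_matrix_mult_def vec_eq_iff)
    ultimately have row: "H $ i = (\<Sum>k\<in>UNIV. ?C $ i $ k *s (A $ k))" for i
      by metis
    have "(\<chi> j. if j = i then H $ j else A $ j)
        = (\<chi> j. if j = i then (\<Sum>k\<in>UNIV. ?C $ i $ k *s (A $ k)) else A $ j)" for i
      using row by (metis (no_types, lifting))
    then have "(\<Sum>i\<in>UNIV. det (\<chi> j. if j = i then H $ j else A $ j)) = (\<Sum>i\<in>UNIV. ?C $ i $ i * det A)"
      by (simp only: det_replace_row_by_combination)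
    also have "\<dots> = det A * trace ?C"
      by (simp add: trace_def sum_distrib_left mult.commute)
    finally show ?thesis by (simp only: trace_mult_commute[of H])
  qed
  then show ?thesis using has_derivative_det[of A] by simp
qed

lemma has_derivative_ln_det:
  fixes A :: "real^'n^'n"
  assumes "det A > 0"
  shows "((\<lambda>A. ln (det A)) has_derivative (\<lambda>H. trace (matrix_inv A ** H))) (at A)"
proof -
  have "invertible A" using assms invertible_det_nz by force
  from has_derivative_ln[OF assms has_derivative_det_invertible[OF this]] assms
  show ?thesis by (simp add: field_simps)
qed

lemma continuous_on_det: "continuous_on UNIV (det :: real^'n^'n \<Rightarrow> real)"
  using has_derivative_det has_derivative_continuous by (fastforce intro: continuous_at_imp_continuous_on)

lemma tendsto_det[tendsto_intros]:
  fixes A :: "real^'n^'n"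
  shows "(f \<longlongrightarrow> A) F \<Longrightarrow> ((\<lambda>x. det (f x)) \<longlongrightarrow> det A) F"
  using continuous_on_det continuous_on_tendsto_compose[of UNIV det f A F] by auto

lemma bounded_bilinear_matrix_mult: "bounded_bilinear ((**) :: real^'n^'m \<Rightarrow> real^'k^'n \<Rightarrow> real^'k^'m)"
proof -
  have "bilinear ((**) :: real^'n^'m \<Rightarrow> real^'k^'n \<Rightarrow> real^'k^'m)"
    unfolding bilinear_def linear_iff
    by (auto simp: vec_eq_iff matrix_matrix_mult_def sum.distrib algebra_simps sum_distrib_left)
  then show ?thesis by (simp add: bilinear_conv_bounded_bilinear)
qed

lemma bounded_linear_trace: "bounded_linear (trace :: real^'n^'n \<Rightarrow> real)"
  unfolding linear_conv_bounded_linear[symmetric] linear_iff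
  by (auto simp: trace_def sum.distrib sum_distrib_left)

text \<open>Cramer's rule for the right-hand side \<open>axis j 1\<close> gives column
  \<open>j\<close> of the inverse. The entries thereby become quotients of determinants, from which
  continuity of inversion follows.\<close>

lemma matrix_inv_eq_cofactor:
  fixes A :: "real^'n^'n"
  assumes "det A \<noteq> 0"
  shows "matrix_inv A = (\<chi> k j. det (\<chi> i l. if l = k then axis j 1 $ i else A $ i $ l) / det A)"
proof -
  have inv: "invertible A" using assms invertible_det_nz by blast
  have "A *v (matrix_inv A *v axis j 1) = axis j 1" for j
    by (simp add: matrix_vector_mul_assoc matrix_inv_mult[OF inv])
  then have "matrix_inv A *v axis j 1 = (\<chi> k. det (\<chi> i l. if l = k then axis j 1 $ i else A $ i $ l) / det A)" for j
    using cramer[OF assms] by blast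
  then have "(matrix_inv A *v axis j 1) $ k = det (\<chi> i l. if l = k then axis j 1 $ i else A $ i $ l) / det A" for j k
    by simp
  then show ?thesis
    by (simp add: vec_eq_iff matrix_vector_mult_basis column_def)
qed

text \<open>At a singular matrix \<open>matrix_inv\<close> is an unspecified choice. The determinant
  is nonzero eventually, and there the inverse agrees with the continuous quotient formula.\<close>

lemma tendsto_matrix_inv:
  fixes A :: "real^'n^'n"
  assumes f: "(f \<longlongrightarrow> A) F" and A: "det A \<noteq> 0"
  shows "((\<lambda>x. matrix_inv (f x)) \<longlongrightarrow> matrix_inv A) F"
proof -
  let ?C = "\<lambda>A::real^'n^'n. (\<chi> k j. det (\<chi> i l. if l = k then axis j 1 $ i else A $ i $ l) / det A) :: real^'n^'n"
  have lim: "((\<lambda>x. ?C (f x)) \<longlongrightarrow> ?C A) F"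
  proof (intro tendsto_vec_lambda tendsto_divide tendsto_det f A)
    fix i l k j :: 'n
    show "((\<lambda>x. if l = k then axis j 1 $ i else f x $ i $ l) \<longlongrightarrow> (if l = k then axis j 1 $ i else A $ i $ l)) F"
      using f by (auto intro!: tendsto_intros)
  qed
  have ev: "\<forall>\<^sub>F x in F. ?C (f x) = matrix_inv (f x)"
  proof -
    have "\<forall>\<^sub>F x in F. det (f x) \<noteq> 0"
      using tendsto_imp_eventually_ne[OF tendsto_det[OF f] A] .
    then show ?thesis by eventually_elim (rule matrix_inv_eq_cofactor[symmetric])
  qed
  have "((\<lambda>x. matrix_inv (f x)) \<longlongrightarrow> ?C A) F"
    by (rule Lim_transform_eventually[OF lim ev])
  then show ?thesis
    by (simp only: matrix_inv_eq_cofactor[OF A])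
qed

text \<open>From the resolvent identity for \<open>matrix_inv X - matrix_inv A\<close>, the first
  order remainder is \<open>(matrix_inv A - matrix_inv X) ** (X - A) ** matrix_inv A\<close>. After
  division by the norm of \<open>X - A\<close> it tends to \<open>0\<close> by continuity of
  inversion.\<close>

lemma has_derivative_matrix_inv:
  fixes A :: "real^'n^'n"
  assumes A: "det A \<noteq> 0"
  shows "(matrix_inv has_derivative (\<lambda>H. - (matrix_inv A ** H ** matrix_inv A))) (at A)"
proof -
  interpret B: bounded_bilinear "(**) :: real^'n^'n \<Rightarrow> real^'n^'n \<Rightarrow> real^'n^'n"
    by (rule bounded_bilinear_matrix_mult)
  obtain K where K: "K > 0" "\<And>(X::real^'n^'n) (Y::real^'n^'n). norm (X ** Y) \<le> norm X * norm Y * K"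
    using B.pos_bounded by blast
  let ?i = "matrix_inv A"
  have lin: "bounded_linear (\<lambda>H. - (?i ** H ** ?i))"
    by (intro bounded_linear_minus bounded_linear_compose[OF B.bounded_linear_left B.bounded_linear_right])
  show ?thesis
    unfolding has_derivative_at2
  proof (intro conjI lin)
    have ev: "\<forall>\<^sub>F X in at A. det X \<noteq> 0"
      by (rule tendsto_imp_eventually_ne[OF tendsto_det[OF tendsto_ident_at] A])
    have lim: "((\<lambda>X. norm (?i - matrix_inv X) * norm ?i * K * K) \<longlongrightarrow> norm (?i - ?i) * norm ?i * K * K) (at A)"
      by (intro tendsto_intros tendsto_matrix_inv tendsto_ident_at A)
    show "((\<lambda>X. (1 / norm (X - A)) *\<^sub>R (matrix_inv X - (?i + - (?i ** (X - A) ** ?i)))) \<longlongrightarrow> 0) (at A)"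
    proof (rule Lim_null_comparison)
      show "((\<lambda>X. norm (?i - matrix_inv X) * norm ?i * K * K) \<longlongrightarrow> 0) (at A)" using lim by simp
      show "\<forall>\<^sub>F X in at A. norm ((1 / norm (X - A)) *\<^sub>R (matrix_inv X - (?i + - (?i ** (X - A) ** ?i))))
          \<le> norm (?i - matrix_inv X) * norm ?i * K * K"
        using ev eventually_neq_at_within[of A A UNIV]
      proof eventually_elim
        case (elim X)
        have iA: "invertible A" and iX: "invertible X" using A elim by (auto simp: invertible_det_nz)
        have "matrix_inv X ** (X - A) ** ?i = (matrix_inv X ** X) ** ?i - matrix_inv X ** (A ** ?i)"
          by (simp add: B.diff_left B.diff_right matrix_mul_assoc)
        then have d: "matrix_inv X - ?i = - (matrix_inv X ** (X - A) ** ?i)"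
          by (simp add: matrix_inv_mult[OF iA] matrix_inv_mult[OF iX])
        have "matrix_inv X - (?i + - (?i ** (X - A) ** ?i)) = (matrix_inv X - ?i) + ?i ** (X - A) ** ?i"
          by simp
        also have "\<dots> = (?i - matrix_inv X) ** (X - A) ** ?i"
          unfolding d by (simp add: B.diff_left)
        finally have eq: "matrix_inv X - (?i + - (?i ** (X - A) ** ?i)) = (?i - matrix_inv X) ** (X - A) ** ?i" .
        have "norm ((?i - matrix_inv X) ** (X - A) ** ?i) \<le> norm ((?i - matrix_inv X) ** (X - A)) * norm ?i * K"
          by (rule K)
        also have "\<dots> \<le> (norm (?i - matrix_inv X) * norm (X - A) * K) * norm ?i * K"
          by (intro mult_right_mono K) (use K in auto)
        finally show ?case
          unfolding eq using elim by (simp add: field_simps)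
      qed
    qed
  qed
qed

lemma outer_bounded_bilinear: "bounded_bilinear (outer :: real^'d \<Rightarrow> real^'d \<Rightarrow> real^'d^'d)"
proof -
  have "bilinear (outer :: real^'d \<Rightarrow> real^'d \<Rightarrow> real^'d^'d)"
    unfolding bilinear_def linear_iff outer_def by (simp add: vec_eq_iff algebra_simps)
  then show ?thesis by (simp add: bilinear_conv_bounded_bilinear)
qed

interpretation outer: bounded_bilinear "outer :: real^'d \<Rightarrow> real^'d \<Rightarrow> real^'d^'d"
  by (rule outer_bounded_bilinear)

interpretation matmul: bounded_bilinear "(**) :: real^'n^'m \<Rightarrow> real^'k^'n \<Rightarrow> real^'k^'m"
  by (rule bounded_bilinear_matrix_mult)

lemmas linear_trace = bounded_linear.linear[OF bounded_linear_trace]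

lemma trace_mult_outer: "trace (P ** outer x y) = y \<bullet> (P *v x)"
proof -
  have "trace (P ** outer x y) = (\<Sum>i\<in>UNIV. \<Sum>k\<in>UNIV. P $ i $ k * (x $ k * y $ i))"
    by (simp add: trace_def matrix_matrix_mult_def outer_def)
  also have "\<dots> = y \<bullet> (P *v x)"
    by (simp add: inner_vec_def matrix_vector_mult_def sum_distrib_left mult_ac)
  finally show ?thesis .
qed

lemma outer_mult_vector: "outer x y *v z = (y \<bullet> z) *\<^sub>R x"
  by (simp add: vec_eq_iff outer_def matrix_vector_mult_def inner_vec_def sum_distrib_left sum_distrib_right mult_ac)

lemma bounded_linear_matrix_vector_left: "bounded_linear (\<lambda>A::real^'n^'m. A *v x)"
  unfolding linear_conv_bounded_linear[symmetric] linear_iff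
  by (simp add: matrix_vector_mult_add_rdistrib scaleR_matrix_vector_assoc)

section \<open>Positive definite matrices and strict monotonicity of the log determinant\<close>

definition pos_def :: "real^'n^'n \<Rightarrow> bool" where
  "pos_def A \<longleftrightarrow> (\<forall>x. x \<noteq> 0 \<longrightarrow> 0 < x \<bullet> (A *v x))"

lemma pos_def_invertible: "pos_def A \<Longrightarrow> invertible A"
  unfolding invertible_left_inverse matrix_left_invertible_ker pos_def_def by force

lemma pos_def_nonneg: "pos_def A \<Longrightarrow> 0 \<le> x \<bullet> (A *v x)"
  by (cases "x = 0") (auto simp: pos_def_def less_imp_le)

lemma pos_def_mat_1: "pos_def (mat 1)"
  by (simp add: pos_def_def)

lemma pos_def_add_psd:
  assumes "pos_def A" "\<And>x. 0 \<le> x \<bullet> (B *v x)" "t \<ge> 0"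
  shows "pos_def (A + t *\<^sub>R B)"
  using assms unfolding pos_def_def
  by (simp add: matrix_vector_mult_add_rdistrib inner_add_right scaleR_matrix_vector_assoc[symmetric] add_pos_nonneg)

lemma pos_def_scaleR: "pos_def A \<Longrightarrow> t > 0 \<Longrightarrow> pos_def (t *\<^sub>R A)"
  unfolding pos_def_def by (simp add: scaleR_matrix_vector_assoc[symmetric])

text \<open>The segment from the identity to \<open>A\<close> consists of invertible matrices.\<close>
lemma pos_def_det_pos:
  fixes A :: "real^'n^'n"
  assumes A: "pos_def A"
  shows "det A > 0"
proof (rule ccontr)
  assume "\<not> det A > 0"
  let ?P = "\<lambda>t. (1 - t) *\<^sub>R mat 1 + t *\<^sub>R A"
  have cont: "continuous_on {0..1} (\<lambda>t. det (?P t))"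
    by (intro continuous_on_compose2[OF continuous_on_det] continuous_intros) auto
  have "\<exists>t\<ge>0. t \<le> 1 \<and> det (?P t) = 0"
    by (rule IVT2'[OF _ _ _ cont]) (use \<open>\<not> det A > 0\<close> in auto)
  then obtain t where t: "0 \<le> t" "t \<le> 1" "det (?P t) = 0" by blast
  have "pos_def (?P t)"
  proof (cases "t = 1")
    case False
    then show ?thesis
      using t pos_def_nonneg[OF A] by (intro pos_def_add_psd pos_def_scaleR pos_def_mat_1) auto
  qed (use A in simp)
  then show False using t(3) pos_def_invertible invertible_det_nz by blast
qed

text \<open>Adding \<open>t\<close> times the identity makes the matrix positive definite; then
  \<open>t\<close> decreases to \<open>0\<close>.\<close>

lemma psd_det_nonneg:
  fixes A :: "real^'n^'n"
  assumes A: "\<And>x. 0 \<le> x \<bullet> (A *v x)"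
  shows "det A \<ge> 0"
proof -
  have "((\<lambda>t. det (t *\<^sub>R mat 1 + A)) \<longlongrightarrow> det (0 *\<^sub>R mat 1 + A)) (at_right 0)"
    by (intro tendsto_intros)
  then have "((\<lambda>t. det (t *\<^sub>R mat 1 + A)) \<longlongrightarrow> det A) (at_right 0)" by simp
  then show ?thesis
  proof (rule tendsto_lowerbound)
    have "0 \<le> det (t *\<^sub>R mat 1 + A)" if "t > 0" for t
      using pos_def_det_pos[OF pos_def_add_psd[OF pos_def_scaleR[OF pos_def_mat_1 that], of A 1]] A by simp
    then show "\<forall>\<^sub>F t in at_right 0. 0 \<le> det (t *\<^sub>R mat 1 + A)"
      by (auto simp: eventually_at_right_less intro: eventually_mono[OF eventually_at_right_less])
  qed simp
qed

lemma pos_def_matrix_inv: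
  fixes A :: "real^'n^'n"
  assumes A: "pos_def A"
  shows "pos_def (matrix_inv A)"
  unfolding pos_def_def
proof (intro allI impI)
  fix x :: "real^'n" assume x: "x \<noteq> 0"
  let ?y = "matrix_inv A *v x"
  have x_eq: "A *v ?y = x"
    by (simp add: matrix_vector_mul_assoc matrix_inv_mult[OF pos_def_invertible[OF A]])
  then have "?y \<noteq> 0" using x by auto
  then have "0 < ?y \<bullet> (A *v ?y)" using A by (simp add: pos_def_def)
  then show "0 < x \<bullet> ?y" by (simp add: x_eq inner_commute)
qed

text \<open>Along the segment \<open>A + t B\<close> the derivative of the log determinant is
  \<open>trace (matrix_inv (A + t B) ** B)\<close>. The inverse moves with \<open>t\<close>, which
  is why positivity of \<open>trace (P ** B)\<close> is asked for every positive definite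
  \<open>P\<close>.\<close>

lemma ln_det_less_add:
  fixes A B :: "real^'n^'n"
  assumes A: "pos_def A" and B: "\<And>x. 0 \<le> x \<bullet> (B *v x)"
    and tr: "\<And>P. pos_def P \<Longrightarrow> 0 < trace (P ** B)"
  shows "ln (det A) < ln (det (A + B))"
proof -
  have pd: "pos_def (A + t *\<^sub>R B)" if "t \<ge> 0" for t
    using pos_def_add_psd[OF A B that] .
  have "(\<lambda>t. ln (det (A + t *\<^sub>R B))) 0 < (\<lambda>t. ln (det (A + t *\<^sub>R B))) 1"
  proof (rule DERIV_pos_imp_increasing[where f="\<lambda>t. ln (det (A + t *\<^sub>R B))" and a=0 and b=1])
    fix t :: real assume t: "0 \<le> t" "t \<le> 1"
    have lin: "((\<lambda>t. A + t *\<^sub>R B) has_derivative (\<lambda>h. h *\<^sub>R B)) (at t)"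
      by (auto intro!: derivative_eq_intros)
    have "((\<lambda>t. ln (det (A + t *\<^sub>R B))) has_derivative (\<lambda>h. trace (matrix_inv (A + t *\<^sub>R B) ** (h *\<^sub>R B)))) (at t)"
      by (rule has_derivative_compose[OF lin has_derivative_ln_det]) (intro pos_def_det_pos pd t)
    also have "(\<lambda>h. trace (matrix_inv (A + t *\<^sub>R B) ** (h *\<^sub>R B))) = (*) (trace (matrix_inv (A + t *\<^sub>R B) ** B))"
      by (simp add: fun_eq_iff matmul.scaleR_right linear_scale[OF linear_trace])
    finally have "((\<lambda>t. ln (det (A + t *\<^sub>R B))) has_real_derivative trace (matrix_inv (A + t *\<^sub>R B) ** B)) (at t)"
      unfolding has_field_derivative_def .
    moreover have "0 < trace (matrix_inv (A + t *\<^sub>R B) ** B)"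
      by (intro tr pos_def_matrix_inv pd t)
    ultimately show "\<exists>y. ((\<lambda>t. ln (det (A + t *\<^sub>R B))) has_real_derivative y) (at t) \<and> 0 < y" by blast
  qed simp
  then show ?thesis by simp
qed

section \<open>Regression with a smooth family of functions\<close>

text \<open>\<open>F1 W b z\<close> and \<open>F2 W b b' z\<close> are directional derivatives at
  \<open>W\<close>, with the later direction last. Keeping directions as vectors treats the weights
  as an abstract Euclidean space, so the tuple structure of the perceptron weights does not enter
  the asymptotics.\<close>

locale smooth_family =
  fixes F :: "'w::euclidean_space \<Rightarrow> 'z::euclidean_space \<Rightarrow> real^'d"
    and F1 :: "'w \<Rightarrow> 'w \<Rightarrow> 'z \<Rightarrow> real^'d"
    and F2 :: "'w \<Rightarrow> 'w \<Rightarrow> 'w \<Rightarrow> 'z \<Rightarrow> real^'d"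
  assumes F_deriv: "\<And>W z. ((\<lambda>W. F W z) has_derivative (\<lambda>b. F1 W b z)) (at W)"
    and F1_deriv: "\<And>W b z. ((\<lambda>W. F1 W b z) has_derivative (\<lambda>b'. F2 W b b' z)) (at W)"
    and F2_cont: "\<And>b b' z. continuous_on UNIV (\<lambda>W. F2 W b b' z)"
    and F_meas[measurable]: "\<And>W. F W \<in> borel_measurable borel"
    and F1_meas[measurable]: "\<And>W b. F1 W b \<in> borel_measurable borel"
    and F2_meas[measurable]: "\<And>W b b'. F2 W b b' \<in> borel_measurable borel"
begin

definition resid :: "'w \<Rightarrow> (real^'d) \<times> 'z \<Rightarrow> real^'d" where
  "resid W v = fst v - F W (snd v)"

definition sq_resid :: "'w \<Rightarrow> (real^'d) \<times> 'z \<Rightarrow> real^'d^'d" where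
  "sq_resid W v = outer (resid W v) (resid W v)"

text \<open>The direction precedes the parameter so that, for fixed directions, the squared residual
  and its derivatives are functions of the same shape and one uniform law covers them all.\<close>

definition sq_resid1 :: "'w \<Rightarrow> 'w \<Rightarrow> (real^'d) \<times> 'z \<Rightarrow> real^'d^'d" where
  "sq_resid1 b W v = - (outer (F1 W b (snd v)) (resid W v) + outer (resid W v) (F1 W b (snd v)))"

definition sq_resid2 :: "'w \<Rightarrow> 'w \<Rightarrow> 'w \<Rightarrow> (real^'d) \<times> 'z \<Rightarrow> real^'d^'d" where
  "sq_resid2 b b' W v = outer (F1 W b (snd v)) (F1 W b' (snd v)) + outer (F1 W b' (snd v)) (F1 W b (snd v))
     - (outer (F2 W b b' (snd v)) (resid W v) + outer (resid W v) (F2 W b b' (snd v)))"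

lemma linear_F1: "linear (\<lambda>b. F1 W b z)"
  by (rule has_derivative_linear[OF F_deriv])

lemma resid_deriv: "((\<lambda>W. resid W v) has_derivative (\<lambda>b. - F1 W b (snd v))) (at W)"
  unfolding resid_def by (auto intro!: derivative_eq_intros F_deriv)

lemma sq_resid_deriv: "((\<lambda>W. sq_resid W v) has_derivative (\<lambda>b. sq_resid1 b W v)) (at W)"
proof -
  have "((\<lambda>W. sq_resid W v) has_derivative
      (\<lambda>b. outer (resid W v) (- F1 W b (snd v)) + outer (- F1 W b (snd v)) (resid W v))) (at W)"
    unfolding sq_resid_def by (intro outer.FDERIV resid_deriv)
  then show ?thesis
    by (simp add: sq_resid1_def outer.minus_left outer.minus_right add.commute)
qed

lemma sq_resid1_deriv: "((\<lambda>W. sq_resid1 b W v) has_derivative (\<lambda>b'. sq_resid2 b b' W v)) (at W)"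
proof -
  have "((\<lambda>W. sq_resid1 b W v) has_derivative
      (\<lambda>b'. - ((outer (F1 W b (snd v)) (- F1 W b' (snd v)) + outer (F2 W b b' (snd v)) (resid W v))
         + (outer (resid W v) (F2 W b b' (snd v)) + outer (- F1 W b' (snd v)) (F1 W b (snd v)))))) (at W)"
    unfolding sq_resid1_def
    by (intro has_derivative_minus has_derivative_add outer.FDERIV resid_deriv F1_deriv)
  moreover have "(\<lambda>b'. - ((outer (F1 W b (snd v)) (- F1 W b' (snd v)) + outer (F2 W b b' (snd v)) (resid W v))
         + (outer (resid W v) (F2 W b b' (snd v)) + outer (- F1 W b' (snd v)) (F1 W b (snd v)))))
       = (\<lambda>b'. sq_resid2 b b' W v)"
    by (simp add: fun_eq_iff sq_resid2_def outer.minus_left outer.minus_right)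
  ultimately show ?thesis by simp
qed

lemma F_continuous: "continuous_on UNIV (\<lambda>W. F W z)"
  by (intro continuous_at_imp_continuous_on ballI has_derivative_continuous[OF F_deriv])

lemma F1_continuous: "continuous_on UNIV (\<lambda>W. F1 W b z)"
  by (intro continuous_at_imp_continuous_on ballI has_derivative_continuous[OF F1_deriv])

lemma sq_resid_continuous: "continuous_on S (\<lambda>W. sq_resid W v)"
  by (intro continuous_at_imp_continuous_on ballI has_derivative_continuous[OF sq_resid_deriv])

lemma sq_resid1_continuous: "continuous_on S (\<lambda>W. sq_resid1 b W v)"
  by (intro continuous_at_imp_continuous_on ballI has_derivative_continuous[OF sq_resid1_deriv])

lemma sq_resid2_continuous: "continuous_on S (\<lambda>W. sq_resid2 b b' W v)"
proof (rule continuous_on_subset)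
  have "continuous_on UNIV (\<lambda>W. resid W v)"
    unfolding resid_def by (intro continuous_on_diff continuous_on_const F_continuous)
  then show "continuous_on UNIV (\<lambda>W. sq_resid2 b b' W v)"
    unfolding sq_resid2_def
    by (intro continuous_on_diff continuous_on_add outer.continuous_on F1_continuous F2_cont)
qed simp

lemma measurable_outer[measurable]:
  assumes [measurable]: "f \<in> borel_measurable M" "g \<in> borel_measurable M"
  shows "(\<lambda>x. outer (f x) (g x) :: real^'d^'d) \<in> borel_measurable M"
proof -
  have "continuous_on UNIV (\<lambda>p::(real^'d)\<times>(real^'d). outer (fst p) (snd p))"
    by (intro outer.continuous_on continuous_on_fst continuous_on_snd continuous_on_id)
  from measurable_compose[OF _ borel_measurable_continuous_onI[OF this], of "\<lambda>x. (f x, g x)" M]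
  show ?thesis by simp
qed

lemma measurable_snd_borel: "(snd :: (real^'d) \<times> 'z \<Rightarrow> 'z) \<in> borel_measurable borel"
  by (rule borel_measurable_continuous_onI[OF continuous_on_snd[OF continuous_on_id]])

lemma measurable_resid[measurable]: "resid W \<in> borel_measurable borel"
proof -
  have "(fst :: (real^'d) \<times> 'z \<Rightarrow> real^'d) \<in> borel_measurable borel"
    by (rule borel_measurable_continuous_onI[OF continuous_on_fst[OF continuous_on_id]])
  then show ?thesis
    unfolding resid_def[abs_def]
    by (intro borel_measurable_diff measurable_compose[OF measurable_snd_borel F_meas])
qed

lemma measurable_F1_snd[measurable]: "(\<lambda>v::(real^'d) \<times> 'z. F1 W b (snd v)) \<in> borel_measurable borel"
  by (rule measurable_compose[OF measurable_snd_borel F1_meas])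

lemma measurable_F2_snd[measurable]: "(\<lambda>v::(real^'d) \<times> 'z. F2 W b b' (snd v)) \<in> borel_measurable borel"
  by (rule measurable_compose[OF measurable_snd_borel F2_meas])

lemma measurable_sq_resid[measurable]:
  "sq_resid W \<in> borel_measurable borel"
  "sq_resid1 b W \<in> borel_measurable borel"
  "sq_resid2 b b' W \<in> borel_measurable borel"
  unfolding sq_resid_def[abs_def] sq_resid1_def[abs_def] sq_resid2_def[abs_def] by measurable

end

locale regression_data = smooth_family F F1 F2 + prob_space M
  for F :: "'w::euclidean_space \<Rightarrow> 'z::euclidean_space \<Rightarrow> real^'d" and F1 F2 and M :: "'a measure" +
  fixes Y :: "nat \<Rightarrow> 'a \<Rightarrow> real^'d" and Z :: "nat \<Rightarrow> 'a \<Rightarrow> 'z"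
  assumes YZ_indep: "indep_vars (\<lambda>_. borel) (\<lambda>t \<omega>. (Y t \<omega>, Z t \<omega>)) UNIV"
    and YZ_ident: "\<And>t. distr M borel (\<lambda>\<omega>. (Y t \<omega>, Z t \<omega>)) = distr M borel (\<lambda>\<omega>. (Y 0 \<omega>, Z 0 \<omega>))"
begin

sublocale YZ: iid_sequence M borel "\<lambda>t \<omega>. (Y t \<omega>, Z t \<omega>)"
  by unfold_locales (rule YZ_indep YZ_ident)+

definition \<Gamma> :: "nat \<Rightarrow> 'a \<Rightarrow> 'w \<Rightarrow> real^'d^'d" where
  "\<Gamma> n \<omega> W = YZ.average (sq_resid W) n \<omega>"

definition \<Gamma>1 :: "nat \<Rightarrow> 'a \<Rightarrow> 'w \<Rightarrow> 'w \<Rightarrow> real^'d^'d" where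
  "\<Gamma>1 n \<omega> b W = YZ.average (sq_resid1 b W) n \<omega>"

definition \<Gamma>2 :: "nat \<Rightarrow> 'a \<Rightarrow> 'w \<Rightarrow> 'w \<Rightarrow> 'w \<Rightarrow> real^'d^'d" where
  "\<Gamma>2 n \<omega> b b' W = YZ.average (sq_resid2 b b' W) n \<omega>"

definition U :: "nat \<Rightarrow> 'a \<Rightarrow> 'w \<Rightarrow> real" where
  "U n \<omega> W = ln (det (\<Gamma> n \<omega> W))"

definition U1 :: "nat \<Rightarrow> 'a \<Rightarrow> 'w \<Rightarrow> 'w \<Rightarrow> real" where
  "U1 n \<omega> b W = trace (matrix_inv (\<Gamma> n \<omega> W) ** \<Gamma>1 n \<omega> b W)"

definition U2 :: "nat \<Rightarrow> 'a \<Rightarrow> 'w \<Rightarrow> 'w \<Rightarrow> 'w \<Rightarrow> real" where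
  "U2 n \<omega> b b' W = trace (matrix_inv (\<Gamma> n \<omega> W) ** \<Gamma>2 n \<omega> b b' W)
     - trace (matrix_inv (\<Gamma> n \<omega> W) ** \<Gamma>1 n \<omega> b' W ** matrix_inv (\<Gamma> n \<omega> W) ** \<Gamma>1 n \<omega> b W)"

lemma \<Gamma>_deriv: "(\<Gamma> n \<omega> has_derivative (\<lambda>b. \<Gamma>1 n \<omega> b W)) (at W)"
  unfolding \<Gamma>_def[abs_def] \<Gamma>1_def YZ.average_def
  by (intro has_derivative_scaleR_right has_derivative_sum sq_resid_deriv)

lemma \<Gamma>1_deriv: "(\<Gamma>1 n \<omega> b has_derivative (\<lambda>b'. \<Gamma>2 n \<omega> b b' W)) (at W)"
  unfolding \<Gamma>1_def[abs_def] \<Gamma>2_def YZ.average_def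
  by (intro has_derivative_scaleR_right has_derivative_sum sq_resid1_deriv)

lemma det_\<Gamma>_continuous: "continuous_on S (\<lambda>W. det (\<Gamma> n \<omega> W))"
proof -
  have "continuous_on S (\<Gamma> n \<omega>)"
    by (intro continuous_at_imp_continuous_on ballI has_derivative_continuous[OF \<Gamma>_deriv])
  then show ?thesis by (intro continuous_on_compose2[OF continuous_on_det]) auto
qed

lemma open_det_\<Gamma>_pos: "open {W. det (\<Gamma> n \<omega> W) > 0}"
  using det_\<Gamma>_continuous[of UNIV n \<omega>] by (intro open_Collect_less continuous_on_const)

lemma \<Gamma>_psd: "0 \<le> x \<bullet> (\<Gamma> n \<omega> W *v x)"
proof -
  have lin: "linear (\<lambda>A::real^'d^'d. A *v x)"
    by (rule bounded_linear.linear[OF bounded_linear_matrix_vector_left])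
  have "\<Gamma> n \<omega> W *v x = (1 / real n) *\<^sub>R (\<Sum>t<n. (resid W (Y t \<omega>, Z t \<omega>) \<bullet> x) *\<^sub>R resid W (Y t \<omega>, Z t \<omega>))"
    unfolding \<Gamma>_def YZ.average_def linear_scale[OF lin] linear_sum[OF lin]
    by (simp only: sq_resid_def outer_mult_vector)
  then show ?thesis by (simp add: inner_sum_right inner_commute sum_nonneg)
qed

lemma det_\<Gamma>_nonneg: "det (\<Gamma> n \<omega> W) \<ge> 0"
  by (intro psd_det_nonneg \<Gamma>_psd)

lemma U_deriv:
  assumes "det (\<Gamma> n \<omega> W) > 0"
  shows "(U n \<omega> has_derivative (\<lambda>b. U1 n \<omega> b W)) (at W)"
  unfolding U_def[abs_def] U1_def
  by (rule has_derivative_compose[OF \<Gamma>_deriv has_derivative_ln_det[OF assms]])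

lemma U1_deriv:
  assumes "det (\<Gamma> n \<omega> W) > 0"
  shows "(U1 n \<omega> b has_derivative (\<lambda>b'. U2 n \<omega> b b' W)) (at W)"
proof -
  have inv: "((\<lambda>W. matrix_inv (\<Gamma> n \<omega> W)) has_derivative
      (\<lambda>b'. - (matrix_inv (\<Gamma> n \<omega> W) ** \<Gamma>1 n \<omega> b' W ** matrix_inv (\<Gamma> n \<omega> W)))) (at W)"
    by (rule has_derivative_compose[OF \<Gamma>_deriv has_derivative_matrix_inv]) (use assms in simp)
  have "((\<lambda>W. matrix_inv (\<Gamma> n \<omega> W) ** \<Gamma>1 n \<omega> b W) has_derivative
      (\<lambda>b'. matrix_inv (\<Gamma> n \<omega> W) ** \<Gamma>2 n \<omega> b b' W
        + - (matrix_inv (\<Gamma> n \<omega> W) ** \<Gamma>1 n \<omega> b' W ** matrix_inv (\<Gamma> n \<omega> W)) ** \<Gamma>1 n \<omega> b W)) (at W)"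
    by (rule matmul.FDERIV[OF inv \<Gamma>1_deriv])
  from bounded_linear.has_derivative[OF bounded_linear_trace this]
  have "(U1 n \<omega> b has_derivative (\<lambda>b'. trace (matrix_inv (\<Gamma> n \<omega> W) ** \<Gamma>2 n \<omega> b b' W
        + - (matrix_inv (\<Gamma> n \<omega> W) ** \<Gamma>1 n \<omega> b' W ** matrix_inv (\<Gamma> n \<omega> W)) ** \<Gamma>1 n \<omega> b W))) (at W)"
    by (simp add: U1_def[abs_def])
  then show ?thesis
    unfolding U2_def[abs_def]
    by (simp add: linear_add[OF linear_trace] linear_neg[OF linear_trace] linear_diff[OF linear_trace] matmul.minus_left)
qed

lemma frechet_U:
  assumes "det (\<Gamma> n \<omega> W) > 0"
  shows "frechet_derivative (U n \<omega>) (at W) = (\<lambda>b. U1 n \<omega> b W)"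
  using frechet_derivative_at[OF U_deriv[OF assms]] by simp

lemma gradient_U:
  assumes "det (\<Gamma> n \<omega> W) > 0"
  shows "gradient (U n \<omega>) W = (\<Sum>b\<in>Basis. U1 n \<omega> b W *\<^sub>R b)"
  by (simp add: gradient_def frechet_U[OF assms])

text \<open>The outer derivative acts on \<open>frechet_derivative\<close>, whose closed form holds
  only where the determinant is positive. This region is open, so the formula may be substituted
  near \<open>W\<close>.\<close>

lemma hessian_U:
  assumes "det (\<Gamma> n \<omega> W) > 0"
  shows "hessian (U n \<omega>) W b b' = U2 n \<omega> b b' W"
proof -
  have "((\<lambda>y. frechet_derivative (U n \<omega>) (at y) b) has_derivative (\<lambda>b'. U2 n \<omega> b b' W)) (at W)"
    by (rule has_derivative_transform_within_open[OF U1_deriv[OF assms] open_det_\<Gamma>_pos])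
       (use assms frechet_U in auto)
  from frechet_derivative_at[OF this] show ?thesis by (simp add: hessian_def fun_eq_iff)
qed

end

section \<open>The regression model, its domination bounds and its limiting moments\<close>

lemma (in prob_space) trace_expectation:
  fixes X :: "'a \<Rightarrow> real^'d^'d"
  assumes "integrable M X"
  shows "trace (P ** expectation X) = expectation (\<lambda>\<omega>. trace (P ** X \<omega>))"
    and "integrable M (\<lambda>\<omega>. trace (P ** X \<omega>))"
proof -
  have "bounded_linear (\<lambda>X::real^'d^'d. trace (P ** X))"
    by (intro bounded_linear_compose[OF bounded_linear_trace] matmul.bounded_linear_right)
  from integral_bounded_linear[OF this assms] integrable_bounded_linear[OF this assms]
  show "trace (P ** expectation X) = expectation (\<lambda>\<omega>. trace (P ** X \<omega>))"
    and "integrable M (\<lambda>\<omega>. trace (P ** X \<omega>))" by simp_all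
qed

lemma (in prob_space) expectation_mult_vector:
  fixes X :: "'a \<Rightarrow> real^'d^'d"
  assumes "integrable M X"
  shows "expectation X *v x = expectation (\<lambda>\<omega>. X \<omega> *v x)" and "integrable M (\<lambda>\<omega>. X \<omega> *v x)"
  using integral_bounded_linear[OF bounded_linear_matrix_vector_left assms]
    integrable_bounded_linear[OF bounded_linear_matrix_vector_left assms] by simp_all

lemma (in prob_space) psd_expectation_outer:
  fixes f :: "'a \<Rightarrow> real^'d"
  assumes "integrable M (\<lambda>\<omega>. outer (f \<omega>) (f \<omega>))"
  shows "x \<bullet> (expectation (\<lambda>\<omega>. outer (f \<omega>) (f \<omega>)) *v x) = expectation (\<lambda>\<omega>. (f \<omega> \<bullet> x)\<^sup>2)"
    and "integrable M (\<lambda>\<omega>. (f \<omega> \<bullet> x)\<^sup>2)"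
proof -
  have i: "integrable M (\<lambda>\<omega>. (f \<omega> \<bullet> x) *\<^sub>R f \<omega>)"
    using expectation_mult_vector(2)[OF assms, of x] by (simp add: outer_mult_vector)
  show "x \<bullet> (expectation (\<lambda>\<omega>. outer (f \<omega>) (f \<omega>)) *v x) = expectation (\<lambda>\<omega>. (f \<omega> \<bullet> x)\<^sup>2)"
    using integral_inner_right[OF i, of x]
    by (simp add: expectation_mult_vector[OF assms] outer_mult_vector inner_commute power2_eq_square)
  show "integrable M (\<lambda>\<omega>. (f \<omega> \<bullet> x)\<^sup>2)"
    using integrable_inner_right[OF i, of x] by (simp add: inner_commute power2_eq_square)
qed

text \<open>The weight \<open>\<kappa>\<close> bounds the growth of the derivatives in the input; for the perceptron \<open>\<kappa> z = 1 + norm z\<close>.\<close>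
locale regression_model = regression_data F F1 F2 M Y Z
  for F :: "'w::euclidean_space \<Rightarrow> 'z::euclidean_space \<Rightarrow> real^'d" and F1 F2 and M :: "'a measure"
    and Y :: "nat \<Rightarrow> 'a \<Rightarrow> real^'d" and Z :: "nat \<Rightarrow> 'a \<Rightarrow> 'z" +
  fixes \<Theta> :: "'w set" and W0 :: 'w and \<kappa> :: "'z \<Rightarrow> real"
  assumes noise_sq: "integrable M (\<lambda>\<omega>. (norm (resid W0 (Y 0 \<omega>, Z 0 \<omega>)))\<^sup>2)"
    and noise_mean: "expectation (\<lambda>\<omega>. resid W0 (Y 0 \<omega>, Z 0 \<omega>)) = 0"
    and noise_indep: "distr M borel (\<lambda>\<omega>. (resid W0 (Y 0 \<omega>, Z 0 \<omega>), Z 0 \<omega>))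
        = distr M borel (\<lambda>\<omega>. resid W0 (Y 0 \<omega>, Z 0 \<omega>)) \<Otimes>\<^sub>M distr M borel (Z 0)"
    and noise_cov: "invertible (expectation (\<lambda>\<omega>. sq_resid W0 (Y 0 \<omega>, Z 0 \<omega>)))"
    and \<Theta>_compact: "compact \<Theta>" and W0_interior: "W0 \<in> interior \<Theta>"
    and identifiable: "\<And>W. W \<in> \<Theta> \<Longrightarrow> AE \<omega> in M. F W (Z 0 \<omega>) = F W0 (Z 0 \<omega>) \<Longrightarrow> W = W0"
    and \<kappa>_meas[measurable]: "\<kappa> \<in> borel_measurable borel" and \<kappa>_ge_1: "\<And>z. 1 \<le> \<kappa> z"
    and \<kappa>_sq: "integrable M (\<lambda>\<omega>. (\<kappa> (Z 0 \<omega>))\<^sup>2)"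
    and F_bound: "\<exists>C. \<forall>W\<in>\<Theta>. \<forall>z. norm (F W z) \<le> C"
    and F1_bound: "\<And>b. \<exists>C. \<forall>W\<in>\<Theta>. \<forall>z. norm (F1 W b z) \<le> C * \<kappa> z"
    and F2_bound: "\<And>b b'. \<exists>C. \<forall>W\<in>\<Theta>. \<forall>z. norm (F2 W b b' z) \<le> C * (\<kappa> z)\<^sup>2"
begin

abbreviation "V0 \<omega> \<equiv> (Y 0 \<omega>, Z 0 \<omega>)"

definition \<epsilon>0 :: "'a \<Rightarrow> real^'d" where "\<epsilon>0 \<omega> = resid W0 (V0 \<omega>)"

definition \<Gamma>0 :: "real^'d^'d" where "\<Gamma>0 = expectation (\<lambda>\<omega>. sq_resid W0 (V0 \<omega>))"

definition J :: "'w \<Rightarrow> 'w \<Rightarrow> real^'d^'d" where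
  "J b b' = expectation (\<lambda>\<omega>. outer (F1 W0 b (Z 0 \<omega>)) (F1 W0 b' (Z 0 \<omega>)))"

definition I0 :: "'w \<Rightarrow> 'w \<Rightarrow> real" where
  "I0 b b' = trace (matrix_inv \<Gamma>0 ** J b b')"

lemma W0_in: "W0 \<in> \<Theta>"
  using W0_interior interior_subset by blast

lemma V0_measurable[measurable]: "V0 \<in> borel_measurable M"
  using YZ.V_measurable[of 0] by simp

lemma Z_measurable[measurable]: "Z 0 \<in> borel_measurable M"
  using measurable_compose[OF V0_measurable measurable_snd_borel] by simp

lemma \<epsilon>0_measurable[measurable]: "\<epsilon>0 \<in> borel_measurable M"
  unfolding \<epsilon>0_def[abs_def] by (rule measurable_compose[OF V0_measurable measurable_resid])

lemma \<epsilon>0_integrable: "integrable M \<epsilon>0"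
proof -
  have "integrable M (\<lambda>\<omega>. norm (\<epsilon>0 \<omega>))"
    by (rule square_integrable_imp_integrable) (use noise_sq in \<open>simp_all add: \<epsilon>0_def[symmetric]\<close>)
  then show ?thesis by (simp add: integrable_norm_iff)
qed

text \<open>Independence is given as a product form of the joint law; pushing it forward under
  \<open>f\<close> and \<open>g\<close> reduces it to the product rule for two scalar variables.
  Integrability of each factor alone suffices, which is what keeps the moment requirements
  low.\<close>

lemma indep_noise_input:
  fixes f :: "real^'d \<Rightarrow> real" and g :: "'z \<Rightarrow> real"
  assumes "f \<in> borel_measurable borel" "g \<in> borel_measurable borel"
    and "integrable M (\<lambda>\<omega>. f (\<epsilon>0 \<omega>))" "integrable M (\<lambda>\<omega>. g (Z 0 \<omega>))"
  shows "integrable M (\<lambda>\<omega>. f (\<epsilon>0 \<omega>) * g (Z 0 \<omega>))"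
    and "expectation (\<lambda>\<omega>. f (\<epsilon>0 \<omega>) * g (Z 0 \<omega>)) = expectation (\<lambda>\<omega>. f (\<epsilon>0 \<omega>)) * expectation (\<lambda>\<omega>. g (Z 0 \<omega>))"
proof -
  note [measurable] = assms(1,2)
  have sf: "sigma_finite_measure (distr (distr M borel (Z 0)) borel g)"
    by (intro prob_space_imp_sigma_finite prob_space.prob_space_distr prob_space_distr) auto
  have "distr M borel (\<lambda>\<omega>. f (\<epsilon>0 \<omega>)) \<Otimes>\<^sub>M distr M borel (\<lambda>\<omega>. g (Z 0 \<omega>))
      = distr (distr M borel \<epsilon>0) borel f \<Otimes>\<^sub>M distr (distr M borel (Z 0)) borel g"
    by (simp add: distr_distr o_def)
  also have "\<dots> = distr (distr M borel \<epsilon>0 \<Otimes>\<^sub>M distr M borel (Z 0)) (borel \<Otimes>\<^sub>M borel) (\<lambda>(x, y). (f x, g y))"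
    by (rule pair_measure_distr[OF _ _ sf]) auto
  also have "\<dots> = distr (distr M borel (\<lambda>\<omega>. (\<epsilon>0 \<omega>, Z 0 \<omega>))) (borel \<Otimes>\<^sub>M borel) (\<lambda>(x, y). (f x, g y))"
    using noise_indep by (simp add: \<epsilon>0_def[abs_def])
  also have "\<dots> = distr M (borel \<Otimes>\<^sub>M borel) (\<lambda>\<omega>. (f (\<epsilon>0 \<omega>), g (Z 0 \<omega>)))"
  proof (subst distr_distr)
    have "(\<lambda>(x, y). (f x, g y)) \<in> measurable (borel \<Otimes>\<^sub>M borel) (borel \<Otimes>\<^sub>M borel)" by measurable
    then show "(\<lambda>(x, y). (f x, g y)) \<in> measurable borel (borel \<Otimes>\<^sub>M borel)" by (simp add: borel_prod)
  qed (auto simp: o_def)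
  finally have ind: "indep_var borel (\<lambda>\<omega>. f (\<epsilon>0 \<omega>)) borel (\<lambda>\<omega>. g (Z 0 \<omega>))"
    by (subst indep_var_distribution_eq) simp
  show "integrable M (\<lambda>\<omega>. f (\<epsilon>0 \<omega>) * g (Z 0 \<omega>))"
    by (rule indep_var_integrable[OF ind assms(3,4)])
  show "expectation (\<lambda>\<omega>. f (\<epsilon>0 \<omega>) * g (Z 0 \<omega>)) = expectation (\<lambda>\<omega>. f (\<epsilon>0 \<omega>)) * expectation (\<lambda>\<omega>. g (Z 0 \<omega>))"
    by (rule indep_var_lebesgue_integral[OF ind assms(3,4)])
qed

lemma outer_bound: obtains K where "K > 0" "\<And>(x::real^'d) y. norm (outer x y) \<le> K * (norm x * norm y)"
proof -
  obtain K where "K > 0" "\<And>(x::real^'d) y. norm (outer x y) \<le> norm x * norm y * K"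
    using outer.pos_bounded by blast
  then show ?thesis using that[of K] by (simp add: mult.commute)
qed

text \<open>Entrywise these are products of a function of the input with a centred noise coordinate.
  The lemma removes every term linear in the noise: in the mean of the first derivative, in the mean
  of the second and in the expansion of the limiting matrix.\<close>

lemma expectation_outer_input_noise:
  fixes f :: "'z \<Rightarrow> real^'d"
  assumes [measurable]: "f \<in> borel_measurable borel" and f: "integrable M (\<lambda>\<omega>. f (Z 0 \<omega>))"
  shows "integrable M (\<lambda>\<omega>. outer (f (Z 0 \<omega>)) (\<epsilon>0 \<omega>))" "integrable M (\<lambda>\<omega>. outer (\<epsilon>0 \<omega>) (f (Z 0 \<omega>)))"
    and "expectation (\<lambda>\<omega>. outer (f (Z 0 \<omega>)) (\<epsilon>0 \<omega>)) = 0" "expectation (\<lambda>\<omega>. outer (\<epsilon>0 \<omega>) (f (Z 0 \<omega>))) = 0"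
proof -
  obtain K where K: "K > 0" "\<And>(x::real^'d) y. norm (outer x y) \<le> K * (norm x * norm y)" by (rule outer_bound) blast
  have "integrable M (\<lambda>\<omega>. norm (\<epsilon>0 \<omega>) * norm (f (Z 0 \<omega>)))"
    by (rule indep_noise_input) (use f \<epsilon>0_integrable in auto)
  then have iK: "integrable M (\<lambda>\<omega>. K * (norm (\<epsilon>0 \<omega>) * norm (f (Z 0 \<omega>))))" by simp
  show 1: "integrable M (\<lambda>\<omega>. outer (f (Z 0 \<omega>)) (\<epsilon>0 \<omega>))"
    by (rule Bochner_Integration.integrable_bound[OF iK])
       (use K in \<open>auto intro!: AE_I2 order_trans[OF K(2)] simp: mult.commute\<close>)
  show 2: "integrable M (\<lambda>\<omega>. outer (\<epsilon>0 \<omega>) (f (Z 0 \<omega>)))"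
    by (rule Bochner_Integration.integrable_bound[OF iK])
       (use K in \<open>auto intro!: AE_I2 order_trans[OF K(2)]\<close>)
  have comp: "expectation X $ i $ j = expectation (\<lambda>\<omega>. X \<omega> $ i $ j)" if "integrable M X" for X :: "'a \<Rightarrow> real^'d^'d" and i j
    using integral_bounded_linear[OF bounded_linear_compose[OF bounded_linear_vec_nth[of j] bounded_linear_vec_nth[of i]] that]
    by simp
  have nth: "(\<lambda>x::real^'d. x $ i) \<in> borel_measurable borel" for i
    by (rule borel_measurable_continuous_onI[OF linear_continuous_on[OF bounded_linear_vec_nth]])
  have zero: "expectation (\<lambda>\<omega>. \<epsilon>0 \<omega> $ j * f (Z 0 \<omega>) $ i) = 0" for i j
  proof -
    have "expectation (\<lambda>\<omega>. \<epsilon>0 \<omega> $ j) = expectation \<epsilon>0 $ j"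
      using integral_bounded_linear[OF bounded_linear_vec_nth \<epsilon>0_integrable] by simp
    also have "\<dots> = 0" using noise_mean by (simp add: \<epsilon>0_def[abs_def])
    finally have e: "expectation (\<lambda>\<omega>. \<epsilon>0 \<omega> $ j) = 0" .
    have "expectation (\<lambda>\<omega>. \<epsilon>0 \<omega> $ j * f (Z 0 \<omega>) $ i) = expectation (\<lambda>\<omega>. \<epsilon>0 \<omega> $ j) * expectation (\<lambda>\<omega>. f (Z 0 \<omega>) $ i)"
      by (rule indep_noise_input(2)[where f="\<lambda>x. x $ j" and g="\<lambda>z. f z $ i"])
         (use integrable_bounded_linear[OF bounded_linear_vec_nth \<epsilon>0_integrable] integrable_bounded_linear[OF bounded_linear_vec_nth f]
            nth measurable_compose[OF assms(1) nth] in auto)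
    then show ?thesis using e by simp
  qed
  show "expectation (\<lambda>\<omega>. outer (f (Z 0 \<omega>)) (\<epsilon>0 \<omega>)) = 0" "expectation (\<lambda>\<omega>. outer (\<epsilon>0 \<omega>) (f (Z 0 \<omega>))) = 0"
    using zero by (simp_all add: vec_eq_iff comp[OF 1] comp[OF 2]) (simp_all add: outer_def mult.commute)
qed

text \<open>Normalised to be at least \<open>1\<close>, so that \<open>norm y + F_sup\<close> is at
  least \<open>1\<close> and lower order factors can be absorbed into higher order ones.\<close>

definition F_sup :: real where "F_sup = (SOME c. 1 \<le> c \<and> (\<forall>W\<in>\<Theta>. \<forall>z. norm (F W z) \<le> c))"

lemma F_sup: "1 \<le> F_sup" "W \<in> \<Theta> \<Longrightarrow> norm (F W z) \<le> F_sup"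
proof -
  obtain C where C: "\<forall>W\<in>\<Theta>. \<forall>z. norm (F W z) \<le> C" using F_bound by blast
  have "\<exists>c. 1 \<le> c \<and> (\<forall>W\<in>\<Theta>. \<forall>z. norm (F W z) \<le> c)"
    using C by (intro exI[of _ "max 1 C"]) (auto simp: le_max_iff_disj)
  from someI_ex[OF this] show "1 \<le> F_sup" "W \<in> \<Theta> \<Longrightarrow> norm (F W z) \<le> F_sup" by (auto simp: F_sup_def)
qed

text \<open>With \<open>r = norm y + F_sup\<close>, the first summand dominates the squared
  residual. The second, \<open>r\<close> times the square of \<open>\<kappa> z\<close>, dominates
  first derivative times residual, a product of two first derivatives, and second derivative times
  residual, because \<open>r\<close> and \<open>\<kappa> z\<close> are at least
  \<open>1\<close>.\<close>

definition envelope :: "(real^'d) \<times> 'z \<Rightarrow> real" where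
  "envelope v = (norm (fst v) + F_sup)\<^sup>2 + (norm (fst v) + F_sup) * (\<kappa> (snd v))\<^sup>2"

lemma measurable_envelope[measurable]: "envelope \<in> borel_measurable borel"
proof -
  have [measurable]: "(fst :: (real^'d) \<times> 'z \<Rightarrow> real^'d) \<in> borel_measurable borel"
    by (rule borel_measurable_continuous_onI[OF continuous_on_fst[OF continuous_on_id]])
  have [measurable]: "(\<lambda>v::(real^'d) \<times> 'z. \<kappa> (snd v)) \<in> borel_measurable borel"
    by (rule measurable_compose[OF measurable_snd_borel \<kappa>_meas])
  show ?thesis unfolding envelope_def[abs_def] by measurable
qed

text \<open>Replacing \<open>Y\<close> by noise plus a bounded term leaves one delicate product, the
  norm of the noise times the square of \<open>\<kappa> (Z 0 \<omega>)\<close>. Its factors are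
  independent and each is integrable.\<close>

lemma integrable_envelope: "integrable M (\<lambda>\<omega>. envelope (V0 \<omega>))"
proof -
  let ?B = "\<lambda>\<omega>. (2 * (norm (\<epsilon>0 \<omega>))\<^sup>2 + 8 * F_sup\<^sup>2) + (norm (\<epsilon>0 \<omega>) * (\<kappa> (Z 0 \<omega>))\<^sup>2 + 2 * F_sup * (\<kappa> (Z 0 \<omega>))\<^sup>2)"
  have B: "integrable M ?B"
    using noise_sq[folded \<epsilon>0_def] \<kappa>_sq integrable_norm[OF \<epsilon>0_integrable]
    by (intro Bochner_Integration.integrable_add integrable_mult_right indep_noise_input(1)) auto
  show ?thesis
  proof (rule Bochner_Integration.integrable_bound[OF B])
    show "AE \<omega> in M. norm (envelope (V0 \<omega>)) \<le> norm (?B \<omega>)"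
    proof (rule AE_I2)
      fix \<omega>
      have "norm (Y 0 \<omega>) \<le> norm (\<epsilon>0 \<omega>) + norm (F W0 (Z 0 \<omega>))"
        using norm_triangle_ineq[of "\<epsilon>0 \<omega>" "F W0 (Z 0 \<omega>)"] by (simp add: \<epsilon>0_def resid_def)
      then have y: "norm (Y 0 \<omega>) + F_sup \<le> norm (\<epsilon>0 \<omega>) + 2 * F_sup"
        using F_sup(2)[OF W0_in, of "Z 0 \<omega>"] by linarith
      have nn: "0 \<le> norm (Y 0 \<omega>) + F_sup" using F_sup(1) by (smt (verit) norm_ge_zero)
      have "(norm (Y 0 \<omega>) + F_sup)\<^sup>2 \<le> (norm (\<epsilon>0 \<omega>) + 2 * F_sup)\<^sup>2"
        by (intro power_mono y nn)
      also have "\<dots> \<le> 2 * (norm (\<epsilon>0 \<omega>))\<^sup>2 + 8 * F_sup\<^sup>2"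
        using zero_le_power2[of "norm (\<epsilon>0 \<omega>) - 2 * F_sup"] by (simp add: power2_sum power2_diff power_mult_distrib)
      finally have 1: "(norm (Y 0 \<omega>) + F_sup)\<^sup>2 \<le> 2 * (norm (\<epsilon>0 \<omega>))\<^sup>2 + 8 * F_sup\<^sup>2" .
      have 2: "(norm (Y 0 \<omega>) + F_sup) * (\<kappa> (Z 0 \<omega>))\<^sup>2 \<le> norm (\<epsilon>0 \<omega>) * (\<kappa> (Z 0 \<omega>))\<^sup>2 + 2 * F_sup * (\<kappa> (Z 0 \<omega>))\<^sup>2"
        using mult_right_mono[OF y, of "(\<kappa> (Z 0 \<omega>))\<^sup>2"] by (simp add: distrib_right)
      have "0 \<le> envelope (V0 \<omega>)" using nn by (simp add: envelope_def)
      moreover have "envelope (V0 \<omega>) \<le> ?B \<omega>" using 1 2 by (simp add: envelope_def)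
      ultimately show "norm (envelope (V0 \<omega>)) \<le> norm (?B \<omega>)" by simp
    qed
  qed measurable
qed

lemma norm_resid_le: "W \<in> \<Theta> \<Longrightarrow> norm (resid W v) \<le> norm (fst v) + F_sup"
  unfolding resid_def using norm_triangle_ineq4[of "fst v" "F W (snd v)"] F_sup(2)[of W "snd v"] by linarith

lemma sq_resid_envelope:
  shows "\<exists>C. \<forall>W\<in>\<Theta>. \<forall>v. norm (sq_resid W v) \<le> C * envelope v"
    and "\<exists>C. \<forall>W\<in>\<Theta>. \<forall>v. norm (sq_resid1 b W v) \<le> C * envelope v"
    and "\<exists>C. \<forall>W\<in>\<Theta>. \<forall>v. norm (sq_resid2 b b' W v) \<le> C * envelope v"
proof -
  obtain K where K: "K > 0" "\<And>(x::real^'d) y. norm (outer x y) \<le> K * (norm x * norm y)" by (rule outer_bound) blast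
  have C1: "\<exists>C\<ge>0. \<forall>W\<in>\<Theta>. \<forall>z. norm (F1 W b z) \<le> C * \<kappa> z" for b
  proof -
    obtain C where C: "\<forall>W\<in>\<Theta>. \<forall>z. norm (F1 W b z) \<le> C * \<kappa> z" using F1_bound by blast
    have "C * \<kappa> z \<le> \<bar>C\<bar> * \<kappa> z" for z using \<kappa>_ge_1[of z] by (intro mult_right_mono) auto
    then show ?thesis using C by (intro exI[of _ "\<bar>C\<bar>"]) (auto intro: order_trans)
  qed
  obtain C where C: "C \<ge> 0" "\<And>W z. W \<in> \<Theta> \<Longrightarrow> norm (F1 W b z) \<le> C * \<kappa> z" using C1[of b] by blast
  obtain C' where C': "C' \<ge> 0" "\<And>W z. W \<in> \<Theta> \<Longrightarrow> norm (F1 W b' z) \<le> C' * \<kappa> z" using C1[of b'] by blast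
  obtain D0 where D0: "\<forall>W\<in>\<Theta>. \<forall>z. norm (F2 W b b' z) \<le> D0 * (\<kappa> z)\<^sup>2" using F2_bound by blast
  define D where "D = \<bar>D0\<bar>"
  have D: "D \<ge> 0" "\<And>W z. W \<in> \<Theta> \<Longrightarrow> norm (F2 W b b' z) \<le> D * (\<kappa> z)\<^sup>2"
  proof -
    fix W z assume "W \<in> \<Theta>"
    then have "norm (F2 W b b' z) \<le> D0 * (\<kappa> z)\<^sup>2" using D0 by blast
    also have "\<dots> \<le> D * (\<kappa> z)\<^sup>2" unfolding D_def by (intro mult_right_mono) auto
    finally show "norm (F2 W b b' z) \<le> D * (\<kappa> z)\<^sup>2" .
  qed (simp add: D_def)
  have u1: "1 \<le> norm (fst v) + F_sup" for v :: "(real^'d) \<times> 'z" using F_sup(1) by (smt (verit) norm_ge_zero)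
  have k2: "\<kappa> z \<le> (\<kappa> z)\<^sup>2" for z using \<kappa>_ge_1[of z] by (simp add: power2_eq_square)
  have e1: "(norm (fst v) + F_sup)\<^sup>2 \<le> envelope v" for v
    using u1[of v] by (simp add: envelope_def)
  have e2: "(\<kappa> (snd v))\<^sup>2 * (norm (fst v) + F_sup) \<le> envelope v" for v
    by (simp add: envelope_def mult.commute)
  have e3: "(\<kappa> (snd v))\<^sup>2 \<le> envelope v" for v
    using mult_left_mono[OF u1[of v], of "(\<kappa> (snd v))\<^sup>2"] e2[of v] by simp
  have r: "norm (resid W v) \<le> norm (fst v) + F_sup" if "W \<in> \<Theta>" for W v using norm_resid_le[OF that] .
  have b0: "norm (resid W v) * norm (resid W v) \<le> envelope v" if "W \<in> \<Theta>" for W v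
    using mult_mono[OF r[OF that] r[OF that], of v v] u1[of v] e1[of v] by (simp add: power2_eq_square)
  have b1: "norm (F1 W b (snd v)) * norm (resid W v) \<le> C * envelope v" if W: "W \<in> \<Theta>" for W v
  proof -
    have "norm (F1 W b (snd v)) * norm (resid W v) \<le> (C * (\<kappa> (snd v))\<^sup>2) * (norm (fst v) + F_sup)"
      using C(1) k2[of "snd v"] by (intro mult_mono r W order_trans[OF C(2)[OF W]] mult_left_mono) auto
    also have "\<dots> \<le> C * envelope v" using mult_left_mono[OF e2[of v] C(1)] by (simp add: mult.assoc)
    finally show ?thesis .
  qed
  have b2: "norm (F1 W b (snd v)) * norm (F1 W b' (snd v)) \<le> C * C' * envelope v" if W: "W \<in> \<Theta>" for W v
  proof -
    have "norm (F1 W b (snd v)) * norm (F1 W b' (snd v)) \<le> (C * \<kappa> (snd v)) * (C' * \<kappa> (snd v))"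
      using C C' W \<kappa>_ge_1[of "snd v"] by (intro mult_mono) (auto intro!: mult_nonneg_nonneg)
    also have "\<dots> = C * C' * (\<kappa> (snd v))\<^sup>2" by (simp add: power2_eq_square)
    also have "\<dots> \<le> C * C' * envelope v" using C C' e3 by (intro mult_left_mono) auto
    finally show ?thesis .
  qed
  have b3: "norm (F2 W b b' (snd v)) * norm (resid W v) \<le> D * envelope v" if W: "W \<in> \<Theta>" for W v
  proof -
    have "norm (F2 W b b' (snd v)) * norm (resid W v) \<le> (D * (\<kappa> (snd v))\<^sup>2) * (norm (fst v) + F_sup)"
      using D(1) by (intro mult_mono r W D(2)) auto
    also have "\<dots> \<le> D * envelope v" using mult_left_mono[OF e2[of v] D(1)] by (simp add: mult.assoc)
    finally show ?thesis .
  qed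
  have outer_le: "norm (outer x y) \<le> K * B" if "norm x * norm y \<le> B" for x y :: "real^'d" and B
    using K(2)[of x y] mult_left_mono[OF that, of K] K(1) by linarith
  have outer_le': "norm (outer y x) \<le> K * B" if "norm x * norm y \<le> B" for x y :: "real^'d" and B
    using outer_le[of y x B] that by (simp add: mult.commute)
  show "\<exists>C. \<forall>W\<in>\<Theta>. \<forall>v. norm (sq_resid W v) \<le> C * envelope v"
    unfolding sq_resid_def using outer_le[OF b0] by blast
  have "norm (sq_resid1 b W v) \<le> (2 * K * C) * envelope v" if W: "W \<in> \<Theta>" for W v
    unfolding sq_resid1_def norm_minus_cancel
    using norm_triangle_ineq[of "outer (F1 W b (snd v)) (resid W v)" "outer (resid W v) (F1 W b (snd v))"]
      outer_le[OF b1[OF W, of v]] outer_le'[OF b1[OF W, of v]] by (simp add: algebra_simps)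
  then show "\<exists>C. \<forall>W\<in>\<Theta>. \<forall>v. norm (sq_resid1 b W v) \<le> C * envelope v" by blast
  have "norm (sq_resid2 b b' W v) \<le> (2 * K * (C * C') + 2 * K * D) * envelope v" if W: "W \<in> \<Theta>" for W v
  proof -
    have t: "norm (p + q - (r + s)) \<le> norm p + norm q + (norm r + norm s)" for p q r s :: "real^'d^'d"
      using norm_triangle_ineq4[of "p + q" "r + s"] norm_triangle_ineq[of p q] norm_triangle_ineq[of r s] by linarith
    show ?thesis unfolding sq_resid2_def
      by (rule order_trans[OF t])
         (use outer_le[OF b2[OF W, of v]] outer_le'[OF b2[OF W, of v]] outer_le[OF b3[OF W, of v]] outer_le'[OF b3[OF W, of v]]
          in \<open>simp add: algebra_simps\<close>)
  qed
  then show "\<exists>C. \<forall>W\<in>\<Theta>. \<forall>v. norm (sq_resid2 b b' W v) \<le> C * envelope v" by blast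
qed

lemma uniform_law_sq_resid:
  assumes a: "a \<in> {sq_resid, sq_resid1 b, sq_resid2 b b'}"
  shows "AE \<omega> in M. uniform_limit \<Theta> (\<lambda>n W. YZ.average (a W) n \<omega>) (\<lambda>W. expectation (\<lambda>\<omega>. a W (V0 \<omega>))) sequentially"
    and "continuous_on \<Theta> (\<lambda>W. expectation (\<lambda>\<omega>. a W (V0 \<omega>)))"
    and "\<And>W. W \<in> \<Theta> \<Longrightarrow> integrable M (\<lambda>\<omega>. a W (V0 \<omega>))"
proof -
  obtain C where C: "\<And>W v. W \<in> \<Theta> \<Longrightarrow> norm (a W v) \<le> C * envelope v"
  proof -
    have "\<exists>C. \<forall>W\<in>\<Theta>. \<forall>v. norm (a W v) \<le> C * envelope v"
      using sq_resid_envelope(1) sq_resid_envelope(2)[of b] sq_resid_envelope(3)[of b b'] a by auto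
    then show ?thesis using that by blast
  qed
  have m: "a W \<in> borel_measurable borel" for W using a measurable_sq_resid by auto
  have c: "continuous_on \<Theta> (\<lambda>W. a W v)" for v
    using a by (elim insertE emptyE) (simp_all only: sq_resid_continuous sq_resid1_continuous sq_resid2_continuous)
  have i: "integrable M (\<lambda>\<omega>. C * envelope (V0 \<omega>))" using integrable_envelope by simp
  have me: "(\<lambda>v. C * envelope v) \<in> borel_measurable borel" by measurable
  note law = YZ.uniform_strong_law_vector[where a=a and K="\<lambda>v. C * envelope v", OF \<Theta>_compact m c C me i]
  show "AE \<omega> in M. uniform_limit \<Theta> (\<lambda>n W. YZ.average (a W) n \<omega>) (\<lambda>W. expectation (\<lambda>\<omega>. a W (V0 \<omega>))) sequentially"
    by (rule law(1))
  show "continuous_on \<Theta> (\<lambda>W. expectation (\<lambda>\<omega>. a W (V0 \<omega>)))" by (rule law(2))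
  show "\<And>W. W \<in> \<Theta> \<Longrightarrow> integrable M (\<lambda>\<omega>. a W (V0 \<omega>))" by (rule law(3))
qed

lemma F1_integrable: "integrable M (\<lambda>\<omega>. F1 W0 b (Z 0 \<omega>))"
  and F2_integrable: "integrable M (\<lambda>\<omega>. F2 W0 b b' (Z 0 \<omega>))"
  and F1_sq_integrable: "integrable M (\<lambda>\<omega>. (norm (F1 W0 b (Z 0 \<omega>)))\<^sup>2)"
proof -
  obtain C where C: "\<And>z. norm (F1 W0 b z) \<le> C * \<kappa> z" using F1_bound[of b] W0_in by blast
  obtain D where D: "\<And>z. norm (F2 W0 b b' z) \<le> D * (\<kappa> z)\<^sup>2" using F2_bound[of b b'] W0_in by blast
  have i: "integrable M (\<lambda>\<omega>. r * (\<kappa> (Z 0 \<omega>))\<^sup>2)" for r using \<kappa>_sq by simp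
  have [measurable]: "(\<lambda>\<omega>. F1 W0 b (Z 0 \<omega>)) \<in> borel_measurable M" "(\<lambda>\<omega>. F2 W0 b b' (Z 0 \<omega>)) \<in> borel_measurable M"
    by (rule measurable_compose[OF Z_measurable F1_meas], rule measurable_compose[OF Z_measurable F2_meas])
  have sq: "(norm (F1 W0 b z))\<^sup>2 \<le> C\<^sup>2 * (\<kappa> z)\<^sup>2" for z
    using power_mono[OF C[of z], of 2] by (simp add: power_mult_distrib)
  show F1sq: "integrable M (\<lambda>\<omega>. (norm (F1 W0 b (Z 0 \<omega>)))\<^sup>2)"
    by (rule Bochner_Integration.integrable_bound[OF i[of "C\<^sup>2"]]) (use sq in \<open>auto intro!: AE_I2\<close>)
  have "integrable M (\<lambda>\<omega>. norm (F1 W0 b (Z 0 \<omega>)))"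
    by (rule square_integrable_imp_integrable) (use F1sq in auto)
  then show "integrable M (\<lambda>\<omega>. F1 W0 b (Z 0 \<omega>))" by (simp add: integrable_norm_iff)
  show "integrable M (\<lambda>\<omega>. F2 W0 b b' (Z 0 \<omega>))"
    by (rule Bochner_Integration.integrable_bound[OF i[of D]])
       (use D in \<open>auto intro!: AE_I2 intro: order_trans[OF _ abs_ge_self]\<close>)
qed

lemma F1_outer_integrable: "integrable M (\<lambda>\<omega>. outer (F1 W0 b (Z 0 \<omega>)) (F1 W0 b' (Z 0 \<omega>)))"
proof -
  obtain K where K: "K > 0" "\<And>(x::real^'d) y. norm (outer x y) \<le> K * (norm x * norm y)" by (rule outer_bound) blast
  have [measurable]: "(\<lambda>\<omega>. F1 W0 b (Z 0 \<omega>)) \<in> borel_measurable M" for b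
    by (rule measurable_compose[OF Z_measurable F1_meas])
  have i: "integrable M (\<lambda>\<omega>. K * ((norm (F1 W0 b (Z 0 \<omega>)))\<^sup>2 + (norm (F1 W0 b' (Z 0 \<omega>)))\<^sup>2))"
    using F1_sq_integrable by simp
  show ?thesis
  proof (rule Bochner_Integration.integrable_bound[OF i], goal_cases)
    case 2
    show ?case
    proof (rule AE_I2)
      fix \<omega>
      let ?x = "F1 W0 b (Z 0 \<omega>)" and ?y = "F1 W0 b' (Z 0 \<omega>)"
      have "a * b \<le> a\<^sup>2 + b\<^sup>2" if "a \<ge> 0" "b \<ge> 0" for a b :: real
      proof -
        have "2 * (a * b) \<le> a\<^sup>2 + b\<^sup>2" using sum_squares_bound[of a b] by (simp add: mult.assoc)
        moreover have "0 \<le> a * b" using that by simp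
        ultimately show ?thesis by linarith
      qed
      then have "norm ?x * norm ?y \<le> (norm ?x)\<^sup>2 + (norm ?y)\<^sup>2" by simp
      then have "norm (outer ?x ?y) \<le> K * ((norm ?x)\<^sup>2 + (norm ?y)\<^sup>2)"
        using K(1) by (intro order_trans[OF K(2)] mult_left_mono) auto
      then show "norm (outer ?x ?y) \<le> norm (K * ((norm ?x)\<^sup>2 + (norm ?y)\<^sup>2))" by simp
    qed
  qed measurable
qed

lemma sq_resid1_mean_zero: "expectation (\<lambda>\<omega>. sq_resid1 b W0 (V0 \<omega>)) = 0"
  using expectation_outer_input_noise[OF F1_meas F1_integrable]
  by (simp add: sq_resid1_def \<epsilon>0_def)

lemma sq_resid2_mean: "expectation (\<lambda>\<omega>. sq_resid2 b b' W0 (V0 \<omega>)) = J b b' + J b' b"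
  using expectation_outer_input_noise[OF F2_meas F2_integrable, of b b'] F1_outer_integrable
  by (simp add: sq_resid2_def J_def \<epsilon>0_def)

lemma sq_resid_integrable: "W \<in> \<Theta> \<Longrightarrow> integrable M (\<lambda>\<omega>. sq_resid W (V0 \<omega>))"
  by (rule uniform_law_sq_resid(3)) auto

lemma \<Gamma>0_eq: "\<Gamma>0 = expectation (\<lambda>\<omega>. outer (\<epsilon>0 \<omega>) (\<epsilon>0 \<omega>))"
  and \<epsilon>0_outer_integrable: "integrable M (\<lambda>\<omega>. outer (\<epsilon>0 \<omega>) (\<epsilon>0 \<omega>))"
  using sq_resid_integrable[OF W0_in] by (simp_all add: \<Gamma>0_def sq_resid_def \<epsilon>0_def)

lemma \<Gamma>0_form: "x \<bullet> (\<Gamma>0 *v y) = expectation (\<lambda>\<omega>. (\<epsilon>0 \<omega> \<bullet> x) * (\<epsilon>0 \<omega> \<bullet> y))"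
proof -
  have i: "integrable M (\<lambda>\<omega>. (\<epsilon>0 \<omega> \<bullet> y) *\<^sub>R \<epsilon>0 \<omega>)"
    using expectation_mult_vector(2)[OF \<epsilon>0_outer_integrable, of y] by (simp add: outer_mult_vector)
  show ?thesis
    using integral_inner_right[OF i, of x]
    by (simp add: \<Gamma>0_eq expectation_mult_vector[OF \<epsilon>0_outer_integrable] outer_mult_vector inner_commute mult.commute)
qed

text \<open>The quadratic form at \<open>x\<close> is the mean square of
  \<open>\<epsilon>0 \<bullet> x\<close>. If it vanishes, then
  \<open>\<epsilon>0 \<bullet> x\<close> is zero almost surely, hence \<open>\<Gamma>0 *v x\<close>
  is zero, against invertibility.\<close>

lemma \<Gamma>0_pos_def: "pos_def \<Gamma>0"
  unfolding pos_def_def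
proof (intro allI impI)
  fix x :: "real^'d" assume x: "x \<noteq> 0"
  note psd = psd_expectation_outer[OF \<epsilon>0_outer_integrable, of x, folded \<Gamma>0_eq]
  have "x \<bullet> (\<Gamma>0 *v x) \<noteq> 0"
  proof
    assume "x \<bullet> (\<Gamma>0 *v x) = 0"
    then have "AE \<omega> in M. (\<epsilon>0 \<omega> \<bullet> x)\<^sup>2 = 0"
      using integral_nonneg_eq_0_iff_AE[OF psd(2)] psd(1) by auto
    then have "AE \<omega> in M. (\<epsilon>0 \<omega> \<bullet> x) *\<^sub>R \<epsilon>0 \<omega> = 0" by eventually_elim simp
    then have "\<Gamma>0 *v x = expectation (\<lambda>_. 0)"
      unfolding \<Gamma>0_eq expectation_mult_vector(1)[OF \<epsilon>0_outer_integrable] outer_mult_vector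
      by (intro integral_cong_AE) auto
    then have "\<Gamma>0 *v x = 0" by simp
    then show False
      using noise_cov[folded \<Gamma>0_def] x unfolding invertible_left_inverse matrix_left_invertible_ker by blast
  qed
  moreover have "x \<bullet> (\<Gamma>0 *v x) \<ge> 0" unfolding psd(1) by simp
  ultimately show "0 < x \<bullet> (\<Gamma>0 *v x)" by simp
qed

lemma \<Gamma>0_det_pos: "det \<Gamma>0 > 0"
  by (rule pos_def_det_pos[OF \<Gamma>0_pos_def])

abbreviation "P0 \<equiv> matrix_inv \<Gamma>0"

lemma P0_symmetric: "x \<bullet> (P0 *v y) = y \<bullet> (P0 *v x)"
proof -
  have inv: "\<Gamma>0 *v (P0 *v x) = x" for x
    by (simp add: matrix_vector_mul_assoc matrix_inv_mult[OF pos_def_invertible[OF \<Gamma>0_pos_def]])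
  have "x \<bullet> (P0 *v y) = (P0 *v y) \<bullet> (\<Gamma>0 *v (P0 *v x))" by (simp add: inv inner_commute)
  also have "\<dots> = (P0 *v x) \<bullet> (\<Gamma>0 *v (P0 *v y))" unfolding \<Gamma>0_form by (simp add: mult.commute)
  also have "\<dots> = y \<bullet> (P0 *v x)" by (simp add: inv inner_commute)
  finally show ?thesis .
qed

text \<open>The trace against an outer product is a bilinear form, so \<open>I0\<close> is the mean
  of an inner product weighted by \<open>P0\<close> between derivatives of the regression function.
  Symmetry, bilinearity and nonnegativity are read off from this shape.\<close>

lemma I0_eq:
  "I0 b b' = expectation (\<lambda>\<omega>. F1 W0 b' (Z 0 \<omega>) \<bullet> (P0 *v F1 W0 b (Z 0 \<omega>)))"
  "integrable M (\<lambda>\<omega>. F1 W0 b' (Z 0 \<omega>) \<bullet> (P0 *v F1 W0 b (Z 0 \<omega>)))"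
  using trace_expectation[OF F1_outer_integrable, of P0 b b']
  by (simp_all add: I0_def J_def trace_mult_outer)

lemma I0_symmetric: "I0 b b' = I0 b' b"
  unfolding I0_eq by (subst P0_symmetric) simp

lemma trace_P0_J: "trace (P0 ** (J b b' + J b' b)) = 2 * I0 b b'"
  using I0_symmetric[of b' b] by (simp add: matmul.add_right linear_add[OF linear_trace] I0_def)

lemma I0_bilinear: "bilinear I0"
proof -
  have l1: "linear (\<lambda>b'. I0 b b')" for b
  proof (rule linearI)
    show "I0 b (x + y) = I0 b x + I0 b y" for x y
      using I0_eq[where b=b and b'=x] I0_eq[where b=b and b'=y]
      by (simp add: I0_eq(1)[of b "x + y"] linear_add[OF linear_F1] inner_add_left)
    show "I0 b (r *\<^sub>R x) = r *\<^sub>R I0 b x" for r x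
      by (simp add: I0_eq(1) linear_scale[OF linear_F1])
  qed
  moreover have "linear (\<lambda>b. I0 b b')" for b'
    using l1[of b'] by (subst I0_symmetric)
  ultimately show ?thesis by (simp add: bilinear_def)
qed

lemma mat_op_inner: "x \<bullet> mat_op I0 y = I0 x y"
proof -
  have "x \<bullet> mat_op I0 y = (\<Sum>b\<in>Basis. (x \<bullet> b) * (\<Sum>b'\<in>Basis. I0 b b' * (y \<bullet> b')))"
    by (simp add: mat_op_def inner_sum_right mult.commute)
  also have "\<dots> = (\<Sum>b\<in>Basis. (x \<bullet> b) * I0 b (\<Sum>b'\<in>Basis. (y \<bullet> b') *\<^sub>R b'))"
    using I0_bilinear by (simp add: bilinear_def linear_sum linear_scale mult.commute)
  also have "\<dots> = I0 (\<Sum>b\<in>Basis. (x \<bullet> b) *\<^sub>R b) y"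
    using linear_sum[of "\<lambda>x. I0 x y" "\<lambda>b. (x \<bullet> b) *\<^sub>R b" Basis] I0_bilinear
    by (simp add: bilinear_def bilinear_lmul[OF I0_bilinear] euclidean_representation)
  finally show ?thesis by (simp add: euclidean_representation)
qed

lemma mat_op_linear: "linear (mat_op I0)"
  by (rule linearI) (simp_all add: mat_op_def algebra_simps sum.distrib scaleR_sum_right sum_distrib_left)

lemma I0_nonneg: "0 \<le> I0 b b"
  unfolding I0_eq(1)
  by (intro Bochner_Integration.integral_nonneg pos_def_nonneg pos_def_matrix_inv \<Gamma>0_pos_def)

definition \<Gamma>lim :: "'w \<Rightarrow> real^'d^'d" where
  "\<Gamma>lim W = expectation (\<lambda>\<omega>. sq_resid W (V0 \<omega>))"

lemma \<Gamma>lim_W0: "\<Gamma>lim W0 = \<Gamma>0"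
  by (simp add: \<Gamma>lim_def \<Gamma>0_def)

text \<open>Identifiability makes \<open>W0\<close> the unique minimiser of the limiting criterion, because
  \<open>\<Gamma>lim W - \<Gamma>0\<close> is the second moment matrix of \<open>F W0 (Z 0) - F W (Z 0)\<close>.\<close>
lemma
  assumes W: "W \<in> \<Theta>"
  shows \<Gamma>lim_pos_def: "pos_def (\<Gamma>lim W)"
    and ln_det_\<Gamma>lim_less: "W \<noteq> W0 \<Longrightarrow> ln (det \<Gamma>0) < ln (det (\<Gamma>lim W))"
proof -
  define f where "f z = F W0 z - F W z" for z
  have fm[measurable]: "f \<in> borel_measurable borel" unfolding f_def[abs_def] by measurable
  have fZ[measurable]: "(\<lambda>\<omega>. f (Z 0 \<omega>)) \<in> borel_measurable M"
    by (rule measurable_compose[OF Z_measurable fm])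
  have fb: "norm (f z) \<le> 2 * F_sup" for z
    unfolding f_def using norm_triangle_ineq4[of "F W0 z" "F W z"] F_sup(2)[OF W0_in, of z] F_sup(2)[OF W, of z] by linarith
  have fi: "integrable M (\<lambda>\<omega>. f (Z 0 \<omega>))"
    by (rule integrable_const_bound[where B="2 * F_sup"]) (use fb in auto)
  note cross = expectation_outer_input_noise[OF fm fi]
  have eq: "sq_resid W (V0 \<omega>) = outer (\<epsilon>0 \<omega>) (\<epsilon>0 \<omega>) + (outer (\<epsilon>0 \<omega>) (f (Z 0 \<omega>)) + outer (f (Z 0 \<omega>)) (\<epsilon>0 \<omega>))
      + outer (f (Z 0 \<omega>)) (f (Z 0 \<omega>))" for \<omega>
  proof -
    have "resid W (V0 \<omega>) = \<epsilon>0 \<omega> + f (Z 0 \<omega>)" by (simp add: \<epsilon>0_def resid_def f_def)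
    then show ?thesis by (simp add: sq_resid_def outer.add_left outer.add_right)
  qed
  have ff: "integrable M (\<lambda>\<omega>. outer (f (Z 0 \<omega>)) (f (Z 0 \<omega>)))"
  proof -
    obtain K where K: "K > 0" "\<And>(x::real^'d) y. norm (outer x y) \<le> K * (norm x * norm y)" by (rule outer_bound) blast
    have "norm (outer (f z) (f z)) \<le> K * ((2 * F_sup) * (2 * F_sup))" for z
      using F_sup(1) K(1) by (intro order_trans[OF K(2)] mult_left_mono mult_mono fb) auto
    then show ?thesis by (intro integrable_const_bound) auto
  qed
  define B where "B = expectation (\<lambda>\<omega>. outer (f (Z 0 \<omega>)) (f (Z 0 \<omega>)))"
  have \<Gamma>lim_eq: "\<Gamma>lim W = \<Gamma>0 + B"
    unfolding \<Gamma>lim_def eq \<Gamma>0_eq B_def using cross ff \<epsilon>0_outer_integrable by simp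
  have B_psd: "0 \<le> x \<bullet> (B *v x)" for x
    unfolding B_def psd_expectation_outer[OF ff] by simp
  show "pos_def (\<Gamma>lim W)"
    unfolding \<Gamma>lim_eq using pos_def_add_psd[OF \<Gamma>0_pos_def B_psd, of 1] by simp
  assume ne: "W \<noteq> W0"
  show "ln (det \<Gamma>0) < ln (det (\<Gamma>lim W))"
    unfolding \<Gamma>lim_eq
  proof (rule ln_det_less_add[OF \<Gamma>0_pos_def B_psd])
    fix P :: "real^'d^'d" assume P: "pos_def P"
    note tr = trace_expectation[OF ff, of P, folded B_def, unfolded trace_mult_outer]
    have nonneg: "0 \<le> f z \<bullet> (P *v f z)" for z by (rule pos_def_nonneg[OF P])
    \<comment> \<open>\<open>trace (P ** B)\<close> is the mean of the nonnegative
      \<open>f \<bullet> (P *v f)\<close> at the input. If it were zero, \<open>f\<close> would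
      vanish almost surely, which identifiability allows only at \<open>W0\<close>.\<close>
    have "trace (P ** B) \<noteq> 0"
    proof
      assume "trace (P ** B) = 0"
      then have "AE \<omega> in M. f (Z 0 \<omega>) \<bullet> (P *v f (Z 0 \<omega>)) = 0"
        using integral_nonneg_eq_0_iff_AE[OF tr(2)] tr(1) nonneg by auto
      then have "AE \<omega> in M. F W (Z 0 \<omega>) = F W0 (Z 0 \<omega>)"
      proof eventually_elim
        case (elim \<omega>)
        then have "f (Z 0 \<omega>) = 0" using P unfolding pos_def_def by force
        then show ?case by (simp add: f_def)
      qed
      then show False using identifiable[OF W] ne by blast
    qed
    moreover have "trace (P ** B) \<ge> 0" unfolding tr(1) using nonneg by simp
    ultimately show "0 < trace (P ** B)" by simp
  qed
qed

end

section \<open>Measurability of the gradient, singular outcomes included\<close>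

lemma measurable_trace_mult:
  fixes f g :: "'s \<Rightarrow> real^'d^'d"
  assumes [measurable]: "f \<in> borel_measurable M" "g \<in> borel_measurable M"
  shows "(\<lambda>x. trace (f x ** g x)) \<in> borel_measurable M"
proof -
  have "continuous_on UNIV (\<lambda>p::(real^'d^'d)\<times>(real^'d^'d). trace (fst p ** snd p))"
    by (intro bounded_linear.continuous_on[OF bounded_linear_trace] matmul.continuous_on
        continuous_on_fst continuous_on_snd continuous_on_id)
  from measurable_compose[OF _ borel_measurable_continuous_onI[OF this], of "\<lambda>x. (f x, g x)" M]
  show ?thesis by simp
qed

text \<open>Inversion is continuous on the open set of positive determinant; setting it to
  \<open>0\<close> elsewhere removes the unspecified values at singular matrices.\<close>

lemma measurable_matrix_inv_on_det_pos:
  "(\<lambda>A::real^'d^'d. if A \<in> {A. det A > 0} then matrix_inv A else 0) \<in> borel_measurable borel"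
proof (rule borel_measurable_continuous_on_if)
  show "{A::real^'d^'d. det A > 0} \<in> sets borel"
    using continuous_on_det by (intro borel_open open_Collect_less continuous_on_const)
  show "continuous_on {A::real^'d^'d. det A > 0} matrix_inv"
    by (intro continuous_at_imp_continuous_on ballI has_derivative_continuous[OF has_derivative_matrix_inv]) auto
qed simp

text \<open>Where \<open>D\<close> vanishes, \<open>ln D = 0\<close> by convention while \<open>ln D \<rightarrow> -\<infinity>\<close> along points with \<open>D > 0\<close>.\<close>
lemma ln_differentiable_at_zero:
  fixes D :: "'w::real_normed_vector \<Rightarrow> real"
  assumes cont: "continuous_on UNIV D" and nonneg: "\<And>W. 0 \<le> D W" and zero: "D W0 = 0"
    and diff: "((\<lambda>W. ln (D W)) has_derivative f') (at W0)"
  shows "\<forall>\<^sub>F W in nhds W0. D W = 0"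
proof -
  have "continuous (at W0) (\<lambda>W. ln (D W))" by (rule has_derivative_continuous[OF diff])
  then have "((\<lambda>W. ln (D W)) \<longlongrightarrow> ln (D W0)) (nhds W0)"
    using tendsto_at_iff_tendsto_nhds[of "\<lambda>W. ln (D W)" W0] by (simp add: isCont_def)
  \<comment> \<open>Continuity forces \<open>ln (D W) > -1\<close> and \<open>D W < exp (-1)\<close>
    near \<open>W0\<close>, but for positive \<open>D W\<close> the second inequality contradicts
    the first.\<close>
  then have 1: "\<forall>\<^sub>F W in nhds W0. ln (D W) > -1"
    using zero by (intro order_tendstoD(1)[of _ 0]) auto
  have "(D \<longlongrightarrow> D W0) (at W0)" using cont by (simp add: continuous_on_def)
  then have "(D \<longlongrightarrow> D W0) (nhds W0)" using tendsto_at_iff_tendsto_nhds[of D W0] by simp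
  then have 2: "\<forall>\<^sub>F W in nhds W0. D W < exp (-1)"
    using zero by (intro order_tendstoD(2)[of _ 0]) auto
  from 1 2 show ?thesis
  proof eventually_elim
    case (elim W)
    show "D W = 0"
    proof (rule ccontr)
      assume "D W \<noteq> 0"
      then have "D W > 0" using nonneg[of W] by simp
      then have "ln (D W) < -1" using elim(2) ln_less_cancel_iff[of "D W" "exp (-1)"] by simp
      then show False using elim(1) by simp
    qed
  qed
qed

text \<open>The neighbourhood may be taken from the balls of radius \<open>1 / Suc m\<close>, and by
  continuity vanishing on such a ball can be tested on a countable dense subset, so only countable
  quantifiers remain.\<close>

lemma measurable_eventually_zero:
  fixes D :: "'a \<Rightarrow> 'w::{metric_space, second_countable_topology} \<Rightarrow> real"
  assumes cont: "\<And>\<omega>. continuous_on UNIV (D \<omega>)" and [measurable]: "\<And>W. (\<lambda>\<omega>. D \<omega> W) \<in> borel_measurable M"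
  shows "{\<omega>\<in>space M. \<forall>\<^sub>F W in nhds W0. D \<omega> W = 0} \<in> sets M"
proof -
  have "\<exists>T. countable T \<and> T \<subseteq> ball W0 (1 / Suc m) \<and> ball W0 (1 / Suc m) \<subseteq> closure T" for m
    using separable[of "ball W0 (1 / Suc m)"] by metis
  then obtain T where T: "\<And>m. countable (T m)" "\<And>m. T m \<subseteq> ball W0 (1 / Suc m)" "\<And>m. ball W0 (1 / Suc m) \<subseteq> closure (T m)"
    by metis
  have "(\<forall>\<^sub>F W in nhds W0. D \<omega> W = 0) \<longleftrightarrow> (\<exists>m. \<forall>q\<in>T m. D \<omega> q = 0)" for \<omega>
  proof
    assume "\<forall>\<^sub>F W in nhds W0. D \<omega> W = 0"
    then obtain d where d: "d > 0" "\<And>W. dist W W0 < d \<Longrightarrow> D \<omega> W = 0" by (auto simp: eventually_nhds_metric)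
    obtain m :: nat where "1 / Suc m < d" using nat_approx_posE[OF d(1)] by auto
    then have "\<forall>q\<in>T m. D \<omega> q = 0" using T(2)[of m] d(2) by (force simp: dist_commute)
    then show "\<exists>m. \<forall>q\<in>T m. D \<omega> q = 0" by blast
  next
    assume "\<exists>m. \<forall>q\<in>T m. D \<omega> q = 0"
    then obtain m where m: "\<forall>q\<in>T m. D \<omega> q = 0" by blast
    have "closed {W. D \<omega> W = 0}" using cont[of \<omega>] by (intro closed_Collect_eq continuous_on_const)
    then have "closure (T m) \<subseteq> {W. D \<omega> W = 0}" using m by (intro closure_minimal) auto
    then have "\<forall>W. dist W W0 < 1 / Suc m \<longrightarrow> D \<omega> W = 0" using T(3)[of m] by (force simp: dist_commute)
    then show "\<forall>\<^sub>F W in nhds W0. D \<omega> W = 0"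
      unfolding eventually_nhds_metric by (intro exI[of _ "1 / Suc m"]) auto
  qed
  moreover have "{\<omega>\<in>space M. \<exists>m. \<forall>q\<in>T m. D \<omega> q = 0} \<in> sets M"
    using T(1) by measurable
  ultimately show ?thesis by simp
qed

context regression_data begin

lemma measurable_\<Gamma>[measurable]:
  "(\<lambda>\<omega>. \<Gamma> n \<omega> W) \<in> borel_measurable M" "(\<lambda>\<omega>. \<Gamma>1 n \<omega> b W) \<in> borel_measurable M"
  unfolding \<Gamma>_def \<Gamma>1_def by (rule YZ.measurable_average, rule measurable_sq_resid)+

lemma measurable_det_\<Gamma>[measurable]: "(\<lambda>\<omega>. det (\<Gamma> n \<omega> W)) \<in> borel_measurable M"
  by (rule measurable_compose[OF measurable_\<Gamma>(1) borel_measurable_continuous_onI[OF continuous_on_det]])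

text \<open>\<open>SOME f'. False\<close> is the junk value of \<open>frechet_derivative\<close> at points without a derivative. For discrete noise the
  event \<open>det \<Gamma> = 0\<close> has positive probability for every \<open>n\<close>, so measurability of the gradient must cover it.\<close>
lemma gradient_U_cases:
  "gradient (U n \<omega>) W =
    (if det (\<Gamma> n \<omega> W) > 0 then \<Sum>b\<in>Basis. U1 n \<omega> b W *\<^sub>R b
     else if \<forall>\<^sub>F W in nhds W. det (\<Gamma> n \<omega> W) = 0 then 0
     else \<Sum>b\<in>Basis. (SOME f'. False) b *\<^sub>R b)"
proof -
  consider "det (\<Gamma> n \<omega> W) > 0" | "det (\<Gamma> n \<omega> W) = 0" using det_\<Gamma>_nonneg[of n \<omega> W] by linarith
  then show ?thesis
  proof cases
    case 1
    then show ?thesis by (simp add: gradient_U)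
  next
    case 2
    show ?thesis
    proof (cases "\<forall>\<^sub>F W in nhds W. det (\<Gamma> n \<omega> W) = 0")
      case True
      then obtain S where S: "open S" "W \<in> S" "\<And>V. V \<in> S \<Longrightarrow> det (\<Gamma> n \<omega> V) = 0" unfolding eventually_nhds by blast
      \<comment> \<open>On \<open>S\<close> the criterion is \<open>ln 0 = 0\<close> identically, so
        it is differentiable there with derivative \<open>0\<close>.\<close>
      have "(U n \<omega> has_derivative (\<lambda>_. 0)) (at W)"
        by (rule has_derivative_transform_within_open[OF has_derivative_const[of 0] S(1,2)]) (simp add: U_def S(3))
      then have "frechet_derivative (U n \<omega>) (at W) = (\<lambda>_. 0)" using frechet_derivative_at by metis
      then show ?thesis using True 2 by (simp add: gradient_def)
    next
      case False
      have "\<not> (U n \<omega> has_derivative f') (at W)" for f'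
        using ln_differentiable_at_zero[OF det_\<Gamma>_continuous det_\<Gamma>_nonneg 2] False unfolding U_def[abs_def] by blast
      then have "frechet_derivative (U n \<omega>) (at W) = (SOME f'. False)"
        by (simp add: frechet_derivative_def)
      then show ?thesis using False 2 by (simp add: gradient_def)
    qed
  qed
qed

lemma measurable_gradient_U: "(\<lambda>\<omega>. gradient (U n \<omega>) W) \<in> borel_measurable M"
proof -
  define inv' where "inv' A = (if A \<in> {A. det A > 0} then matrix_inv A else 0)" for A :: "real^'d^'d"
  have inv'[measurable]: "inv' \<in> borel_measurable borel"
    unfolding inv'_def[abs_def] by (rule measurable_matrix_inv_on_det_pos)
  have tr: "(\<lambda>\<omega>. trace (inv' (\<Gamma> n \<omega> W) ** \<Gamma>1 n \<omega> b W)) \<in> borel_measurable M" for b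
    by (intro measurable_trace_mult measurable_compose[OF measurable_\<Gamma>(1) inv'] measurable_\<Gamma>(2))
  have "gradient (U n \<omega>) W =
    (if det (\<Gamma> n \<omega> W) > 0 then \<Sum>b\<in>Basis. trace (inv' (\<Gamma> n \<omega> W) ** \<Gamma>1 n \<omega> b W) *\<^sub>R b
     else if \<forall>\<^sub>F W in nhds W. det (\<Gamma> n \<omega> W) = 0 then 0
     else \<Sum>b\<in>Basis. (SOME f'. False) b *\<^sub>R b)" for \<omega>
    unfolding gradient_U_cases by (simp add: inv'_def U1_def)
  note eq = this
  show ?thesis
    unfolding eq
  proof (intro measurable_If measurable_const)
    show "(\<lambda>\<omega>. \<Sum>b\<in>Basis. trace (inv' (\<Gamma> n \<omega> W) ** \<Gamma>1 n \<omega> b W) *\<^sub>R b) \<in> borel_measurable M"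
      by (intro borel_measurable_sum borel_measurable_scaleR borel_measurable_const tr)
    show "{\<omega>\<in>space M. 0 < det (\<Gamma> n \<omega> W)} \<in> sets M"
      by (rule borel_measurable_less[OF borel_measurable_const measurable_det_\<Gamma>])
    show "{\<omega>\<in>space M. \<forall>\<^sub>F W in nhds W. det (\<Gamma> n \<omega> W) = 0} \<in> sets M"
      by (rule measurable_eventually_zero[OF det_\<Gamma>_continuous measurable_det_\<Gamma>])
  qed simp_all
qed

end

section \<open>Almost sure joint limits of the criterion and its derivatives\<close>

context regression_model begin

lemma AE_uniform_limits:
  "AE \<omega> in M. uniform_limit \<Theta> (\<lambda>n. \<Gamma> n \<omega>) \<Gamma>lim sequentially \<and>
    (\<forall>b\<in>Basis. uniform_limit \<Theta> (\<lambda>n. \<Gamma>1 n \<omega> b) (\<lambda>W. expectation (\<lambda>\<omega>. sq_resid1 b W (V0 \<omega>))) sequentially) \<and>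
    (\<forall>b\<in>Basis. \<forall>b'\<in>Basis. uniform_limit \<Theta> (\<lambda>n. \<Gamma>2 n \<omega> b b') (\<lambda>W. expectation (\<lambda>\<omega>. sq_resid2 b b' W (V0 \<omega>))) sequentially)"
proof -
  have "AE \<omega> in M. uniform_limit \<Theta> (\<lambda>n. \<Gamma> n \<omega>) \<Gamma>lim sequentially"
    using uniform_law_sq_resid(1)[of sq_resid] by (simp add: \<Gamma>_def[abs_def] \<Gamma>lim_def[abs_def])
  moreover have "AE \<omega> in M. \<forall>b\<in>Basis. uniform_limit \<Theta> (\<lambda>n. \<Gamma>1 n \<omega> b) (\<lambda>W. expectation (\<lambda>\<omega>. sq_resid1 b W (V0 \<omega>))) sequentially"
    unfolding AE_ball_countable[OF countable_finite[OF finite_Basis]]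
    using uniform_law_sq_resid(1)[of "sq_resid1 b" b for b] by (simp add: \<Gamma>1_def[abs_def])
  moreover have "AE \<omega> in M. \<forall>b\<in>Basis. \<forall>b'\<in>Basis. uniform_limit \<Theta> (\<lambda>n. \<Gamma>2 n \<omega> b b') (\<lambda>W. expectation (\<lambda>\<omega>. sq_resid2 b b' W (V0 \<omega>))) sequentially"
    unfolding AE_ball_countable[OF countable_finite[OF finite_Basis]]
    using uniform_law_sq_resid(1)[of "sq_resid2 b b'" b b' for b b'] by (simp add: \<Gamma>2_def[abs_def])
  ultimately show ?thesis by eventually_elim blast
qed

abbreviation "near W \<equiv> sequentially \<times>\<^sub>F inf (nhds W) (principal \<Theta>)"

text \<open>Uniform limits supply one null set for all parameters in \<Theta>. In the limit of
  \<open>U2\<close> at \<open>W0\<close> the trace with two first derivatives disappears because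
  both of them tend to \<open>0\<close>, and the symmetry of \<open>I0\<close> yields the factor
  \<open>2\<close>.\<close>

lemma AE_local_limits:
  "AE \<omega> in M. (\<forall>W\<in>\<Theta>. ((\<lambda>(n, W). \<Gamma> n \<omega> W) \<longlongrightarrow> \<Gamma>lim W) (near W)) \<and>
    (\<forall>b\<in>Basis. ((\<lambda>(n, W). \<Gamma>1 n \<omega> b W) \<longlongrightarrow> 0) (near W0)) \<and>
    (\<forall>b\<in>Basis. \<forall>b'\<in>Basis. ((\<lambda>(n, W). U2 n \<omega> b b' W) \<longlongrightarrow> 2 * I0 b b') (near W0))"
  using AE_uniform_limits
proof eventually_elim
  case (elim \<omega>)
  have 0: "((\<lambda>(n, W). \<Gamma> n \<omega> W) \<longlongrightarrow> \<Gamma>lim W) (near W)" if "W \<in> \<Theta>" for W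
    using uniform_limit_tendsto_prod[OF conjunct1[OF elim] _ that] uniform_law_sq_resid(2)[of sq_resid] by (simp add: \<Gamma>lim_def[abs_def])
  have 1: "((\<lambda>(n, W). \<Gamma>1 n \<omega> b W) \<longlongrightarrow> 0) (near W0)" if "b \<in> Basis" for b
  proof -
    have "uniform_limit \<Theta> (\<lambda>n. \<Gamma>1 n \<omega> b) (\<lambda>W. expectation (\<lambda>\<omega>. sq_resid1 b W (V0 \<omega>))) sequentially"
      using elim that by blast
    from uniform_limit_tendsto_prod[OF this uniform_law_sq_resid(2)[of "sq_resid1 b" b] W0_in]
    show ?thesis by (simp add: sq_resid1_mean_zero)
  qed
  have 2: "((\<lambda>(n, W). \<Gamma>2 n \<omega> b b' W) \<longlongrightarrow> J b b' + J b' b) (near W0)" if "b \<in> Basis" "b' \<in> Basis" for b b'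
  proof -
    have "uniform_limit \<Theta> (\<lambda>n. \<Gamma>2 n \<omega> b b') (\<lambda>W. expectation (\<lambda>\<omega>. sq_resid2 b b' W (V0 \<omega>))) sequentially"
      using elim that by blast
    from uniform_limit_tendsto_prod[OF this uniform_law_sq_resid(2)[of "sq_resid2 b b'" b b'] W0_in]
    show ?thesis by (simp add: sq_resid2_mean)
  qed
  have 3: "((\<lambda>(n, W). U2 n \<omega> b b' W) \<longlongrightarrow> 2 * I0 b b') (near W0)" if b: "b \<in> Basis" "b' \<in> Basis" for b b'
  proof -
    have "((\<lambda>p. matrix_inv (\<Gamma> (fst p) \<omega> (snd p))) \<longlongrightarrow> P0) (near W0)"
      using tendsto_matrix_inv[OF 0[OF W0_in]] \<Gamma>0_det_pos by (simp add: case_prod_beta' \<Gamma>lim_W0)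
    note lims = this 2[OF b, unfolded case_prod_beta'] 1[OF b(1), unfolded case_prod_beta'] 1[OF b(2), unfolded case_prod_beta']
    have "((\<lambda>p. U2 (fst p) \<omega> b b' (snd p)) \<longlongrightarrow> trace (P0 ** (J b b' + J b' b)) - trace (P0 ** 0 ** P0 ** 0)) (near W0)"
      unfolding U2_def by (intro tendsto_diff bounded_linear.tendsto[OF bounded_linear_trace] matmul.tendsto lims)
    then show ?thesis
      by (simp add: case_prod_beta' trace_P0_J matmul.zero_left matmul.zero_right linear_0[OF linear_trace])
  qed
  show ?case using 0 1 3 by blast
qed

lemma filterlim_at_W0: "filterlim (\<lambda>n. (n, W0)) (near W0) sequentially"
proof (rule filterlim_Pair)
  show "filterlim (\<lambda>n. n) sequentially sequentially" by (rule filterlim_ident)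
  show "filterlim (\<lambda>n. W0) (inf (nhds W0) (principal \<Theta>)) sequentially"
    using W0_in by (simp add: filterlim_inf filterlim_principal)
qed

lemma AE_det_\<Gamma>_W0_pos: "AE \<omega> in M. (\<lambda>n. \<Gamma> n \<omega> W0) \<longlonglongrightarrow> \<Gamma>0 \<and> (\<forall>\<^sub>F n in sequentially. det (\<Gamma> n \<omega> W0) > 0)"
  using AE_local_limits
proof eventually_elim
  case (elim \<omega>)
  have "((\<lambda>(n, W). \<Gamma> n \<omega> W) \<longlongrightarrow> \<Gamma>lim W0) (near W0)" using elim W0_in by blast
  from filterlim_compose[OF this filterlim_at_W0]
  have lim: "(\<lambda>n. \<Gamma> n \<omega> W0) \<longlonglongrightarrow> \<Gamma>0" by (simp add: \<Gamma>lim_W0)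
  then have "\<forall>\<^sub>F n in sequentially. det (\<Gamma> n \<omega> W0) > 0"
    using order_tendstoD(1)[OF tendsto_det[OF lim] \<Gamma>0_det_pos] by simp
  with lim show ?case by blast
qed

theorem hessian_tendsto:
  "AE \<omega> in M. \<forall>b\<in>Basis. \<forall>b'\<in>Basis. (\<lambda>n. hessian (U n \<omega>) W0 b b') \<longlonglongrightarrow> 2 * I0 b b'"
  using AE_local_limits AE_det_\<Gamma>_W0_pos
proof eventually_elim
  case (elim \<omega>)
  show ?case
  proof (intro ballI)
    fix b b' :: 'w assume "b \<in> Basis" "b' \<in> Basis"
    then have "((\<lambda>(n, W). U2 n \<omega> b b' W) \<longlongrightarrow> 2 * I0 b b') (near W0)" using elim by blast
    from filterlim_compose[OF this filterlim_at_W0]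
    have "(\<lambda>n. U2 n \<omega> b b' W0) \<longlonglongrightarrow> 2 * I0 b b'" by simp
    moreover have "\<forall>\<^sub>F n in sequentially. U2 n \<omega> b b' W0 = hessian (U n \<omega>) W0 b b'"
      using conjunct2[OF elim(2)] by eventually_elim (simp add: hessian_U)
    ultimately show "(\<lambda>n. hessian (U n \<omega>) W0 b b') \<longlonglongrightarrow> 2 * I0 b b'"
      by (rule Lim_transform_eventually)
  qed
qed

section \<open>The score and its central limit theorem\<close>

definition score :: "(real^'d) \<times> 'z \<Rightarrow> 'w" where
  "score v = (\<Sum>b\<in>Basis. trace (P0 ** sq_resid1 b W0 v) *\<^sub>R b)"

lemma measurable_score[measurable]: "score \<in> borel_measurable borel"
  unfolding score_def[abs_def]
  by (intro borel_measurable_sum borel_measurable_scaleR measurable_trace_mult measurable_sq_resid borel_measurable_const)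

text \<open>\<open>score\<close> is one summand of the gradient with the empirical inverse matrix
  replaced by its limit \<open>P0\<close>. Symmetry of \<open>P0\<close> merges the two outer
  products into a single term, linear in the noise, with factor \<open>- 2\<close>.\<close>

lemma score_inner: "x \<bullet> score v = - 2 * (resid W0 v \<bullet> (P0 *v F1 W0 x (snd v)))"
proof -
  have tr: "trace (P0 ** sq_resid1 b W0 v) = - 2 * (resid W0 v \<bullet> (P0 *v F1 W0 b (snd v)))" for b
    using P0_symmetric[of "F1 W0 b (snd v)" "resid W0 v"]
    unfolding sq_resid1_def matmul.minus_right matmul.add_right linear_neg[OF linear_trace] linear_add[OF linear_trace] trace_mult_outer
    by simp
  have lin: "linear (\<lambda>x. resid W0 v \<bullet> (P0 *v F1 W0 x (snd v)))"
    by (rule linearI) (simp_all add: linear_add[OF linear_F1] linear_scale[OF linear_F1] matrix_vector_right_distrib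
        matrix_vector_mult_scaleR inner_add_right)
  have "x \<bullet> score v = (\<Sum>b\<in>Basis. (x \<bullet> b) * (- 2 * (resid W0 v \<bullet> (P0 *v F1 W0 b (snd v)))))"
    by (simp only: score_def tr inner_sum_right inner_scaleR_right) (simp only: mult.commute)
  also have "\<dots> = - 2 * (\<Sum>b\<in>Basis. (x \<bullet> b) * (resid W0 v \<bullet> (P0 *v F1 W0 b (snd v))))"
    by (simp add: sum_distrib_left mult.left_commute sum_negf)
  also have "(\<Sum>b\<in>Basis. (x \<bullet> b) * (resid W0 v \<bullet> (P0 *v F1 W0 b (snd v))))
      = resid W0 v \<bullet> (P0 *v F1 W0 (\<Sum>b\<in>Basis. (x \<bullet> b) *\<^sub>R b) (snd v))"
    unfolding linear_sum[OF lin] linear_scale[OF lin] by simp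
  finally show ?thesis by (simp only: euclidean_representation)
qed

text \<open>In coordinates the square is a double sum of
  \<open>\<epsilon>0 $ i * \<epsilon>0 $ j\<close> times a product of input coordinates.
  Independence separates them, and the noise factor has mean \<open>\<Gamma>0 $ i $ j\<close>; two
  moments of each side suffice.\<close>

lemma noise_quadratic_form:
  fixes q :: "'z \<Rightarrow> real^'d"
  assumes q[measurable]: "q \<in> borel_measurable borel" and q_sq: "integrable M (\<lambda>\<omega>. (norm (q (Z 0 \<omega>)))\<^sup>2)"
  shows "integrable M (\<lambda>\<omega>. (\<epsilon>0 \<omega> \<bullet> q (Z 0 \<omega>))\<^sup>2)"
    and "expectation (\<lambda>\<omega>. (\<epsilon>0 \<omega> \<bullet> q (Z 0 \<omega>))\<^sup>2) = expectation (\<lambda>\<omega>. q (Z 0 \<omega>) \<bullet> (\<Gamma>0 *v q (Z 0 \<omega>)))"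
proof -
  have nth: "(\<lambda>x::real^'d. x $ i) \<in> borel_measurable borel" for i
    by (rule borel_measurable_continuous_onI[OF linear_continuous_on[OF bounded_linear_vec_nth]])
  have qm[measurable]: "(\<lambda>z. q z $ i) \<in> borel_measurable borel" for i
    by (rule measurable_compose[OF q nth])
  have qZ[measurable]: "(\<lambda>\<omega>. q (Z 0 \<omega>)) \<in> borel_measurable M" by (rule measurable_compose[OF Z_measurable q])
  have qZi[measurable]: "(\<lambda>\<omega>. q (Z 0 \<omega>) $ i) \<in> borel_measurable M" for i by (rule measurable_compose[OF qZ nth])
  have qq: "integrable M (\<lambda>\<omega>. q (Z 0 \<omega>) $ i * q (Z 0 \<omega>) $ j)" for i j
  proof (rule Bochner_Integration.integrable_bound[OF q_sq])
    show "AE \<omega> in M. norm (q (Z 0 \<omega>) $ i * q (Z 0 \<omega>) $ j) \<le> norm ((norm (q (Z 0 \<omega>)))\<^sup>2)"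
      by (intro AE_I2) (auto simp: power2_eq_square abs_mult intro!: mult_mono component_le_norm_cart)
  qed measurable
  have ee: "integrable M (\<lambda>\<omega>. \<epsilon>0 \<omega> $ i * \<epsilon>0 \<omega> $ j)" "expectation (\<lambda>\<omega>. \<epsilon>0 \<omega> $ i * \<epsilon>0 \<omega> $ j) = \<Gamma>0 $ i $ j" for i j
    using integrable_bounded_linear[OF bounded_linear_compose[OF bounded_linear_vec_nth[of j] bounded_linear_vec_nth[of i]] \<epsilon>0_outer_integrable]
      integral_bounded_linear[OF bounded_linear_compose[OF bounded_linear_vec_nth[of j] bounded_linear_vec_nth[of i]] \<epsilon>0_outer_integrable]
    by (simp_all add: \<Gamma>0_eq outer_def)
  have prod: "integrable M (\<lambda>\<omega>. (\<epsilon>0 \<omega> $ i * \<epsilon>0 \<omega> $ j) * (q (Z 0 \<omega>) $ i * q (Z 0 \<omega>) $ j))"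
    "expectation (\<lambda>\<omega>. (\<epsilon>0 \<omega> $ i * \<epsilon>0 \<omega> $ j) * (q (Z 0 \<omega>) $ i * q (Z 0 \<omega>) $ j))
      = \<Gamma>0 $ i $ j * expectation (\<lambda>\<omega>. q (Z 0 \<omega>) $ i * q (Z 0 \<omega>) $ j)" for i j
    using indep_noise_input[of "\<lambda>x. x $ i * x $ j" "\<lambda>z. q z $ i * q z $ j"] nth qm ee[of i j] qq[of i j]
    by (simp_all add: borel_measurable_times)
  have sq: "(\<epsilon>0 \<omega> \<bullet> q (Z 0 \<omega>))\<^sup>2 = (\<Sum>i\<in>UNIV. \<Sum>j\<in>UNIV. (\<epsilon>0 \<omega> $ i * \<epsilon>0 \<omega> $ j) * (q (Z 0 \<omega>) $ i * q (Z 0 \<omega>) $ j))" for \<omega>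
    by (simp add: inner_vec_def power2_eq_square sum_product mult_ac)
  show "integrable M (\<lambda>\<omega>. (\<epsilon>0 \<omega> \<bullet> q (Z 0 \<omega>))\<^sup>2)"
    unfolding sq by (intro Bochner_Integration.integrable_sum prod)
  have form: "y \<bullet> (\<Gamma>0 *v y) = (\<Sum>i\<in>UNIV. \<Sum>j\<in>UNIV. \<Gamma>0 $ i $ j * (y $ i * y $ j))" for y
    by (simp add: inner_vec_def matrix_vector_mult_def sum_distrib_left mult_ac)
  show "expectation (\<lambda>\<omega>. (\<epsilon>0 \<omega> \<bullet> q (Z 0 \<omega>))\<^sup>2) = expectation (\<lambda>\<omega>. q (Z 0 \<omega>) \<bullet> (\<Gamma>0 *v q (Z 0 \<omega>)))"
    unfolding sq form using prod qq by (simp add: Bochner_Integration.integral_sum Bochner_Integration.integrable_sum)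
qed

text \<open>The quadratic form is taken at \<open>P0 *v F1 W0 x z\<close>: \<open>\<Gamma>0\<close>
  cancels one of the two factors \<open>P0\<close>, leaving the integrand of \<open>I0 x x\<close>.
  The \<open>4\<close> is the square of the factor \<open>- 2\<close> in the score.\<close>

lemma score_second_moment:
  "integrable M (\<lambda>\<omega>. (x \<bullet> score (V0 \<omega>))\<^sup>2)"
  "expectation (\<lambda>\<omega>. (x \<bullet> score (V0 \<omega>))\<^sup>2) = 4 * I0 x x"
proof -
  let ?q = "\<lambda>z. P0 *v F1 W0 x z"
  have mul: "(\<lambda>y. P0 *v y) \<in> borel_measurable borel"
    by (intro borel_measurable_continuous_onI linear_continuous_on) (simp add: linear_linear)
  have qm: "?q \<in> borel_measurable borel" by (rule measurable_compose[OF F1_meas mul])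
  have qZ[measurable]: "(\<lambda>\<omega>. ?q (Z 0 \<omega>)) \<in> borel_measurable M" by (rule measurable_compose[OF Z_measurable qm])
  obtain K where K: "\<And>y. norm (P0 *v y) \<le> norm y * K"
    using bounded_linear.bounded[of "\<lambda>y. P0 *v y"] by (auto simp: linear_linear)
  have i: "integrable M (\<lambda>\<omega>. (norm (F1 W0 x (Z 0 \<omega>)))\<^sup>2 * K\<^sup>2)" using F1_sq_integrable by simp
  have q_sq: "integrable M (\<lambda>\<omega>. (norm (?q (Z 0 \<omega>)))\<^sup>2)"
  proof (rule Bochner_Integration.integrable_bound[OF i])
    have "(norm (?q z))\<^sup>2 \<le> (norm (F1 W0 x z))\<^sup>2 * K\<^sup>2" for z
      using power_mono[OF K[of "F1 W0 x z"], of 2] by (simp add: power_mult_distrib)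
    then show "AE \<omega> in M. norm ((norm (?q (Z 0 \<omega>)))\<^sup>2) \<le> norm ((norm (F1 W0 x (Z 0 \<omega>)))\<^sup>2 * K\<^sup>2)" by simp
  qed measurable
  note quad = noise_quadratic_form[OF qm q_sq]
  have sc: "(x \<bullet> score (V0 \<omega>))\<^sup>2 = 4 * (\<epsilon>0 \<omega> \<bullet> ?q (Z 0 \<omega>))\<^sup>2" for \<omega>
    by (simp add: score_inner \<epsilon>0_def power_mult_distrib)
  show "integrable M (\<lambda>\<omega>. (x \<bullet> score (V0 \<omega>))\<^sup>2)" unfolding sc using quad(1) by simp
  have inv: "\<Gamma>0 *v (P0 *v y) = y" for y
    by (simp add: matrix_vector_mul_assoc matrix_inv_mult[OF pos_def_invertible[OF \<Gamma>0_pos_def]])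
  show "expectation (\<lambda>\<omega>. (x \<bullet> score (V0 \<omega>))\<^sup>2) = 4 * I0 x x"
    unfolding sc using quad(2) by (simp add: inv I0_eq(1) inner_commute)
qed

lemma score_mean: "expectation (\<lambda>\<omega>. score (V0 \<omega>)) = 0"
  and score_norm_sq: "integrable M (\<lambda>\<omega>. (norm (score (V0 \<omega>)))\<^sup>2)"
proof -
  have "integrable M (\<lambda>\<omega>. sq_resid1 b W0 (V0 \<omega>))" for b
    by (rule uniform_law_sq_resid(3)[OF _ W0_in]) auto
  note tr = trace_expectation[OF this, of P0]
  have "expectation (\<lambda>\<omega>. score (V0 \<omega>)) = (\<Sum>b\<in>Basis. trace (P0 ** expectation (\<lambda>\<omega>. sq_resid1 b W0 (V0 \<omega>))) *\<^sub>R b)"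
    unfolding score_def tr(1) using tr(2) by (simp add: Bochner_Integration.integral_sum)
  then show "expectation (\<lambda>\<omega>. score (V0 \<omega>)) = 0"
    by (simp add: sq_resid1_mean_zero matmul.zero_right linear_0[OF linear_trace])
  have "(norm y)\<^sup>2 = (\<Sum>b\<in>Basis. (b \<bullet> y)\<^sup>2)" for y :: 'w
    by (simp add: norm_eq_sqrt_inner euclidean_inner[of y y] sum_nonneg power2_eq_square inner_commute)
  then show "integrable M (\<lambda>\<omega>. (norm (score (V0 \<omega>)))\<^sup>2)"
    using score_second_moment(1) by simp
qed

text \<open>The linear map \<open>A\<close> is kept general because the statement is used twice:
  with the identity for the gradient, and with \<open>- 1/2\<close> times the inverse of the
  information operator for the estimator.\<close>

lemma score_clt:
  fixes A :: "'w \<Rightarrow> 'w"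
  assumes A: "bounded_linear A" and \<mu>: "gaussian_law \<mu> C"
    and C: "\<And>t. t \<bullet> C t = expectation (\<lambda>\<omega>. (t \<bullet> A (score (V0 \<omega>)))\<^sup>2)"
  shows "conv_in_law M (\<lambda>n \<omega>. A ((1 / sqrt (real n)) *\<^sub>R (\<Sum>t<n. score (Y t \<omega>, Z t \<omega>)))) \<mu>"
proof -
  interpret A: bounded_linear A by fact
  have Am: "A \<in> borel_measurable borel"
    by (intro borel_measurable_continuous_onI linear_continuous_on A)
  have As: "(\<lambda>v. A (score v)) \<in> borel_measurable borel" by (rule measurable_compose[OF measurable_score Am])
  have sI: "integrable M (\<lambda>\<omega>. score (V0 \<omega>))"
  proof -
    have [measurable]: "(\<lambda>\<omega>. score (V0 \<omega>)) \<in> borel_measurable M" by (rule measurable_compose[OF V0_measurable measurable_score])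
    have "integrable M (\<lambda>\<omega>. norm (score (V0 \<omega>)))"
      by (rule square_integrable_imp_integrable) (use score_norm_sq in auto)
    then show ?thesis by (simp add: integrable_norm_iff)
  qed
  obtain K where K: "\<And>y. norm (A y) \<le> norm y * K" using A.bounded by blast
  have "conv_in_law M (\<lambda>n \<omega>. (1 / sqrt (real n)) *\<^sub>R (\<Sum>t<n. A (score (Y t \<omega>, Z t \<omega>)))) \<mu>"
  proof (rule multivariate_central_limit_theorem[where \<xi>="\<lambda>t \<omega>. A (score (Y t \<omega>, Z t \<omega>))", OF _ _ _ _ \<mu> C])
    show "indep_vars (\<lambda>_. borel) (\<lambda>t \<omega>. A (score (Y t \<omega>, Z t \<omega>))) UNIV"
      by (rule indep_vars_compose2[OF YZ_indep]) (rule As)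
    show "distr M borel (\<lambda>\<omega>. A (score (Y n \<omega>, Z n \<omega>))) = distr M borel (\<lambda>\<omega>. A (score (V0 \<omega>)))" for n
      using distr_distr[OF As YZ.V_measurable[of n]] distr_distr[OF As YZ.V_measurable[of 0]] YZ_ident[of n]
      by (simp add: o_def)
    show "expectation (\<lambda>\<omega>. A (score (V0 \<omega>))) = 0"
      using integral_bounded_linear[OF A sI] score_mean by (simp add: A.zero)
    have i: "integrable M (\<lambda>\<omega>. (norm (score (V0 \<omega>)))\<^sup>2 * K\<^sup>2)" using score_norm_sq by simp
    show "integrable M (\<lambda>\<omega>. (norm (A (score (V0 \<omega>))))\<^sup>2)"
    proof (rule Bochner_Integration.integrable_bound[OF i])
      show "(\<lambda>\<omega>. (norm (A (score (V0 \<omega>))))\<^sup>2) \<in> borel_measurable M"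
        using measurable_compose[OF V0_measurable As] by measurable
      have "(norm (A y))\<^sup>2 \<le> (norm y)\<^sup>2 * K\<^sup>2" for y
        using power_mono[OF K[of y], of 2] by (simp add: power_mult_distrib)
      then show "AE \<omega> in M. norm ((norm (A (score (V0 \<omega>))))\<^sup>2) \<le> norm ((norm (score (V0 \<omega>)))\<^sup>2 * K\<^sup>2)" by simp
    qed
  qed
  then show ?thesis by (simp add: A.scaleR A.sum)
qed

end

section \<open>Asymptotic normality\<close>

context regression_model begin

definition score_sum :: "nat \<Rightarrow> 'a \<Rightarrow> 'w" where
  "score_sum n \<omega> = (1 / sqrt (real n)) *\<^sub>R (\<Sum>t<n. score (Y t \<omega>, Z t \<omega>))"

text \<open>The random majorant in the Slutsky argument. The normalised gradient (where the
  determinant is positive) and its approximation are built from the same normalised sums with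
  different matrix factors, so both the approximation and the difference are bounded by multiples of
  the norms of these sums.\<close>

definition control :: "nat \<Rightarrow> 'a \<Rightarrow> real" where
  "control n \<omega> = (\<Sum>b\<in>(Basis::'w set). norm ((1 / sqrt (real n)) *\<^sub>R (\<Sum>t<n. sq_resid1 b W0 (Y t \<omega>, Z t \<omega>))))"

lemma control_nonneg: "0 \<le> control n \<omega>"
  by (simp add: control_def sum_nonneg)

text \<open>Up to a constant, the square is at most the squared noise norm times the squared norm of
  the derivative, a product of independent integrable variables.\<close>

lemma sq_resid1_norm_sq: "integrable M (\<lambda>\<omega>. (norm (sq_resid1 b W0 (V0 \<omega>)))\<^sup>2)"
proof -
  obtain K where K: "K > 0" "\<And>(x::real^'d) y. norm (outer x y) \<le> K * (norm x * norm y)" by (rule outer_bound) blast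
  have nm: "(\<lambda>z. (norm (F1 W0 b z))\<^sup>2) \<in> borel_measurable borel"
    using F1_meas[of W0 b] by measurable
  have i: "integrable M (\<lambda>\<omega>. (2 * K)\<^sup>2 * ((norm (\<epsilon>0 \<omega>))\<^sup>2 * (norm (F1 W0 b (Z 0 \<omega>)))\<^sup>2))"
    by (intro integrable_mult_right indep_noise_input(1)[of "\<lambda>x. (norm x)\<^sup>2" "\<lambda>z. (norm (F1 W0 b z))\<^sup>2"]
        nm noise_sq[folded \<epsilon>0_def] F1_sq_integrable) simp
  show ?thesis
  proof (rule Bochner_Integration.integrable_bound[OF i])
    show "(\<lambda>\<omega>. (norm (sq_resid1 b W0 (V0 \<omega>)))\<^sup>2) \<in> borel_measurable M"
      using measurable_compose[OF V0_measurable measurable_sq_resid(2)[of b W0]] by simp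
    have "(norm (sq_resid1 b W0 (V0 \<omega>)))\<^sup>2 \<le> (2 * K)\<^sup>2 * ((norm (\<epsilon>0 \<omega>))\<^sup>2 * (norm (F1 W0 b (Z 0 \<omega>)))\<^sup>2)" for \<omega>
    proof -
      let ?e = "\<epsilon>0 \<omega>" and ?f = "F1 W0 b (Z 0 \<omega>)"
      have "norm (sq_resid1 b W0 (V0 \<omega>)) \<le> norm (outer ?f ?e) + norm (outer ?e ?f)"
        unfolding sq_resid1_def norm_minus_cancel by (simp add: \<epsilon>0_def norm_triangle_ineq)
      also have "\<dots> \<le> (2 * K) * (norm ?e * norm ?f)"
        using K(2)[of ?f ?e] K(2)[of ?e ?f] by (simp add: mult.commute mult.left_commute)
      finally have "(norm (sq_resid1 b W0 (V0 \<omega>)))\<^sup>2 \<le> ((2 * K) * (norm ?e * norm ?f))\<^sup>2"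
        by (intro power_mono) auto
      then show ?thesis by (simp add: power_mult_distrib)
    qed
    then show "AE \<omega> in M. norm ((norm (sq_resid1 b W0 (V0 \<omega>)))\<^sup>2) \<le> norm ((2 * K)\<^sup>2 * ((norm (\<epsilon>0 \<omega>))\<^sup>2 * (norm (F1 W0 b (Z 0 \<omega>)))\<^sup>2))"
      by simp
  qed
qed

lemma measurable_control: "control n \<in> borel_measurable M"
proof -
  have "(\<lambda>\<omega>. sq_resid1 b W0 (Y t \<omega>, Z t \<omega>)) \<in> borel_measurable M" for b t
    by (rule measurable_compose[OF YZ.V_measurable measurable_sq_resid(2)])
  then show ?thesis
    unfolding control_def[abs_def]
    by (intro borel_measurable_sum borel_measurable_norm measurable_compose[OF _ borel_measurable_norm]
        borel_measurable_scaleR borel_measurable_const) auto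
qed

lemma control_second_moment:
  obtains c where "\<And>n. integrable M (\<lambda>\<omega>. (control n \<omega>)\<^sup>2)" "\<And>n. expectation (\<lambda>\<omega>. (control n \<omega>)\<^sup>2) \<le> c"
proof -
  let ?X = "\<lambda>n \<omega> b. (1 / sqrt (real n)) *\<^sub>R (\<Sum>t<n. sq_resid1 b W0 (Y t \<omega>, Z t \<omega>))"
  let ?c = "\<Sum>b\<in>(Basis::'w set). expectation (\<lambda>\<omega>. (norm (sq_resid1 b W0 (V0 \<omega>)))\<^sup>2)"
  have mom: "integrable M (\<lambda>\<omega>. (norm (?X n \<omega> b))\<^sup>2)"
    "expectation (\<lambda>\<omega>. (norm (?X n \<omega> b))\<^sup>2) \<le> expectation (\<lambda>\<omega>. (norm (sq_resid1 b W0 (V0 \<omega>)))\<^sup>2)" for n b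
  proof -
    have ind: "indep_vars (\<lambda>_. borel) (\<lambda>t \<omega>. sq_resid1 b W0 (Y t \<omega>, Z t \<omega>)) UNIV"
      by (rule indep_vars_compose2[OF YZ_indep]) (rule measurable_sq_resid)
    have ident: "distr M borel (\<lambda>\<omega>. sq_resid1 b W0 (Y t \<omega>, Z t \<omega>)) = distr M borel (\<lambda>\<omega>. sq_resid1 b W0 (V0 \<omega>))" for t
      using distr_distr[OF measurable_sq_resid(2) YZ.V_measurable[of t]] distr_distr[OF measurable_sq_resid(2) YZ.V_measurable[of 0]]
        YZ_ident[of t] by (simp add: o_def)
    note m = iid_normalized_sum_second_moment[where \<xi>="\<lambda>t \<omega>. sq_resid1 b W0 (Y t \<omega>, Z t \<omega>)",
        OF ind ident sq_resid1_norm_sq sq_resid1_mean_zero]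
    show "integrable M (\<lambda>\<omega>. (norm (?X n \<omega> b))\<^sup>2)" by (rule m(1))
    show "expectation (\<lambda>\<omega>. (norm (?X n \<omega> b))\<^sup>2) \<le> expectation (\<lambda>\<omega>. (norm (sq_resid1 b W0 (V0 \<omega>)))\<^sup>2)" by (rule m(2))
  qed
  have le: "(control n \<omega>)\<^sup>2 \<le> real DIM('w) * (\<Sum>b\<in>Basis. (norm (?X n \<omega> b))\<^sup>2)" for n \<omega>
    unfolding control_def using sum_squared_le_sum_of_squares[of "\<lambda>b. norm (?X n \<omega> b)" "Basis::'w set"]
    by (simp add: mult.commute)
  have i: "integrable M (\<lambda>\<omega>. real DIM('w) * (\<Sum>b\<in>Basis. (norm (?X n \<omega> b))\<^sup>2))" for n
    by (intro integrable_mult_right Bochner_Integration.integrable_sum mom)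
  have int: "integrable M (\<lambda>\<omega>. (control n \<omega>)\<^sup>2)" for n
    by (rule Bochner_Integration.integrable_bound[OF i[of n]])
       (use le measurable_control in \<open>auto intro!: AE_I2 intro: order_trans[OF _ abs_ge_self]\<close>)
  show ?thesis
  proof (rule that[OF int])
    fix n
    have "expectation (\<lambda>\<omega>. (control n \<omega>)\<^sup>2) \<le> expectation (\<lambda>\<omega>. real DIM('w) * (\<Sum>b\<in>Basis. (norm (?X n \<omega> b))\<^sup>2))"
      by (intro integral_mono int i le)
    also have "\<dots> = real DIM('w) * (\<Sum>b\<in>Basis. expectation (\<lambda>\<omega>. (norm (?X n \<omega> b))\<^sup>2))"
      using mom(1) by (simp only: integral_mult_right_zero Bochner_Integration.integral_sum)
    also have "\<dots> \<le> real DIM('w) * ?c" by (intro mult_left_mono sum_mono mom) auto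
    finally show "expectation (\<lambda>\<omega>. (control n \<omega>)\<^sup>2) \<le> real DIM('w) * ?c" .
  qed
qed

text \<open>The bound is linear in \<open>Q\<close>: with \<open>Q = P0\<close> it controls the size
  of the score sum, and with \<open>Q\<close> the difference of the empirical inverse and
  \<open>P0\<close> it controls the replacement error.\<close>

lemma trace_combination_bound:
  obtains K where "K > 0"
    and "\<And>(Q::real^'d^'d) X. norm (\<Sum>b\<in>(Basis::'w set). trace (Q ** X b) *\<^sub>R b) \<le> K * norm Q * (\<Sum>b\<in>Basis. norm (X b))"
proof -
  obtain L where L: "\<And>A::real^'d^'d. norm (trace A) \<le> norm A * L" "L > 0"
    using bounded_linear.pos_bounded[OF bounded_linear_trace] by blast
  obtain K where K: "K > 0" "\<And>(X::real^'d^'d) (Y::real^'d^'d). norm (X ** Y) \<le> norm X * norm Y * K"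
    using matmul.pos_bounded by blast
  show ?thesis
  proof
    show "K * L > 0" using K L by simp
    fix Q :: "real^'d^'d" and X :: "'w \<Rightarrow> real^'d^'d"
    have "norm (\<Sum>b\<in>Basis. trace (Q ** X b) *\<^sub>R b) \<le> (\<Sum>b\<in>(Basis::'w set). norm (trace (Q ** X b) *\<^sub>R b))"
      by (rule norm_sum)
    also have "\<dots> \<le> (\<Sum>b\<in>(Basis::'w set). (K * L * norm Q) * norm (X b))"
    proof (rule sum_mono)
      fix b :: 'w assume "b \<in> Basis"
      then have "norm (trace (Q ** X b) *\<^sub>R b) = norm (trace (Q ** X b))" by simp
      also have "\<dots> \<le> norm (Q ** X b) * L" by (rule L)
      also have "\<dots> \<le> (norm Q * norm (X b) * K) * L" using K L by (intro mult_right_mono) auto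
      finally show "norm (trace (Q ** X b) *\<^sub>R b) \<le> (K * L * norm Q) * norm (X b)" by (simp add: mult_ac)
    qed
    finally show "norm (\<Sum>b\<in>(Basis::'w set). trace (Q ** X b) *\<^sub>R b) \<le> K * L * norm Q * (\<Sum>b\<in>Basis. norm (X b))"
      by (simp add: sum_distrib_left)
  qed
qed

lemma score_sum_eq:
  "score_sum n \<omega> = (\<Sum>b\<in>Basis. trace (P0 ** ((1 / sqrt (real n)) *\<^sub>R (\<Sum>t<n. sq_resid1 b W0 (Y t \<omega>, Z t \<omega>)))) *\<^sub>R b)"
proof -
  have tr: "trace (P0 ** (r *\<^sub>R (\<Sum>t<n. X t))) = r * (\<Sum>t<n. trace (P0 ** X t))" for r and X :: "nat \<Rightarrow> real^'d^'d"
    by (simp only: matmul.scaleR_right matmul.sum_right linear_scale[OF linear_trace] linear_sum[OF linear_trace] real_scaleR_def)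
  have eq: "score_sum n \<omega> = (1 / sqrt (real n)) *\<^sub>R (\<Sum>b\<in>Basis. (\<Sum>t<n. trace (P0 ** sq_resid1 b W0 (Y t \<omega>, Z t \<omega>))) *\<^sub>R b)"
    unfolding score_sum_def score_def by (subst sum.swap) (simp only: scaleR_sum_left)
  show ?thesis unfolding tr eq by (simp only: scaleR_sum_right scaleR_scaleR)
qed

lemma sqrt_gradient_U_eq:
  assumes "det (\<Gamma> n \<omega> W0) > 0"
  shows "sqrt (real n) *\<^sub>R gradient (U n \<omega>) W0 = (\<Sum>b\<in>Basis. trace (matrix_inv (\<Gamma> n \<omega> W0) **
      ((1 / sqrt (real n)) *\<^sub>R (\<Sum>t<n. sq_resid1 b W0 (Y t \<omega>, Z t \<omega>)))) *\<^sub>R b)"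
proof -
  \<comment> \<open>The identity also holds at \<open>n = 0\<close>, where both sides are
    \<open>0\<close> by the convention on division.\<close>
  have s: "sqrt (real n) * (1 / real n) = 1 / sqrt (real n)"
    using sqrt_divide_self_eq[of "real n"] by (simp add: inverse_eq_divide)
  have "sqrt (real n) * U1 n \<omega> b W0 = trace (matrix_inv (\<Gamma> n \<omega> W0) **
      ((1 / sqrt (real n)) *\<^sub>R (\<Sum>t<n. sq_resid1 b W0 (Y t \<omega>, Z t \<omega>))))" for b
    unfolding U1_def \<Gamma>1_def YZ.average_def matmul.scaleR_right linear_scale[OF linear_trace] s[symmetric]
    by simp
  then show ?thesis by (simp add: gradient_U[OF assms] scaleR_sum_right)
qed

lemma score_sum_bound:
  obtains K where "K > 0" "\<And>n \<omega>. norm (score_sum n \<omega>) \<le> K * control n \<omega>"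
proof -
  obtain K where K: "K > 0" "\<And>(Q::real^'d^'d) X. norm (\<Sum>b\<in>(Basis::'w set). trace (Q ** X b) *\<^sub>R b) \<le> K * norm Q * (\<Sum>b\<in>Basis. norm (X b))"
    by (rule trace_combination_bound) blast
  show ?thesis
  proof
    \<comment> \<open>The added \<open>1\<close> gives a positive constant without any bound on
      \<open>norm P0\<close> from below.\<close>
    show "K * norm P0 + 1 > 0" using K(1) by (simp add: add_nonneg_pos)
    fix n \<omega>
    have "norm (score_sum n \<omega>) \<le> K * norm P0 * control n \<omega>"
      unfolding score_sum_eq control_def by (rule K(2))
    then show "norm (score_sum n \<omega>) \<le> (K * norm P0 + 1) * control n \<omega>"
      using control_nonneg[of n \<omega>] by (simp add: distrib_right)
  qed
qed

text \<open>Gradient and score sum apply the empirical inverse and \<open>P0\<close> to the same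
  normalised sums, so their difference carries the factor
  \<open>matrix_inv (\<Gamma> n \<omega> W0) - P0\<close>, which tends to \<open>0\<close> almost
  surely.\<close>

lemma gradient_close:
  assumes e: "e > 0"
  shows "AE \<omega> in M. \<forall>\<^sub>F n in sequentially.
    norm (sqrt (real n) *\<^sub>R gradient (U n \<omega>) W0 - score_sum n \<omega>) \<le> e * control n \<omega>"
proof -
  obtain K where K: "K > 0" "\<And>(Q::real^'d^'d) X. norm (\<Sum>b\<in>(Basis::'w set). trace (Q ** X b) *\<^sub>R b) \<le> K * norm Q * (\<Sum>b\<in>Basis. norm (X b))"
    by (rule trace_combination_bound) blast
  show ?thesis
    using AE_det_\<Gamma>_W0_pos
  proof eventually_elim
    case (elim \<omega>)
    have "(\<lambda>n. matrix_inv (\<Gamma> n \<omega> W0)) \<longlonglongrightarrow> P0"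
      using elim \<Gamma>0_det_pos by (intro tendsto_matrix_inv) auto
    then have "(\<lambda>n. K * norm (matrix_inv (\<Gamma> n \<omega> W0) - P0)) \<longlonglongrightarrow> K * norm (P0 - P0)" by (intro tendsto_intros)
    then have "\<forall>\<^sub>F n in sequentially. K * norm (matrix_inv (\<Gamma> n \<omega> W0) - P0) < e"
      using e by (intro order_tendstoD(2)[of _ 0]) auto
    with conjunct2[OF elim] show ?case
    proof eventually_elim
      case (elim n)
      have "norm (sqrt (real n) *\<^sub>R gradient (U n \<omega>) W0 - score_sum n \<omega>) \<le> K * norm (matrix_inv (\<Gamma> n \<omega> W0) - P0) * control n \<omega>"
        unfolding sqrt_gradient_U_eq[OF elim(1)] score_sum_eq control_def
          sum_subtractf[symmetric] scaleR_diff_left[symmetric] linear_diff[OF linear_trace, symmetric] matmul.diff_left[symmetric]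
        by (rule K(2))
      also have "\<dots> \<le> e * control n \<omega>" using elim(2) control_nonneg by (intro mult_right_mono) auto
      finally show ?case .
    qed
  qed
qed

lemma I0_gaussian:
  obtains \<mu> where "gaussian_law \<mu> (\<lambda>v. 4 *\<^sub>R mat_op I0 v)"
proof (rule gaussian_law_exists)
  show "linear (\<lambda>v. 4 *\<^sub>R mat_op I0 v)" using mat_op_linear by (simp add: linear_compose_scale_right)
  show "x \<bullet> 4 *\<^sub>R mat_op I0 y = y \<bullet> 4 *\<^sub>R mat_op I0 x" for x y
    using I0_symmetric[of x y] by (simp add: mat_op_inner)
  show "0 \<le> x \<bullet> 4 *\<^sub>R mat_op I0 x" for x by (simp add: mat_op_inner I0_nonneg)
qed blast

lemma measurable_score_sum: "score_sum n \<in> borel_measurable M"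
  unfolding score_sum_def[abs_def]
  by (intro borel_measurable_scaleR borel_measurable_const borel_measurable_sum measurable_compose[OF YZ.V_measurable measurable_score])

theorem gradient_clt:
  "\<exists>\<mu>. gaussian_law \<mu> (\<lambda>v. 4 *\<^sub>R mat_op I0 v) \<and>
      conv_in_law M (\<lambda>n \<omega>. sqrt (real n) *\<^sub>R gradient (U n \<omega>) W0) \<mu>"
proof -
  obtain \<mu> where \<mu>: "gaussian_law \<mu> (\<lambda>v. 4 *\<^sub>R mat_op I0 v)" by (rule I0_gaussian)
  have clt: "conv_in_law M score_sum \<mu>"
    using score_clt[OF bounded_linear_ident \<mu>] by (simp add: mat_op_inner score_second_moment score_sum_def[abs_def])
  obtain K where K: "K > 0" "\<And>n \<omega>. norm (score_sum n \<omega>) \<le> K * control n \<omega>" by (rule score_sum_bound) blast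
  obtain c where c: "\<And>n. integrable M (\<lambda>\<omega>. (control n \<omega>)\<^sup>2)" "\<And>n. expectation (\<lambda>\<omega>. (control n \<omega>)\<^sup>2) \<le> c"
    by (rule control_second_moment) blast
  have "conv_in_law M (\<lambda>n \<omega>. sqrt (real n) *\<^sub>R gradient (U n \<omega>) W0) \<mu>"
  proof (rule slutsky[OF clt measurable_score_sum, where T="\<lambda>n \<omega>. K * control n \<omega>" and c="K\<^sup>2 * c"])
    show "(\<lambda>\<omega>. sqrt (real n) *\<^sub>R gradient (U n \<omega>) W0) \<in> borel_measurable M" for n
      by (intro borel_measurable_scaleR borel_measurable_const measurable_gradient_U)
    show "(\<lambda>\<omega>. K * control n \<omega>) \<in> borel_measurable M" for n
      by (intro borel_measurable_times borel_measurable_const measurable_control)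
    show "integrable M (\<lambda>\<omega>. (K * control n \<omega>)\<^sup>2)" for n using c by (simp add: power_mult_distrib)
    show "expectation (\<lambda>\<omega>. (K * control n \<omega>)\<^sup>2) \<le> K\<^sup>2 * c" for n
      using c by (simp add: power_mult_distrib mult_left_mono)
    show "norm (score_sum n \<omega>) \<le> K * control n \<omega>" for n \<omega> by (rule K)
    fix e :: real assume "e > 0"
    then have "e * K > 0" using K by simp
    from gradient_close[OF this]
    show "AE \<omega> in M. \<forall>\<^sub>F n in sequentially. norm (sqrt (real n) *\<^sub>R gradient (U n \<omega>) W0 - score_sum n \<omega>) \<le> e * (K * control n \<omega>)"
      by (simp add: mult.assoc)
  qed
  with \<mu> show ?thesis by blast
qed

end

section \<open>Consistency and limit law of the minimiser\<close>

locale regression_estimator = regression_model F F1 F2 M Y Z \<Theta> W0 \<kappa>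
  for F :: "'w::euclidean_space \<Rightarrow> 'z::euclidean_space \<Rightarrow> real^'d" and F1 F2 and M :: "'a measure"
    and Y :: "nat \<Rightarrow> 'a \<Rightarrow> real^'d" and Z :: "nat \<Rightarrow> 'a \<Rightarrow> 'z"
    and \<Theta> :: "'w set" and W0 :: 'w and \<kappa> :: "'z \<Rightarrow> real" +
  fixes What :: "nat \<Rightarrow> 'a \<Rightarrow> 'w"
  assumes I0_bij: "bij (mat_op I0)"
    and What_meas: "\<And>n. What n \<in> borel_measurable M"
    and What_in: "\<And>n \<omega>. What n \<omega> \<in> \<Theta>"
    and What_min: "\<And>n \<omega>. \<forall>W\<in>\<Theta>. det (\<Gamma> n \<omega> W) > 0 \<Longrightarrow> \<forall>W\<in>\<Theta>. U n \<omega> (What n \<omega>) \<le> U n \<omega> W"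
begin

text \<open>Away from a ball around \<open>W0\<close>, the joint limit of
  \<open>U n \<omega> W - U n \<omega> W0\<close> is strictly positive at each parameter, and
  compactness makes the strict inequality uniform, so the minimiser cannot stay there. The
  positivity of all determinants comes along because \<open>What_min\<close> speaks only about
  outcomes where it holds.\<close>

lemma AE_consistent:
  "AE \<omega> in M. (\<lambda>n. What n \<omega>) \<longlonglongrightarrow> W0 \<and> (\<forall>\<^sub>F n in sequentially. \<forall>W\<in>\<Theta>. det (\<Gamma> n \<omega> W) > 0)"
  using AE_local_limits
proof eventually_elim
  case (elim \<omega>)
  then have lim: "((\<lambda>p. \<Gamma> (fst p) \<omega> (snd p)) \<longlongrightarrow> \<Gamma>lim W) (near W)" if "W \<in> \<Theta>" for W
    using that by (simp add: case_prod_beta')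
  have det: "\<forall>\<^sub>F n in sequentially. \<forall>W\<in>\<Theta>. det (\<Gamma> n \<omega> W) > 0"
  proof (rule eventually_prod_compact[OF \<Theta>_compact])
    fix W assume W: "W \<in> \<Theta>"
    show "\<forall>\<^sub>F p in near W. det (\<Gamma> (fst p) \<omega> (snd p)) > 0"
      by (rule order_tendstoD(1)[OF tendsto_det[OF lim[OF W]] pos_def_det_pos[OF \<Gamma>lim_pos_def[OF W]]])
  qed simp
  have U_lim: "((\<lambda>p. U (fst p) \<omega> (snd p)) \<longlongrightarrow> ln (det (\<Gamma>lim W))) (near W)" if "W \<in> \<Theta>" for W
    unfolding U_def using pos_def_det_pos[OF \<Gamma>lim_pos_def[OF that]]
    by (intro tendsto_ln tendsto_det lim that) simp
  \<comment> \<open>The value at \<open>W0\<close> depends on \<open>n\<close> alone; viewing it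
    along the product filter allows the subtraction from the limit at \<open>W\<close>.\<close>
  have U_lim0: "((\<lambda>p. U (fst p) \<omega> W0) \<longlongrightarrow> ln (det \<Gamma>0)) (near W)" for W
  proof (rule filterlim_compose[OF _ filterlim_fst])
    show "(\<lambda>n. U n \<omega> W0) \<longlonglongrightarrow> ln (det \<Gamma>0)"
      using filterlim_compose[OF U_lim[OF W0_in] filterlim_at_W0] by (simp add: \<Gamma>lim_W0)
  qed
  have "(\<lambda>n. What n \<omega>) \<longlonglongrightarrow> W0"
  proof (rule tendstoI)
    fix r :: real assume r: "r > 0"
    have K: "compact (\<Theta> - ball W0 r)" by (intro compact_diff \<Theta>_compact open_ball)
    have "\<forall>\<^sub>F n in sequentially. \<forall>W\<in>\<Theta> - ball W0 r. U n \<omega> W0 < U n \<omega> W"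
    proof (rule eventually_prod_compact[OF K])
      fix W assume W: "W \<in> \<Theta> - ball W0 r"
      then have W': "W \<in> \<Theta>" "W \<noteq> W0" using r by auto
      have "0 < ln (det (\<Gamma>lim W)) - ln (det \<Gamma>0)" using ln_det_\<Gamma>lim_less[OF W'] by simp
      from order_tendstoD(1)[OF tendsto_diff[OF U_lim[OF W'(1)] U_lim0] this]
      show "\<forall>\<^sub>F p in near W. U (fst p) \<omega> W0 < U (fst p) \<omega> (snd p)"
        by eventually_elim simp
    qed auto
    with det show "\<forall>\<^sub>F n in sequentially. dist (What n \<omega>) W0 < r"
    proof eventually_elim
      case (elim n)
      have "U n \<omega> (What n \<omega>) \<le> U n \<omega> W0" using What_min[OF elim(1)] W0_in by blast
      then have "What n \<omega> \<notin> \<Theta> - ball W0 r" using elim(2) by (metis not_le)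
      then show ?case using What_in[of n \<omega>] by (simp add: dist_commute)
    qed
  qed
  with det show ?case by blast
qed

lemma linear_combination_bound:
  fixes D :: "'w \<Rightarrow> real"
  assumes "linear D" and "\<And>b. b \<in> Basis \<Longrightarrow> \<bar>D b\<bar> \<le> \<eta>"
  shows "\<bar>D h\<bar> \<le> (real DIM('w) * \<eta>) * norm h"
proof -
  have "D h = (\<Sum>b\<in>Basis. (h \<bullet> b) * D b)"
    using linear_sum[OF assms(1), of "\<lambda>b. (h \<bullet> b) *\<^sub>R b" Basis] by (simp add: linear_scale[OF assms(1)] euclidean_representation)
  then have "\<bar>D h\<bar> \<le> (\<Sum>b\<in>Basis. \<bar>(h \<bullet> b) * D b\<bar>)" by simp
  also have "\<dots> \<le> (\<Sum>b\<in>(Basis::'w set). norm h * \<eta>)"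
    unfolding abs_mult by (intro sum_mono mult_mono assms(2) Basis_le_norm) auto
  also have "\<dots> = (real DIM('w) * \<eta>) * norm h" by simp
  finally show ?thesis .
qed

text \<open>The mean value inequality for \<open>U1 n \<omega> b - 2 * I0 b\<close>, whose
  derivative is small on a whole ball around \<open>W0\<close> by the joint convergence of the
  second derivatives. The radius does not depend on \<open>n\<close>.\<close>

lemma U1_expansion:
  assumes lim: "\<forall>b\<in>Basis. \<forall>b'\<in>Basis. ((\<lambda>(n, W). U2 n \<omega> b b' W) \<longlongrightarrow> 2 * I0 b b') (near W0)"
    and det: "\<forall>\<^sub>F n in sequentially. \<forall>W\<in>\<Theta>. det (\<Gamma> n \<omega> W) > 0" and \<eta>: "\<eta> > 0"
  obtains r where "r > 0" "ball W0 r \<subseteq> \<Theta>"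
    "\<forall>\<^sub>F n in sequentially. \<forall>W\<in>ball W0 r. \<forall>b\<in>Basis.
       \<bar>U1 n \<omega> b W - U1 n \<omega> b W0 - 2 * I0 b (W - W0)\<bar> \<le> (real DIM('w) * \<eta>) * norm (W - W0)"
proof -
  have "\<forall>\<^sub>F p in near W0. \<forall>b\<in>Basis. \<forall>b'\<in>Basis. \<bar>U2 (fst p) \<omega> b b' (snd p) - 2 * I0 b b'\<bar> < \<eta>"
  proof (intro eventually_ball_finite finite_Basis ballI)
    fix b b' :: 'w assume "b \<in> Basis" "b' \<in> Basis"
    then have "((\<lambda>p. U2 (fst p) \<omega> b b' (snd p)) \<longlongrightarrow> 2 * I0 b b') (near W0)"
      using lim by (simp add: case_prod_beta')
    from tendstoD[OF this \<eta>] show "\<forall>\<^sub>F p in near W0. \<bar>U2 (fst p) \<omega> b b' (snd p) - 2 * I0 b b'\<bar> < \<eta>"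
      by (simp add: dist_real_def)
  qed
  then obtain Q R where Q: "eventually Q sequentially" and R: "eventually R (inf (nhds W0) (principal \<Theta>))"
    and QR: "\<And>n W. Q n \<Longrightarrow> R W \<Longrightarrow> \<forall>b\<in>Basis. \<forall>b'\<in>Basis. \<bar>U2 n \<omega> b b' W - 2 * I0 b b'\<bar> < \<eta>"
    unfolding eventually_prod_filter by auto
  have "\<forall>\<^sub>F W in nhds W0. W \<in> \<Theta> \<longrightarrow> R W" using R by (simp add: eventually_inf_principal)
  \<comment> \<open>The joint limit controls only parameters in \<Theta>; interiority of
    \<open>W0\<close> turns this into a full ball, which is convex as the mean value inequality
    demands.\<close>
  moreover have "\<forall>\<^sub>F W in nhds W0. W \<in> interior \<Theta>" using W0_interior by (intro eventually_nhds_in_open) auto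
  ultimately have "\<forall>\<^sub>F W in nhds W0. W \<in> \<Theta> \<and> R W"
    by eventually_elim (use interior_subset in blast)
  then obtain r where r: "r > 0" "\<And>W. dist W W0 < r \<Longrightarrow> W \<in> \<Theta> \<and> R W" by (auto simp: eventually_nhds_metric)
  show ?thesis
  proof
    show "r > 0" by fact
    show sub: "ball W0 r \<subseteq> \<Theta>" using r(2) by (auto simp: dist_commute)
    from Q det show "\<forall>\<^sub>F n in sequentially. \<forall>W\<in>ball W0 r. \<forall>b\<in>Basis.
       \<bar>U1 n \<omega> b W - U1 n \<omega> b W0 - 2 * I0 b (W - W0)\<bar> \<le> (real DIM('w) * \<eta>) * norm (W - W0)"
    proof eventually_elim
      case (elim n)
      show ?case
      proof (intro ballI)
        fix W b assume W: "W \<in> ball W0 r" and b: "b \<in> (Basis :: 'w set)"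
        have lin: "linear (I0 b)" using I0_bilinear by (simp add: bilinear_def)
        have der: "((\<lambda>W. U1 n \<omega> b W - 2 * I0 b W) has_derivative (\<lambda>h. U2 n \<omega> b h V - 2 * I0 b h)) (at V)"
          if V: "V \<in> ball W0 r" for V
        proof -
          have "det (\<Gamma> n \<omega> V) > 0" using elim(2) V sub by blast
          from U1_deriv[OF this] show ?thesis
            by (intro has_derivative_diff has_derivative_mult_right linear_imp_has_derivative lin)
        qed
        have on: "onorm (\<lambda>h. U2 n \<omega> b h V - 2 * I0 b h) \<le> real DIM('w) * \<eta>" if V: "V \<in> ball W0 r" for V
        proof (rule onorm_le)
          fix h
          have "R V" using r(2)[of V] V by (simp add: dist_commute)
          then have "\<bar>U2 n \<omega> b b' V - 2 * I0 b b'\<bar> \<le> \<eta>" if "b' \<in> Basis" for b'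
            using QR[OF elim(1)] b that by (simp add: less_imp_le)
          from linear_combination_bound[OF has_derivative_linear[OF der[OF V]] this]
          show "norm (U2 n \<omega> b h V - 2 * I0 b h) \<le> real DIM('w) * \<eta> * norm h" by simp
        qed
        have "norm ((U1 n \<omega> b W - 2 * I0 b W) - (U1 n \<omega> b W0 - 2 * I0 b W0)) \<le> (real DIM('w) * \<eta>) * norm (W - W0)"
          by (rule differentiable_bound[OF convex_ball has_derivative_at_withinI[OF der] on])
             (use W r(1) in auto)
        moreover have "I0 b (W - W0) = I0 b W - I0 b W0" by (rule linear_diff[OF lin])
        ultimately show "\<bar>U1 n \<omega> b W - U1 n \<omega> b W0 - 2 * I0 b (W - W0)\<bar> \<le> (real DIM('w) * \<eta>) * norm (W - W0)"
          by (simp add: algebra_simps)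
      qed
    qed
  qed
qed

abbreviation "Ainv \<equiv> inv (mat_op I0)"

lemma Ainv_linear: "linear Ainv"
  by (rule inj_linear_imp_inv_linear[OF mat_op_linear bij_is_inj[OF I0_bij]])

lemma Ainv_left: "Ainv (mat_op I0 x) = x"
  by (rule inv_f_f[OF bij_is_inj[OF I0_bij]])

lemma Ainv_right: "mat_op I0 (Ainv x) = x"
  by (rule surj_f_inv_f[OF bij_is_surj[OF I0_bij]])

lemma Ainv_symmetric: "x \<bullet> Ainv y = y \<bullet> Ainv x"
proof -
  have "x \<bullet> Ainv y = Ainv y \<bullet> mat_op I0 (Ainv x)" by (simp add: Ainv_right inner_commute)
  also have "\<dots> = Ainv x \<bullet> mat_op I0 (Ainv y)" unfolding mat_op_inner by (rule I0_symmetric)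
  also have "\<dots> = y \<bullet> Ainv x" by (simp add: Ainv_right inner_commute)
  finally show ?thesis .
qed

lemma Ainv_nonneg: "0 \<le> x \<bullet> Ainv x"
  using I0_nonneg[of "Ainv x"] mat_op_inner[of "Ainv x" "Ainv x"] by (simp add: Ainv_right inner_commute)

text \<open>The gradient vanishes at the interior minimiser \<open>What n \<omega>\<close>, so the expansion at \<open>W0\<close> can be solved for \<open>What n \<omega>\<close>.\<close>
lemma newton_step:
  assumes cons: "(\<lambda>n. What n \<omega>) \<longlonglongrightarrow> W0"
    and lim: "\<forall>b\<in>Basis. \<forall>b'\<in>Basis. ((\<lambda>(n, W). U2 n \<omega> b b' W) \<longlongrightarrow> 2 * I0 b b') (near W0)"
    and det: "\<forall>\<^sub>F n in sequentially. \<forall>W\<in>\<Theta>. det (\<Gamma> n \<omega> W) > 0" and \<theta>: "\<theta> > 0"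
  shows "\<forall>\<^sub>F n in sequentially.
    norm (What n \<omega> - W0 + (1/2) *\<^sub>R Ainv (gradient (U n \<omega>) W0)) \<le> \<theta> * norm (What n \<omega> - W0)"
proof -
  obtain K where K: "K > 0" "\<And>x. norm (Ainv x) \<le> norm x * K"
    using bounded_linear.pos_bounded[OF linear_conv_bounded_linear[THEN iffD1, OF Ainv_linear]] by blast
  let ?d = "real DIM('w)"
  \<comment> \<open>Makes \<open>K * ?d * ?d * \<eta> = \<theta>\<close>: one dimension factor comes
    from the derivative bound, one from summing coordinates, and \<open>K\<close> from applying
    \<open>Ainv\<close>.\<close>
  define \<eta> where "\<eta> = \<theta> / (K * ?d * ?d)"
  have \<eta>: "\<eta> > 0" using \<theta> K by (simp add: \<eta>_def)
  obtain r where r: "r > 0" "ball W0 r \<subseteq> \<Theta>"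
    "\<forall>\<^sub>F n in sequentially. \<forall>W\<in>ball W0 r. \<forall>b\<in>Basis.
       \<bar>U1 n \<omega> b W - U1 n \<omega> b W0 - 2 * I0 b (W - W0)\<bar> \<le> (?d * \<eta>) * norm (W - W0)"
    by (rule U1_expansion[OF lim det \<eta>]) blast
  have "\<forall>\<^sub>F n in sequentially. dist (What n \<omega>) W0 < r" using cons r(1) by (rule tendstoD)
  with r(3) det show ?thesis
  proof eventually_elim
    case (elim n)
    let ?W = "What n \<omega>" and ?g = "gradient (U n \<omega>) W0"
    have W: "?W \<in> ball W0 r" using elim(3) by (simp add: dist_commute)
    have det0: "det (\<Gamma> n \<omega> W0) > 0" and detW: "det (\<Gamma> n \<omega> ?W) > 0" using elim(2) W0_in What_in by auto
    have "(\<lambda>b. U1 n \<omega> b ?W) = (\<lambda>_. 0)"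
      by (rule differential_zero_maxmin[OF W open_ball U_deriv[OF detW]])
         (use What_min[OF elim(2)] r(2) in blast)
    then have zero: "U1 n \<omega> b ?W = 0" for b by (simp add: fun_eq_iff)
    \<comment> \<open>Since \<open>U1\<close> vanishes at the minimiser, each coordinate of this
      vector is, up to sign, the expansion error. Applying \<open>Ainv\<close> and halving turns it
      into the Newton residual.\<close>
    let ?r = "?g + 2 *\<^sub>R mat_op I0 (?W - W0)"
    have comp: "\<bar>?r \<bullet> b\<bar> \<le> (?d * \<eta>) * norm (?W - W0)" if b: "b \<in> Basis" for b
    proof -
      have "?r \<bullet> b = U1 n \<omega> b W0 + 2 * I0 b (?W - W0)"
      proof -
        have "?g \<bullet> b = U1 n \<omega> b W0" using b by (simp add: gradient_U[OF det0] inner_sum_left_Basis)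
        moreover have "mat_op I0 (?W - W0) \<bullet> b = I0 b (?W - W0)" using mat_op_inner[of b] by (simp add: inner_commute)
        ultimately show ?thesis by (simp add: inner_add_left)
      qed
      then have "\<bar>?r \<bullet> b\<bar> = \<bar>U1 n \<omega> b ?W - U1 n \<omega> b W0 - 2 * I0 b (?W - W0)\<bar>" by (simp add: zero)
      also have "\<dots> \<le> (?d * \<eta>) * norm (?W - W0)" using elim(1) W b by blast
      finally show ?thesis .
    qed
    have "norm ?r \<le> (\<Sum>b\<in>Basis. \<bar>?r \<bullet> b\<bar>)" by (rule norm_le_l1)
    also have "\<dots> \<le> (\<Sum>b\<in>(Basis::'w set). (?d * \<eta>) * norm (?W - W0))" by (rule sum_mono) (rule comp)
    also have "\<dots> = ?d * ?d * \<eta> * norm (?W - W0)" by simp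
    finally have nr: "norm ?r \<le> ?d * ?d * \<eta> * norm (?W - W0)" .
    have "?W - W0 + (1/2) *\<^sub>R Ainv ?g = (1/2) *\<^sub>R Ainv ?r"
      by (simp add: linear_add[OF Ainv_linear] linear_scale[OF Ainv_linear] Ainv_left scaleR_add_right)
    then have "norm (?W - W0 + (1/2) *\<^sub>R Ainv ?g) = (1/2) * norm (Ainv ?r)" by simp
    also have "\<dots> \<le> norm (Ainv ?r)" by simp
    also have "\<dots> \<le> norm ?r * K" by (rule K)
    also have "\<dots> \<le> ?d * ?d * \<eta> * norm (?W - W0) * K" using nr K(1) by (intro mult_right_mono) auto
    also have "\<dots> = \<theta> * norm (?W - W0)" using K(1) by (simp add: \<eta>_def)
    finally show ?case .
  qed
qed

text \<open>The Newton error is a fraction of the estimation error itself. With a fraction at most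
  one half it can be absorbed, so the scaled error is at most twice the Newton term and thus bounded
  by the majorant. Replacing the gradient by the score sum costs the second half of
  \<open>e\<close>.\<close>

lemma estimator_close:
  assumes e: "e > 0"
  shows "AE \<omega> in M. \<forall>\<^sub>F n in sequentially.
    norm (sqrt (real n) *\<^sub>R (What n \<omega> - W0) - (- (1/2)) *\<^sub>R Ainv (score_sum n \<omega>)) \<le> e * control n \<omega>"
proof -
  obtain K where K: "K > 0" "\<And>x. norm (Ainv x) \<le> norm x * K"
    using bounded_linear.pos_bounded[OF linear_conv_bounded_linear[THEN iffD1, OF Ainv_linear]] by blast
  obtain L where L: "L > 0" "\<And>n \<omega>. norm (score_sum n \<omega>) \<le> L * control n \<omega>" by (rule score_sum_bound) blast
  \<comment> \<open>\<open>K * \<delta> \<le> e / 2\<close> pays for replacing gradient by score sum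
    under \<open>Ainv\<close>, and \<open>\<delta> \<le> 1\<close> bounds the scaled gradient by
    \<open>(L + 1) * control n \<omega>\<close>.\<close>
  define \<delta> where "\<delta> = min 1 (e / (2 * K))"
  \<comment> \<open>\<open>\<theta> \<le> 1/2\<close> permits the absorption; the second bound makes
    the Newton error \<open>2 * \<theta> * K * (L + 1)\<close> at most \<open>e / 2\<close> times
    the majorant.\<close>
  define \<theta> where "\<theta> = min (1/2) (e / (4 * (K * (L + 1))))"
  have \<delta>: "\<delta> > 0" "\<delta> \<le> 1" "K * \<delta> \<le> e / 2" using e K(1) by (auto simp: \<delta>_def min_def field_simps)
  have \<theta>: "\<theta> > 0" "\<theta> \<le> 1/2" using e K(1) L(1) by (auto simp: \<theta>_def)
  have "\<theta> * (K * (L + 1)) \<le> (e / (4 * (K * (L + 1)))) * (K * (L + 1))"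
    using K(1) L(1) by (intro mult_right_mono) (auto simp: \<theta>_def)
  also have "\<dots> = e / 4" using K(1) L(1) by simp
  finally have \<theta>3: "\<theta> * (K * (L + 1)) \<le> e / 4" .
  show ?thesis
    using AE_consistent AE_local_limits gradient_close[OF \<delta>(1)]
  proof eventually_elim
    case (elim \<omega>)
    have "\<forall>\<^sub>F n in sequentially.
      norm (What n \<omega> - W0 + (1/2) *\<^sub>R Ainv (gradient (U n \<omega>) W0)) \<le> \<theta> * norm (What n \<omega> - W0)"
      using elim \<theta>(1) by (intro newton_step) blast+
    with elim(3) show ?case
    proof eventually_elim
      case (elim n)
      let ?h = "sqrt (real n) *\<^sub>R (What n \<omega> - W0)" and ?G = "sqrt (real n) *\<^sub>R gradient (U n \<omega>) W0"
      let ?g = "(- (1/2)) *\<^sub>R Ainv ?G" and ?s = "score_sum n \<omega>" and ?T = "control n \<omega>"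
      have T: "?T \<ge> 0" by (rule control_nonneg)
      have "?h - ?g = sqrt (real n) *\<^sub>R (What n \<omega> - W0 + (1/2) *\<^sub>R Ainv (gradient (U n \<omega>) W0))"
        by (simp add: linear_scale[OF Ainv_linear] algebra_simps)
      then have hg: "norm (?h - ?g) \<le> \<theta> * norm ?h"
        using mult_left_mono[OF elim(2), of "sqrt (real n)"] by (simp add: mult.left_commute)
      have "norm ?h \<le> norm ?g + norm (?h - ?g)" by (rule norm_triangle_sub)
      moreover have "\<theta> * norm ?h \<le> (1/2) * norm ?h" using \<theta>(2) by (intro mult_right_mono) auto
      ultimately have "norm ?h \<le> 2 * norm ?g" using hg by linarith
      then have "\<theta> * norm ?h \<le> \<theta> * (2 * norm ?g)" using \<theta>(1) by (intro mult_left_mono) auto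
      with hg have hg2: "norm (?h - ?g) \<le> 2 * \<theta> * norm ?g" by simp
      have "norm ?G \<le> norm ?s + norm (?G - ?s)" by (rule norm_triangle_sub)
      also have "\<dots> \<le> L * ?T + 1 * ?T"
        using L(2)[of n \<omega>] elim(1) mult_right_mono[OF \<delta>(2) T] by (intro add_mono) auto
      finally have G: "norm ?G \<le> (L + 1) * ?T" by (simp add: distrib_right)
      have "norm ?g \<le> norm (Ainv ?G)" by simp
      also have "\<dots> \<le> norm ?G * K" by (rule K)
      also have "\<dots> \<le> (L + 1) * ?T * K" using G K(1) by (intro mult_right_mono) auto
      finally have "2 * \<theta> * norm ?g \<le> 2 * \<theta> * ((L + 1) * ?T * K)" using \<theta>(1) by (intro mult_left_mono) auto
      also have "\<dots> = 2 * (\<theta> * (K * (L + 1))) * ?T" by (simp add: mult_ac)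
      also have "\<dots> \<le> 2 * (e / 4) * ?T" using \<theta>3 T by (intro mult_right_mono) auto
      finally have 1: "norm (?h - ?g) \<le> e / 2 * ?T" using hg2 by simp
      have "?g - (- (1/2)) *\<^sub>R Ainv ?s = (- (1/2)) *\<^sub>R Ainv (?G - ?s)"
        by (simp only: linear_diff[OF Ainv_linear] scaleR_diff_right)
      then have "norm (?g - (- (1/2)) *\<^sub>R Ainv ?s) \<le> norm (Ainv (?G - ?s))" by simp
      also have "\<dots> \<le> norm (?G - ?s) * K" by (rule K)
      also have "\<dots> \<le> \<delta> * ?T * K" using elim(1) K(1) by (intro mult_right_mono) auto
      also have "\<dots> = (K * \<delta>) * ?T" by simp
      also have "\<dots> \<le> e / 2 * ?T" using \<delta>(3) T by (intro mult_right_mono)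
      finally have 2: "norm (?g - (- (1/2)) *\<^sub>R Ainv ?s) \<le> e / 2 * ?T" .
      have "norm (?h - (- (1/2)) *\<^sub>R Ainv ?s) \<le> norm (?h - ?g) + norm (?g - (- (1/2)) *\<^sub>R Ainv ?s)"
        using norm_triangle_ineq[of "?h - ?g" "?g - (- (1/2)) *\<^sub>R Ainv ?s"] by simp
      also have "\<dots> \<le> e / 2 * ?T + e / 2 * ?T" by (rule add_mono[OF 1 2])
      also have "\<dots> = e * ?T" by simp
      finally show ?case .
    qed
  qed
qed

theorem estimator_clt:
  "\<exists>\<mu>. gaussian_law \<mu> Ainv \<and> conv_in_law M (\<lambda>n \<omega>. sqrt (real n) *\<^sub>R (What n \<omega> - W0)) \<mu>"
proof -
  obtain \<mu> where \<mu>: "gaussian_law \<mu> Ainv"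
    by (rule gaussian_law_exists[OF Ainv_linear Ainv_symmetric Ainv_nonneg])
  let ?B = "\<lambda>x. (- (1/2)) *\<^sub>R Ainv x"
  have blA: "bounded_linear Ainv" using Ainv_linear by (simp add: linear_conv_bounded_linear)
  have bl: "bounded_linear ?B" by (rule bounded_linear_const_scaleR[OF blA])
  obtain K where K: "K > 0" "\<And>x. norm (Ainv x) \<le> norm x * K"
    using bounded_linear.pos_bounded[OF blA] by blast
  obtain L where L: "L > 0" "\<And>n \<omega>. norm (score_sum n \<omega>) \<le> L * control n \<omega>" by (rule score_sum_bound) blast
  obtain c where c: "\<And>n. integrable M (\<lambda>\<omega>. (control n \<omega>)\<^sup>2)" "\<And>n. expectation (\<lambda>\<omega>. (control n \<omega>)\<^sup>2) \<le> c"
    by (rule control_second_moment) blast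
  have clt: "conv_in_law M (\<lambda>n \<omega>. ?B (score_sum n \<omega>)) \<mu>"
    unfolding score_sum_def
  proof (rule score_clt[OF bl \<mu>])
    fix t
    \<comment> \<open>Moving the symmetric \<open>Ainv\<close> onto \<open>t\<close> gives the
      factor \<open>1/4\<close>, which cancels the \<open>4\<close> in the second moment of the
      score and leaves \<open>I0 (Ainv t) (Ainv t) = t \<bullet> Ainv t\<close>.\<close>
    have sq: "(t \<bullet> ?B x)\<^sup>2 = (1/4) * (Ainv t \<bullet> x)\<^sup>2" for x
      using Ainv_symmetric[of t x] by (simp add: power2_eq_square inner_commute)
    have "expectation (\<lambda>\<omega>. (t \<bullet> ?B (score (Y 0 \<omega>, Z 0 \<omega>)))\<^sup>2) = I0 (Ainv t) (Ainv t)"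
      unfolding sq using score_second_moment(2)[of "Ainv t"] by simp
    also have "\<dots> = t \<bullet> Ainv t" by (simp add: mat_op_inner[symmetric] Ainv_right inner_commute)
    finally show "t \<bullet> Ainv t = expectation (\<lambda>\<omega>. (t \<bullet> ?B (score (Y 0 \<omega>, Z 0 \<omega>)))\<^sup>2)" by simp
  qed
  let ?R = "K * L"
  have R: "?R > 0" using K L by simp
  have "conv_in_law M (\<lambda>n \<omega>. sqrt (real n) *\<^sub>R (What n \<omega> - W0)) \<mu>"
  proof (rule slutsky[OF clt, where T="\<lambda>n \<omega>. ?R * control n \<omega>" and c="?R\<^sup>2 * c"])
    show "(\<lambda>\<omega>. ?B (score_sum n \<omega>)) \<in> borel_measurable M" for n
      by (rule measurable_compose[OF measurable_score_sum borel_measurable_continuous_onI[OF linear_continuous_on[OF bl]]])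
    show "(\<lambda>\<omega>. sqrt (real n) *\<^sub>R (What n \<omega> - W0)) \<in> borel_measurable M" for n
      by (intro borel_measurable_scaleR borel_measurable_diff borel_measurable_const What_meas)
    show "(\<lambda>\<omega>. ?R * control n \<omega>) \<in> borel_measurable M" for n
      by (intro borel_measurable_times borel_measurable_const measurable_control)
    show "integrable M (\<lambda>\<omega>. (?R * control n \<omega>)\<^sup>2)" for n using c by (simp add: power_mult_distrib)
    show "expectation (\<lambda>\<omega>. (?R * control n \<omega>)\<^sup>2) \<le> ?R\<^sup>2 * c" for n
      unfolding power_mult_distrib[of ?R] using c by (simp add: mult_left_mono)
    show "norm (?B (score_sum n \<omega>)) \<le> ?R * control n \<omega>" for n \<omega>
    proof -
      have "norm (?B (score_sum n \<omega>)) \<le> norm (Ainv (score_sum n \<omega>))" by simp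
      also have "\<dots> \<le> norm (score_sum n \<omega>) * K" by (rule K)
      also have "\<dots> \<le> (L * control n \<omega>) * K" using K L by (intro mult_right_mono) auto
      finally show ?thesis by (simp add: mult_ac)
    qed
    fix e :: real assume "e > 0"
    then have "e * ?R > 0" using R by simp
    from estimator_close[OF this]
    show "AE \<omega> in M. \<forall>\<^sub>F n in sequentially. norm (sqrt (real n) *\<^sub>R (What n \<omega> - W0) - ?B (score_sum n \<omega>)) \<le> e * (?R * control n \<omega>)"
      by (simp only: mult.assoc)
  qed
  with \<mu> show ?thesis by blast
qed

end

section \<open>The perceptron\<close>

definition preact :: "('e::finite, 'h::finite, 'd::finite) mlp_weights \<Rightarrow> 'h \<Rightarrow> real^'e \<Rightarrow> real" where
  "preact W j z = snd (fst W) $ j + fst (fst W) $ j \<bullet> z"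

text \<open>The preactivation is linear in the weights, so its derivative in direction
  \<open>b\<close> is \<open>preact b j z\<close>, the same expression evaluated at the
  direction.\<close>

definition mlp1 :: "(real \<Rightarrow> real) \<Rightarrow> (real \<Rightarrow> real) \<Rightarrow> ('e::finite, 'h::finite, 'd::finite) mlp_weights
    \<Rightarrow> ('e, 'h, 'd) mlp_weights \<Rightarrow> real^'e \<Rightarrow> real^'d" where
  "mlp1 \<phi> \<phi>1 W b z = (\<chi> i. snd (snd b) $ i +
      (\<Sum>j\<in>UNIV. fst (snd W) $ i $ j * (preact b j z * \<phi>1 (preact W j z)) + fst (snd b) $ i $ j * \<phi> (preact W j z)))"

definition mlp2 :: "(real \<Rightarrow> real) \<Rightarrow> (real \<Rightarrow> real) \<Rightarrow> ('e::finite, 'h::finite, 'd::finite) mlp_weights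
    \<Rightarrow> ('e, 'h, 'd) mlp_weights \<Rightarrow> ('e, 'h, 'd) mlp_weights \<Rightarrow> real^'e \<Rightarrow> real^'d" where
  "mlp2 \<phi>1 \<phi>2 W b b' z = (\<chi> i.
      (\<Sum>j\<in>UNIV. (fst (snd W) $ i $ j * (preact b j z * (preact b' j z * \<phi>2 (preact W j z)))
          + fst (snd b') $ i $ j * (preact b j z * \<phi>1 (preact W j z)))
        + fst (snd b) $ i $ j * (preact b' j z * \<phi>1 (preact W j z))))"

lemma mlp_preact: "mlp \<phi> W z = (\<chi> i. snd (snd W) $ i + (\<Sum>j\<in>UNIV. fst (snd W) $ i $ j * \<phi> (preact W j z)))"
  by (simp add: mlp_def preact_def)

lemma has_derivative_vec:
  fixes f :: "'w::euclidean_space \<Rightarrow> real^'d"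
  assumes "\<And>i. ((\<lambda>x. f x $ i) has_derivative (\<lambda>h. f' h $ i)) (at x)"
  shows "(f has_derivative f') (at x)"
proof (subst has_derivative_componentwise_within, rule ballI)
  fix b :: "real^'d" assume "b \<in> Basis"
  then obtain i where "b = axis i 1" by (auto simp: Basis_vec_def)
  then show "((\<lambda>x. f x \<bullet> b) has_derivative (\<lambda>h. f' h \<bullet> b)) (at x)"
    using assms[of i] by (simp add: inner_axis)
qed

lemma bounded_linear_out_bias: "bounded_linear (\<lambda>W::('e::finite, 'h::finite, 'd::finite) mlp_weights. snd (snd W) $ i)"
  by (intro bounded_linear_compose[OF bounded_linear_vec_nth] bounded_linear_compose[OF bounded_linear_snd] bounded_linear_snd)

lemma bounded_linear_out_weight: "bounded_linear (\<lambda>W::('e::finite, 'h::finite, 'd::finite) mlp_weights. fst (snd W) $ i $ j)"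
  by (intro bounded_linear_compose[OF bounded_linear_vec_nth] bounded_linear_compose[OF bounded_linear_fst] bounded_linear_snd)

lemma bounded_linear_preact: "bounded_linear (\<lambda>W::('e::finite, 'h::finite, 'd::finite) mlp_weights. preact W j z)"
  unfolding preact_def
  by (intro bounded_linear_add bounded_linear_compose[OF bounded_linear_inner_left]
      bounded_linear_compose[OF bounded_linear_vec_nth] bounded_linear_compose[OF bounded_linear_snd]
      bounded_linear_compose[OF bounded_linear_fst] bounded_linear_fst)

lemma preact_deriv:
  assumes "\<And>x. (\<phi> has_real_derivative \<phi>1 x) (at x)"
  shows "((\<lambda>W. \<phi> (preact W j z)) has_derivative (\<lambda>b. preact b j z * \<phi>1 (preact W j z))) (at W)"
  by (rule DERIV_compose_FDERIV[OF assms bounded_linear_imp_has_derivative[OF bounded_linear_preact]])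

lemma mlp_deriv:
  assumes "\<And>x. (\<phi> has_real_derivative \<phi>1 x) (at x)"
  shows "((\<lambda>W. mlp \<phi> W z) has_derivative (\<lambda>b. mlp1 \<phi> \<phi>1 W b z)) (at W)"
proof (rule has_derivative_vec)
  fix i
  show "((\<lambda>W. mlp \<phi> W z $ i) has_derivative (\<lambda>b. mlp1 \<phi> \<phi>1 W b z $ i)) (at W)"
    unfolding mlp_preact mlp1_def vec_lambda_beta
    by (intro has_derivative_add has_derivative_sum has_derivative_mult preact_deriv assms
        bounded_linear_imp_has_derivative bounded_linear_out_bias bounded_linear_out_weight)
qed

lemma mlp1_deriv:
  assumes "\<And>x. (\<phi> has_real_derivative \<phi>1 x) (at x)" "\<And>x. (\<phi>1 has_real_derivative \<phi>2 x) (at x)"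
  shows "((\<lambda>W. mlp1 \<phi> \<phi>1 W b z) has_derivative (\<lambda>b'. mlp2 \<phi>1 \<phi>2 W b b' z)) (at W)"
proof (rule has_derivative_vec)
  fix i
  have "((\<lambda>W. mlp1 \<phi> \<phi>1 W b z $ i) has_derivative (\<lambda>b'. 0 +
     (\<Sum>j\<in>UNIV. (fst (snd W) $ i $ j * (preact b j z * (preact b' j z * \<phi>2 (preact W j z)))
          + fst (snd b') $ i $ j * (preact b j z * \<phi>1 (preact W j z)))
        + fst (snd b) $ i $ j * (preact b' j z * \<phi>1 (preact W j z))))) (at W)"
    unfolding mlp1_def vec_lambda_beta
    by (intro has_derivative_add has_derivative_sum has_derivative_mult has_derivative_mult_right has_derivative_const preact_deriv assms
        bounded_linear_imp_has_derivative bounded_linear_out_weight)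
  then show "((\<lambda>W. mlp1 \<phi> \<phi>1 W b z $ i) has_derivative (\<lambda>b'. mlp2 \<phi>1 \<phi>2 W b b' z $ i)) (at W)"
    by (simp add: mlp2_def)
qed

lemma preact_continuous: "continuous_on UNIV (\<lambda>z. preact W j z)"
  unfolding preact_def by (intro continuous_intros)

lemma
  assumes \<phi>: "continuous_on UNIV \<phi>" and \<phi>1: "continuous_on UNIV \<phi>1" and \<phi>2: "continuous_on UNIV \<phi>2"
  shows mlp_continuous: "continuous_on UNIV (mlp \<phi> W)"
    and mlp1_continuous: "continuous_on UNIV (mlp1 \<phi> \<phi>1 W b)"
    and mlp2_continuous: "continuous_on UNIV (mlp2 \<phi>1 \<phi>2 W b b')"
    and mlp2_continuous_weights: "continuous_on UNIV (\<lambda>W. mlp2 \<phi>1 \<phi>2 W b b' z)"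
proof -
  have c: "continuous_on UNIV (\<lambda>z. f (preact W j z))" if "continuous_on UNIV f" for f :: "real \<Rightarrow> real" and W j
    by (rule continuous_on_compose2[OF that preact_continuous]) simp
  have cW: "continuous_on UNIV (\<lambda>W. f (preact W j z))" if "continuous_on UNIV f" for f :: "real \<Rightarrow> real" and z j
    by (rule continuous_on_compose2[OF that linear_continuous_on[OF bounded_linear_preact]]) simp
  show "continuous_on UNIV (mlp \<phi> W)"
    unfolding mlp_preact[abs_def]
    by (intro continuous_on_vec_lambda continuous_on_add continuous_on_sum continuous_on_mult continuous_on_const c \<phi>)
  show "continuous_on UNIV (mlp1 \<phi> \<phi>1 W b)"
    unfolding mlp1_def[abs_def]
    by (intro continuous_on_vec_lambda continuous_on_add continuous_on_sum continuous_on_mult continuous_on_const c \<phi> \<phi>1 preact_continuous)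
  show "continuous_on UNIV (mlp2 \<phi>1 \<phi>2 W b b')"
    unfolding mlp2_def[abs_def]
    by (intro continuous_on_vec_lambda continuous_on_add continuous_on_sum continuous_on_mult continuous_on_const c \<phi>1 \<phi>2 preact_continuous)
  show "continuous_on UNIV (\<lambda>W. mlp2 \<phi>1 \<phi>2 W b b' z)"
    unfolding mlp2_def
    by (intro continuous_on_vec_lambda continuous_on_add continuous_on_sum continuous_on_mult continuous_on_const cW \<phi>1 \<phi>2
        linear_continuous_on[OF bounded_linear_out_weight])
qed

lemma norm_fst_snd_le: "norm (fst x) \<le> norm x" "norm (snd x) \<le> norm x"
  using norm_fst_le[of "fst x" "snd x"] norm_snd_le[of "snd x" "fst x"] by simp_all

lemma abs_out_bias_le: "\<bar>snd (snd W) $ i\<bar> \<le> norm W" for W :: "('e::finite, 'h::finite, 'd::finite) mlp_weights"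
  using component_le_norm_cart[of "snd (snd W)" i] norm_fst_snd_le(2)[of "snd W"] norm_fst_snd_le(2)[of W] by linarith

lemma abs_out_weight_le: "\<bar>fst (snd W) $ i $ j\<bar> \<le> norm W" for W :: "('e::finite, 'h::finite, 'd::finite) mlp_weights"
  using component_le_norm_cart[of "fst (snd W) $ i" j] Finite_Cartesian_Product.norm_nth_le[of "fst (snd W)" i] norm_fst_snd_le(1)[of "snd W"] norm_fst_snd_le(2)[of W] by linarith

lemma abs_preact_le: "\<bar>preact W j z\<bar> \<le> norm W * (1 + norm z)" for W :: "('e::finite, 'h::finite, 'd::finite) mlp_weights"
proof -
  have "\<bar>snd (fst W) $ j\<bar> \<le> norm W"
    using component_le_norm_cart[of "snd (fst W)" j] norm_fst_snd_le(2)[of "fst W"] norm_fst_snd_le(1)[of W] by linarith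
  moreover have "\<bar>fst (fst W) $ j \<bullet> z\<bar> \<le> norm (fst (fst W) $ j) * norm z" by (rule Cauchy_Schwarz_ineq2)
  moreover have "norm (fst (fst W) $ j) * norm z \<le> norm W * norm z"
    using Finite_Cartesian_Product.norm_nth_le[of "fst (fst W)" j] norm_fst_snd_le(1)[of "fst W"] norm_fst_snd_le(1)[of W] by (intro mult_right_mono) auto
  ultimately show ?thesis unfolding preact_def by (simp add: distrib_left)
qed

lemma norm_vec_le_sum:
  fixes f :: "'d::finite \<Rightarrow> real"
  assumes "\<And>i. \<bar>f i\<bar> \<le> B"
  shows "norm (\<chi> i. f i) \<le> real CARD('d) * B"
proof -
  have "norm (\<chi> i. f i) \<le> (\<Sum>i\<in>UNIV. \<bar>(\<chi> i. f i) $ i\<bar>)" by (rule norm_le_l1_cart)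
  also have "\<dots> \<le> (\<Sum>i\<in>(UNIV::'d set). B)" using assms by (intro sum_mono) simp
  finally show ?thesis by simp
qed

lemma abs_sum_le_card:
  fixes f :: "'h::finite \<Rightarrow> real"
  assumes "\<And>j. \<bar>f j\<bar> \<le> B"
  shows "\<bar>\<Sum>j\<in>UNIV. f j\<bar> \<le> real CARD('h) * B"
proof -
  have "\<bar>\<Sum>j\<in>UNIV. f j\<bar> \<le> (\<Sum>j\<in>UNIV. \<bar>f j\<bar>)" by (rule sum_abs)
  also have "\<dots> \<le> (\<Sum>j\<in>(UNIV::'h set). B)" using assms by (intro sum_mono)
  finally show ?thesis by simp
qed

lemma abs_mult_le: "\<bar>x\<bar> \<le> a \<Longrightarrow> \<bar>y\<bar> \<le> b \<Longrightarrow> \<bar>x * y\<bar> \<le> a * b" for x y a b :: real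
  unfolding abs_mult by (intro mult_mono) auto

lemma mlp_bound:
  fixes W :: "('e::finite, 'h::finite, 'd::finite) mlp_weights"
  assumes W: "norm W \<le> R" and K: "\<And>x. \<bar>\<phi> x\<bar> \<le> K"
  shows "norm (mlp \<phi> W z) \<le> real CARD('d) * (R + real CARD('h) * (R * K))"
  unfolding mlp_preact
proof (rule norm_vec_le_sum)
  fix i
  have "\<bar>\<Sum>j\<in>UNIV. fst (snd W) $ i $ j * \<phi> (preact W j z)\<bar> \<le> real CARD('h) * (R * K)"
    by (intro abs_sum_le_card abs_mult_le K order_trans[OF abs_out_weight_le W])
  then show "\<bar>snd (snd W) $ i + (\<Sum>j\<in>UNIV. fst (snd W) $ i $ j * \<phi> (preact W j z))\<bar> \<le> R + real CARD('h) * (R * K)"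
    using abs_out_bias_le[of W i] W by linarith
qed

text \<open>Each derivative through the activation brings out one factor
  \<open>preact b j z\<close>, of size at most \<open>norm b * (1 + norm z)\<close>; the activation
  terms are bounded and the weights range over a bounded set. Hence the first derivative grows with
  one power of \<open>1 + norm z\<close>, and the second with two.\<close>

lemma mlp1_bound:
  fixes W b :: "('e::finite, 'h::finite, 'd::finite) mlp_weights"
  assumes W: "norm W \<le> R" and K: "\<And>x. \<bar>\<phi> x\<bar> \<le> K" "\<And>x. \<bar>\<phi>1 x\<bar> \<le> K"
  shows "norm (mlp1 \<phi> \<phi>1 W b z) \<le> (real CARD('d) * (norm b + real CARD('h) * (R * (norm b * K) + norm b * K))) * (1 + norm z)"
proof -
  let ?k = "1 + norm z"
  have k: "?k \<ge> 1" by simp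
  have K0: "K \<ge> 0" using K(1)[of 0] by linarith
  have "norm (mlp1 \<phi> \<phi>1 W b z) \<le> real CARD('d) * ((norm b + real CARD('h) * (R * (norm b * K) + norm b * K)) * ?k)"
    unfolding mlp1_def
  proof (rule norm_vec_le_sum)
    fix i
    have "\<bar>fst (snd W) $ i $ j * (preact b j z * \<phi>1 (preact W j z)) + fst (snd b) $ i $ j * \<phi> (preact W j z)\<bar>
        \<le> (R * (norm b * K) + norm b * K) * ?k" for j
    proof -
      have 1: "\<bar>fst (snd W) $ i $ j * (preact b j z * \<phi>1 (preact W j z))\<bar> \<le> R * ((norm b * ?k) * K)"
        by (intro abs_mult_le K abs_preact_le order_trans[OF abs_out_weight_le W])
      have 2: "\<bar>fst (snd b) $ i $ j * \<phi> (preact W j z)\<bar> \<le> norm b * K"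
        by (intro abs_mult_le K abs_out_weight_le)
      have 3: "norm b * K \<le> (norm b * K) * ?k" using mult_left_mono[OF k, of "norm b * K"] K0 by simp
      have "(R * (norm b * K) + norm b * K) * ?k = R * ((norm b * ?k) * K) + (norm b * K) * ?k" by (simp add: algebra_simps)
      then show ?thesis using 1 2 3 by linarith
    qed
    then have s: "\<bar>\<Sum>j\<in>UNIV. fst (snd W) $ i $ j * (preact b j z * \<phi>1 (preact W j z)) + fst (snd b) $ i $ j * \<phi> (preact W j z)\<bar>
        \<le> real CARD('h) * ((R * (norm b * K) + norm b * K) * ?k)"
      by (rule abs_sum_le_card)
    have 4: "\<bar>snd (snd b) $ i\<bar> \<le> norm b * ?k"
      using abs_out_bias_le[of b i] mult_left_mono[OF k, of "norm b"] by simp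
    show "\<bar>snd (snd b) $ i + (\<Sum>j\<in>UNIV. fst (snd W) $ i $ j * (preact b j z * \<phi>1 (preact W j z)) + fst (snd b) $ i $ j * \<phi> (preact W j z))\<bar>
      \<le> (norm b + real CARD('h) * (R * (norm b * K) + norm b * K)) * ?k"
    proof -
      have eq: "(norm b + real CARD('h) * B) * k = norm b * k + real CARD('h) * (B * k)" for B k :: real
        by (simp add: distrib_right)
      show ?thesis unfolding eq by (rule order_trans[OF abs_triangle_ineq add_mono[OF 4 s]])
    qed
  qed
  then show ?thesis by (simp only: mult.assoc)
qed

lemma mlp2_bound:
  fixes W b b' :: "('e::finite, 'h::finite, 'd::finite) mlp_weights"
  assumes W: "norm W \<le> R" and K: "\<And>x. \<bar>\<phi>1 x\<bar> \<le> K" "\<And>x. \<bar>\<phi>2 x\<bar> \<le> K"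
  shows "norm (mlp2 \<phi>1 \<phi>2 W b b' z)
    \<le> (real CARD('d) * (real CARD('h) * (R * (norm b * (norm b' * K)) + norm b' * (norm b * K) + norm b * (norm b' * K)))) * (1 + norm z)\<^sup>2"
proof -
  let ?k = "1 + norm z" and ?n = "norm b" and ?n' = "norm b'"
  let ?B = "R * (?n * (?n' * K)) + ?n' * (?n * K) + ?n * (?n' * K)"
  have K0: "K \<ge> 0" using K(1)[of 0] by linarith
  have kk: "?k \<le> ?k\<^sup>2" using mult_left_mono[of 1 ?k ?k] by (simp add: power2_eq_square)
  have "norm (mlp2 \<phi>1 \<phi>2 W b b' z) \<le> real CARD('d) * (real CARD('h) * (?B * ?k\<^sup>2))"
    unfolding mlp2_def
  proof (intro norm_vec_le_sum abs_sum_le_card)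
    fix i j
    have 1: "\<bar>fst (snd W) $ i $ j * (preact b j z * (preact b' j z * \<phi>2 (preact W j z)))\<bar> \<le> R * ((?n * ?k) * ((?n' * ?k) * K))"
      by (intro abs_mult_le K abs_preact_le order_trans[OF abs_out_weight_le W])
    have 2: "\<bar>fst (snd b') $ i $ j * (preact b j z * \<phi>1 (preact W j z))\<bar> \<le> ?n' * ((?n * ?k) * K)"
      by (intro abs_mult_le K abs_preact_le abs_out_weight_le)
    have 3: "\<bar>fst (snd b) $ i $ j * (preact b' j z * \<phi>1 (preact W j z))\<bar> \<le> ?n * ((?n' * ?k) * K)"
      by (intro abs_mult_le K abs_preact_le abs_out_weight_le)
    have e1: "R * ((?n * ?k) * ((?n' * ?k) * K)) = R * (?n * (?n' * K)) * ?k\<^sup>2" by (simp add: power2_eq_square)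
    have e2: "?n' * ((?n * ?k) * K) \<le> ?n' * (?n * K) * ?k\<^sup>2"
      using mult_left_mono[OF kk, of "?n' * (?n * K)"] K0 by (simp add: mult_ac)
    have e3: "?n * ((?n' * ?k) * K) \<le> ?n * (?n' * K) * ?k\<^sup>2"
      using mult_left_mono[OF kk, of "?n * (?n' * K)"] K0 by (simp add: mult_ac)
    show "\<bar>fst (snd W) $ i $ j * (preact b j z * (preact b' j z * \<phi>2 (preact W j z)))
          + fst (snd b') $ i $ j * (preact b j z * \<phi>1 (preact W j z))
        + fst (snd b) $ i $ j * (preact b' j z * \<phi>1 (preact W j z))\<bar> \<le> ?B * ?k\<^sup>2"
      using 1 2 3 e2 e3 unfolding e1 distrib_right by linarith
  qed
  then show ?thesis by (simp only: mult.assoc)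
qed

theorem mainTheorem3:
  fixes M :: "'a measure"
    and \<phi> :: "real \<Rightarrow> real"
    and Y :: "nat \<Rightarrow> 'a \<Rightarrow> real^'d::finite"
    and Z :: "nat \<Rightarrow> 'a \<Rightarrow> real^'e::finite"
    and \<Theta> :: "('e, 'h::finite, 'd) mlp_weights set"
    and W0 :: "('e, 'h, 'd) mlp_weights"
    and What :: "nat \<Rightarrow> 'a \<Rightarrow> ('e, 'h, 'd) mlp_weights"
  defines "\<epsilon> \<equiv> (\<lambda>t \<omega>. Y t \<omega> - mlp \<phi> W0 (Z t \<omega>))"
    and "\<Gamma>0 \<equiv> (\<integral>\<omega>. outer (Y 0 \<omega> - mlp \<phi> W0 (Z 0 \<omega>)) (Y 0 \<omega> - mlp \<phi> W0 (Z 0 \<omega>)) \<partial>M)"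
    and "dF \<equiv> (\<lambda>b \<omega>. frechet_derivative (\<lambda>W. mlp \<phi> W (Z 0 \<omega>)) (at W0) b)"
  defines "I0 \<equiv> (\<lambda>b b'. trace (matrix_inv \<Gamma>0 ** (\<integral>\<omega>. outer (dF b \<omega>) (dF b' \<omega>) \<partial>M)))"
  assumes prob: "prob_space M"
    and sigm: "sigmoidal \<phi>"
    and Y_meas: "\<And>t. Y t \<in> borel_measurable M"
    and Z_meas: "\<And>t. Z t \<in> borel_measurable M"
    and indep: "prob_space.indep_vars M (\<lambda>_. borel) (\<lambda>t \<omega>. (Y t \<omega>, Z t \<omega>)) UNIV"
    and ident: "\<And>t. distr M borel (\<lambda>\<omega>. (Y t \<omega>, Z t \<omega>)) = distr M borel (\<lambda>\<omega>. (Y 0 \<omega>, Z 0 \<omega>))"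
    and noise_centered: "\<And>t. (\<integral>\<omega>. \<epsilon> t \<omega> \<partial>M) = 0"
    and noise_indep: "\<And>t. distr M borel (\<lambda>\<omega>. (\<epsilon> t \<omega>, Z t \<omega>)) = distr M borel (\<epsilon> t) \<Otimes>\<^sub>M distr M borel (Z t)"
    and noise_cov_inv: "invertible \<Gamma>0"
    and compact: "compact \<Theta>"
    and W0_int: "W0 \<in> interior \<Theta>"
    and identifiable: "\<And>W. W \<in> \<Theta> \<Longrightarrow>
         (AE \<omega> in M. mlp \<phi> W (Z 0 \<omega>) = mlp \<phi> W0 (Z 0 \<omega>)) \<Longrightarrow> W = W0"
    and eps_sq: "integrable M (\<lambda>\<omega>. (norm (\<epsilon> 0 \<omega>))\<^sup>2)"
    and Z_cube: "integrable M (\<lambda>\<omega>. (norm (Z 0 \<omega>)) ^ 3)"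
    and I0_inv: "bij (mat_op I0)"
    and What_meas: "\<And>n. What n \<in> borel_measurable M"
    and What_in: "\<And>n \<omega>. What n \<omega> \<in> \<Theta>"
    and What_min: "\<And>n \<omega>. (\<forall>W\<in>\<Theta>. det (Gamma_n \<phi> Y Z n \<omega> W) > 0) \<Longrightarrow>
         (\<forall>W\<in>\<Theta>. U_n \<phi> Y Z n \<omega> (What n \<omega>) \<le> U_n \<phi> Y Z n \<omega> W)"
  shows "(AE \<omega> in M. \<forall>b\<in>Basis. \<forall>b'\<in>Basis.
            (\<lambda>n. hessian (U_n \<phi> Y Z n \<omega>) W0 b b') \<longlonglongrightarrow> 2 * I0 b b')
       \<and> (\<exists>\<mu>. gaussian_law \<mu> (\<lambda>v. 4 *\<^sub>R mat_op I0 v) \<and>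
            conv_in_law M (\<lambda>n \<omega>. sqrt (real n) *\<^sub>R gradient (U_n \<phi> Y Z n \<omega>) W0) \<mu>)
       \<and> (\<exists>\<mu>. gaussian_law \<mu> (inv (mat_op I0)) \<and>
            conv_in_law M (\<lambda>n \<omega>. sqrt (real n) *\<^sub>R (What n \<omega> - W0)) \<mu>)"
proof -
  interpret prob_space M by (rule prob)
  obtain \<phi>1 \<phi>2 where d1: "\<And>x. (\<phi> has_real_derivative \<phi>1 x) (at x)" and d2: "\<And>x. (\<phi>1 has_real_derivative \<phi>2 x) (at x)"
    and bdd: "bounded (range \<phi>)" "bounded (range \<phi>1)" "bounded (range \<phi>2)" and c2: "continuous_on UNIV \<phi>2"
  proof -
    obtain \<phi>1 \<phi>2 \<phi>3 where *: "\<forall>x. (\<phi> has_real_derivative \<phi>1 x) (at x)" "\<forall>x. (\<phi>1 has_real_derivative \<phi>2 x) (at x)"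
      "\<forall>x. (\<phi>2 has_real_derivative \<phi>3 x) (at x)" "bounded (range \<phi>1)" "bounded (range \<phi>2)" "bounded (range \<phi>)"
      using sigm unfolding sigmoidal_def by blast
    then have "continuous_on UNIV \<phi>2" by (meson DERIV_isCont continuous_at_imp_continuous_on)
    then show ?thesis using that * by blast
  qed
  have c0: "continuous_on UNIV \<phi>" and c1: "continuous_on UNIV \<phi>1"
    using d1 d2 by (meson DERIV_isCont continuous_at_imp_continuous_on)+
  obtain K0 K1 K2 where "\<And>x. \<bar>\<phi> x\<bar> \<le> K0" "\<And>x. \<bar>\<phi>1 x\<bar> \<le> K1" "\<And>x. \<bar>\<phi>2 x\<bar> \<le> K2"
    using bdd unfolding bounded_iff by auto
  then obtain K where K: "\<And>x. \<bar>\<phi> x\<bar> \<le> K" "\<And>x. \<bar>\<phi>1 x\<bar> \<le> K" "\<And>x. \<bar>\<phi>2 x\<bar> \<le> K"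
    using that[of "max K0 (max K1 K2)"] by (meson le_max_iff_disj)
  obtain R where R: "\<And>W. W \<in> \<Theta> \<Longrightarrow> norm W \<le> R"
    using compact_imp_bounded[OF compact] unfolding bounded_iff by blast
  interpret S: smooth_family "mlp \<phi>" "mlp1 \<phi> \<phi>1" "mlp2 \<phi>1 \<phi>2 :: ('e, 'h, 'd) mlp_weights \<Rightarrow> _"
  proof unfold_locales
    fix W b b' :: "('e, 'h, 'd) mlp_weights" and z :: "real^'e"
    show "((\<lambda>W. mlp \<phi> W z) has_derivative (\<lambda>b. mlp1 \<phi> \<phi>1 W b z)) (at W)" by (rule mlp_deriv[OF d1])
    show "((\<lambda>W. mlp1 \<phi> \<phi>1 W b z) has_derivative (\<lambda>b'. mlp2 \<phi>1 \<phi>2 W b b' z)) (at W)" by (rule mlp1_deriv[OF d1 d2])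
    show "continuous_on UNIV (\<lambda>W::('e, 'h, 'd) mlp_weights. mlp2 \<phi>1 \<phi>2 W b b' z)"
      by (rule mlp2_continuous_weights[OF c0 c1 c2])
    show "mlp \<phi> W \<in> borel_measurable borel"
      by (rule borel_measurable_continuous_onI[OF mlp_continuous[OF c0 c1 c2]])
    show "mlp1 \<phi> \<phi>1 W b \<in> borel_measurable borel"
      by (rule borel_measurable_continuous_onI[OF mlp1_continuous[OF c0 c1 c2]])
    show "mlp2 \<phi>1 \<phi>2 W b b' \<in> borel_measurable borel"
      by (rule borel_measurable_continuous_onI[OF mlp2_continuous[OF c0 c1 c2]])
  qed
  interpret D: regression_data "mlp \<phi>" "mlp1 \<phi> \<phi>1" "mlp2 \<phi>1 \<phi>2 :: ('e, 'h, 'd) mlp_weights \<Rightarrow> _" M Y Z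
    by unfold_locales (rule indep ident)+
  have \<Gamma>_eq: "D.\<Gamma> = Gamma_n \<phi> Y Z"
    by (simp add: fun_eq_iff D.\<Gamma>_def D.YZ.average_def Gamma_n_def S.sq_resid_def S.resid_def)
  have U_eq: "D.U = U_n \<phi> Y Z"
    by (simp add: fun_eq_iff D.U_def U_n_def \<Gamma>_eq)
  have \<epsilon>_eq: "(\<lambda>\<omega>. S.resid W0 (Y 0 \<omega>, Z 0 \<omega>)) = \<epsilon> 0"
    by (simp add: S.resid_def \<epsilon>_def)
  have \<Gamma>0_eq: "expectation (\<lambda>\<omega>. S.sq_resid W0 (Y 0 \<omega>, Z 0 \<omega>)) = \<Gamma>0"
    by (simp add: S.sq_resid_def S.resid_def \<Gamma>0_def)
  let ?\<kappa> = "\<lambda>z::real^'e. 1 + norm z"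
  have \<kappa>_sq: "integrable M (\<lambda>\<omega>. (?\<kappa> (Z 0 \<omega>))\<^sup>2)"
  proof (rule Bochner_Integration.integrable_bound)
    show "integrable M (\<lambda>\<omega>. 4 + 4 * (norm (Z 0 \<omega>)) ^ 3)" using Z_cube by simp
    show "(\<lambda>\<omega>. (?\<kappa> (Z 0 \<omega>))\<^sup>2) \<in> borel_measurable M" using Z_meas[of 0] by measurable
    \<comment> \<open>Below \<open>1\<close> the square is at most \<open>4\<close>; above
      \<open>1\<close> it is at most \<open>(2 * x)^2\<close>, and \<open>x^2\<close> is at most
      \<open>x^3\<close>.\<close>
    have "(1 + x)\<^sup>2 \<le> 4 + 4 * x ^ 3" if "x \<ge> 0" for x :: real
    proof (cases "x \<le> 1")
      case True
      then have "(1 + x)\<^sup>2 \<le> 2\<^sup>2" using that by (intro power_mono) auto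
      also have "\<dots> = 4" by simp
      finally have "(1 + x)\<^sup>2 \<le> 4" .
      moreover have "0 \<le> x ^ 3" by (rule zero_le_power[OF that])
      ultimately show ?thesis by linarith
    next
      case False
      then have "(1 + x)\<^sup>2 \<le> (2 * x)\<^sup>2" by (intro power_mono) auto
      also have "\<dots> = 4 * x\<^sup>2" by (simp add: power_mult_distrib)
      also have "\<dots> \<le> 4 * x ^ 3" using False by (intro mult_left_mono power_increasing) auto
      finally show ?thesis by simp
    qed
    then show "AE \<omega> in M. norm ((?\<kappa> (Z 0 \<omega>))\<^sup>2) \<le> norm (4 + 4 * (norm (Z 0 \<omega>)) ^ 3)" by simp
  qed
  interpret R: regression_model "mlp \<phi>" "mlp1 \<phi> \<phi>1" "mlp2 \<phi>1 \<phi>2 :: ('e, 'h, 'd) mlp_weights \<Rightarrow> _" M Y Z \<Theta> W0 ?\<kappa>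
  proof unfold_locales
    show "integrable M (\<lambda>\<omega>. (norm (S.resid W0 (Y 0 \<omega>, Z 0 \<omega>)))\<^sup>2)" using eps_sq by (simp add: S.resid_def \<epsilon>_def)
    show "expectation (\<lambda>\<omega>. S.resid W0 (Y 0 \<omega>, Z 0 \<omega>)) = 0" unfolding \<epsilon>_eq by (rule noise_centered)
    show "distr M borel (\<lambda>\<omega>. (S.resid W0 (Y 0 \<omega>, Z 0 \<omega>), Z 0 \<omega>))
        = distr M borel (\<lambda>\<omega>. S.resid W0 (Y 0 \<omega>, Z 0 \<omega>)) \<Otimes>\<^sub>M distr M borel (Z 0)"
      using noise_indep[of 0] by (simp add: S.resid_def \<epsilon>_def)
    show "invertible (expectation (\<lambda>\<omega>. S.sq_resid W0 (Y 0 \<omega>, Z 0 \<omega>)))" unfolding \<Gamma>0_eq by (rule noise_cov_inv)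
    show "\<exists>C. \<forall>W\<in>\<Theta>. \<forall>z. norm (mlp \<phi> W z) \<le> C"
      by (intro exI ballI allI) (rule mlp_bound[OF R K(1)])
    show "\<exists>C. \<forall>W\<in>\<Theta>. \<forall>z. norm (mlp1 \<phi> \<phi>1 W b z) \<le> C * ?\<kappa> z" for b
      by (intro exI ballI allI) (rule mlp1_bound[OF R K(1,2)])
    show "\<exists>C. \<forall>W\<in>\<Theta>. \<forall>z. norm (mlp2 \<phi>1 \<phi>2 W b b' z) \<le> C * (?\<kappa> z)\<^sup>2" for b b'
      by (intro exI ballI allI) (rule mlp2_bound[OF R K(2,3)])
  qed (use compact W0_int identifiable \<kappa>_sq in auto)
  \<comment> \<open>Uniqueness of the derivative identifies \<open>frechet_derivative\<close> with
    the explicit formula, so the information matrix of the abstract model is the given one.\<close>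
  have dF_eq: "dF b \<omega> = mlp1 \<phi> \<phi>1 W0 b (Z 0 \<omega>)" for b \<omega>
    using frechet_derivative_at[OF mlp_deriv[OF d1, where W=W0 and z="Z 0 \<omega>"]] unfolding dF_def by metis
  have I0_eq: "R.I0 = I0"
    by (simp add: fun_eq_iff R.I0_def R.J_def I0_def dF_eq R.\<Gamma>0_def \<Gamma>0_eq)
  interpret E: regression_estimator "mlp \<phi>" "mlp1 \<phi> \<phi>1" "mlp2 \<phi>1 \<phi>2 :: ('e, 'h, 'd) mlp_weights \<Rightarrow> _" M Y Z \<Theta> W0 ?\<kappa> What
  proof unfold_locales
    show "bij (mat_op R.I0)" unfolding I0_eq by (rule I0_inv)
    show "\<forall>W\<in>\<Theta>. 0 < det (D.\<Gamma> n \<omega> W) \<Longrightarrow> \<forall>W\<in>\<Theta>. D.U n \<omega> (What n \<omega>) \<le> D.U n \<omega> W" for n \<omega>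
      unfolding \<Gamma>_eq U_eq by (rule What_min)
  qed (rule What_meas What_in)+
  show ?thesis
    using R.hessian_tendsto R.gradient_clt E.estimator_clt unfolding I0_eq U_eq by blast
qed

end
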